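(* Fix a base $s$. There is a computable function $f:\mathbb{N}\to\mathbb{Q}$ monotonically decreasing to $0$ such that for any function $g:\mathbb{N}\to\mathbb{Q}$ monotonically decreasing to $0$ there is an absolutely normal real number $\xi$ whose discrepancy function for base $s$ eventually dominates $g$ and whose discrepancy function for each base multiplicatively independent to $s$ is eventually dominated by $f$. Furthermore, $\xi$ is computable from $g$.
   Context: A base is an integer $\geq 2$. Two bases are multiplicatively dependent if one is a rational power of the other, and multiplicatively independent otherwise. For a real $x$, $\{x\}$ is its fractional part. For $\vec\xi=(\xi_1,\dots,\xi_N)$ in $[0,1]$, $D(\vec\xi)=\sup_{0\leq u<v\leq 1}\bigl|\#\{n:1\leq n\leq N,\ u\leq \xi_n<v\}/N-(v-u)\bigr|$. The discrepancy function of $\xi$ for base $r$ is $N\mapsto D(\{r^j\xi\}:0\leq j<N)$. $\xi$ is normal to base $r$ iff this tends to $0$, and absolutely normal if normal to every base. A function $h$ eventually dominates $g$ if $h(N)\geq g(N)$ for all sufficiently large $N$. "Computable from $g$" means computable relative to an oracle for $g$. *)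

theory Defs
  imports Complex_Main "HOL-Library.Nat_Bijection"
begin

section \<open>Bases, discrepancy and normality\<close>

definition is_base :: "nat \<Rightarrow> bool" where
  "is_base b \<longleftrightarrow> b \<ge> 2"

definition mult_dependent :: "nat \<Rightarrow> nat \<Rightarrow> bool" where
  "mult_dependent r s \<longleftrightarrow>
     (\<exists>q::rat. real r = real s powr real_of_rat q \<or> real s = real r powr real_of_rat q)"

definition mult_independent :: "nat \<Rightarrow> nat \<Rightarrow> bool" where
  "mult_independent r s \<longleftrightarrow> \<not> mult_dependent r s"

text \<open>The discrepancy of the first \<open>N\<close> terms \<open>x 0, \<dots>, x (N - 1)\<close> of a sequence in the unit
  interval; the value at \<open>N = 0\<close> carries no meaning.\<close>

definition discrepancy :: "(nat \<Rightarrow> real) \<Rightarrow> nat \<Rightarrow> real" where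
  "discrepancy x N =
     (SUP (u, v) \<in> {(u, v). 0 \<le> u \<and> u < v \<and> v \<le> 1}.
        \<bar>real (card {n. n < N \<and> u \<le> x n \<and> x n < v}) / real N - (v - u)\<bar>)"

definition discrepancy_fun :: "nat \<Rightarrow> real \<Rightarrow> nat \<Rightarrow> real" where
  "discrepancy_fun r \<xi> N = discrepancy (\<lambda>j. frac (real r ^ j * \<xi>)) N"

definition normal_to_base :: "nat \<Rightarrow> real \<Rightarrow> bool" where
  "normal_to_base r \<xi> \<longleftrightarrow> discrepancy_fun r \<xi> \<longlonglongrightarrow> 0"

definition absolutely_normal :: "real \<Rightarrow> bool" where
  "absolutely_normal \<xi> \<longleftrightarrow> (\<forall>r. is_base r \<longrightarrow> normal_to_base r \<xi>)"

definition eventually_dominates :: "(nat \<Rightarrow> real) \<Rightarrow> (nat \<Rightarrow> real) \<Rightarrow> bool" where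
  "eventually_dominates h g \<longleftrightarrow> (\<forall>\<^sub>F N in sequentially. h N \<ge> g N)"

definition decreasing_to_0 :: "(nat \<Rightarrow> rat) \<Rightarrow> bool" where
  "decreasing_to_0 g \<longleftrightarrow> decseq g \<and> (\<lambda>n. real_of_rat (g n)) \<longlonglongrightarrow> 0"


section \<open>Relative computability\<close>

text \<open>\<open>recursive_in A k F\<close>: the \<open>k\<close>-ary total function \<open>F\<close> is recursive relative to the oracles
  in \<open>A\<close>. This is the class generated from the initial functions and the oracles by composition,
  primitive recursion and minimization restricted to the regular case, where a witness exists for
  every argument; it contains exactly the total functions that are partial recursive in \<open>A\<close>.
  A \<open>k\<close>-ary function is represented on argument lists, and only its values on lists of length \<open>k\<close>
  are meaningful.\<close>

inductive recursive_in :: "(nat \<Rightarrow> nat) set \<Rightarrow> nat \<Rightarrow> (nat list \<Rightarrow> nat) \<Rightarrow> bool"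
  for A :: "(nat \<Rightarrow> nat) set" where
  zero: "recursive_in A k (\<lambda>_. 0)"
| succ: "recursive_in A 1 (\<lambda>xs. Suc (xs ! 0))"
| proj: "i < k \<Longrightarrow> recursive_in A k (\<lambda>xs. xs ! i)"
| oracle_call: "a \<in> A \<Longrightarrow> recursive_in A 1 (\<lambda>xs. a (xs ! 0))"
| comp: "recursive_in A (length Gs) F \<Longrightarrow> (\<And>G. G \<in> set Gs \<Longrightarrow> recursive_in A k G) \<Longrightarrow>
    recursive_in A k (\<lambda>xs. F (map (\<lambda>G. G xs) Gs))"
| prim_rec: "recursive_in A k F \<Longrightarrow> recursive_in A (Suc (Suc k)) G \<Longrightarrow>
    recursive_in A (Suc k) (\<lambda>xs. rec_nat (F (tl xs)) (\<lambda>n y. G (n # y # tl xs)) (hd xs))"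
| mu: "recursive_in A (Suc k) F \<Longrightarrow> (\<And>xs. length xs = k \<Longrightarrow> \<exists>n. F (n # xs) = 0) \<Longrightarrow>
    recursive_in A k (\<lambda>xs. LEAST n. F (n # xs) = 0)"

definition computable_in :: "(nat \<Rightarrow> nat) set \<Rightarrow> (nat \<Rightarrow> nat) \<Rightarrow> bool" where
  "computable_in A h \<longleftrightarrow> (\<exists>F. recursive_in A 1 F \<and> (\<forall>n. F [n] = h n))"

text \<open>An explicit effective coding of the rationals by their reduced fractions. The generic
  \<open>to_nat\<close> for countable types would not do, as it is obtained from an arbitrary choice.\<close>

definition rat_encode :: "rat \<Rightarrow> nat" where
  "rat_encode q = (case quotient_of q of (a, b) \<Rightarrow> prod_encode (int_encode a, nat b))"

lemma inj_rat_encode: "inj rat_encode"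
proof (rule injI)
  fix p q :: rat
  assume eq: "rat_encode p = rat_encode q"
  obtain a b c d where q: "quotient_of p = (a, b)" "quotient_of q = (c, d)"
    by fastforce
  then have "b > 0" "d > 0"
    using quotient_of_denom_pos by blast+
  with eq q have "quotient_of p = quotient_of q"
    by (auto simp: rat_encode_def int_encode_eq)
  then show "p = q"
    by (rule quotient_of_inject)
qed

definition computable_rat_fun_in :: "(nat \<Rightarrow> nat) set \<Rightarrow> (nat \<Rightarrow> rat) \<Rightarrow> bool" where
  "computable_rat_fun_in A f \<longleftrightarrow> computable_in A (\<lambda>n. rat_encode (f n))"

definition computable_rat_fun :: "(nat \<Rightarrow> rat) \<Rightarrow> bool" where
  "computable_rat_fun f \<longleftrightarrow> computable_rat_fun_in {} f"

definition real_computable_in :: "(nat \<Rightarrow> nat) set \<Rightarrow> real \<Rightarrow> bool" where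
  "real_computable_in A \<xi> \<longleftrightarrow>
     (\<exists>q::nat \<Rightarrow> rat. computable_rat_fun_in A q \<and> (\<forall>n. \<bar>\<xi> - real_of_rat (q n)\<bar> \<le> 1 / 2 ^ n))"

definition real_computable_from :: "(nat \<Rightarrow> rat) \<Rightarrow> real \<Rightarrow> bool" where
  "real_computable_from g \<xi> \<longleftrightarrow> real_computable_in {\<lambda>n. rat_encode (g n)} \<xi>"

end

theory Submission
  imports Defs
    "HOL-Analysis.Kronecker_Approximation_Theorem"
    "HOL-Library.FuncSet"
    "HOL-Real_Asymp.Real_Asymp"
begin

text \<open>The number \<open>\<xi>\<close> is built in base \<open>s\<close> by appending, at stage \<open>k\<close>, a block of \<open>2k + 1\<close>
  digits found by exhaustive search, so that \<open>\<xi>\<close> is primitive recursive in \<open>g\<close>. A block of level \<open>T\<close>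
  contains no long run of the digit \<open>s - 1\<close>. This leaves a gap next to \<open>1\<close> in the orbit of
  \<open>\<xi>\<close> in base \<open>s\<close>, hence bounds the discrepancy from below; levels grow so slowly that the bound
  stays above \<open>g\<close>. The block is moreover required to make the orbits in all bases \<open>r \<le> T\<close> uniformly
  distributed up to an error depending on \<open>T\<close>, and for the bases independent of \<open>s\<close> up to an error
  depending on \<open>k\<close> only, which gives \<open>f\<close>.

  Such blocks exist by averaging over the blocks whose digits in base \<open>S\<close>, a power of \<open>s\<close>, all
  differ from \<open>S - 1\<close>. The second moments of the exponential sums are products of factors
  \<open>phi S (t / S ^ i)\<close>. Two consecutive factors near the leading digit of \<open>t\<close> give a saving that
  improves with \<open>S\<close>, for every \<open>r\<close>. If \<open>r\<close> and \<open>s\<close> are independent, then the leading digits of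
  \<open>t = h * r ^ m\<close> are governed by the irrational rotation by \<open>ln r / ln S\<close>, and averaging over \<open>m\<close> a
  product of many factors gives, by Parseval's identity, an arbitrarily good saving for fixed \<open>S\<close>.
  The rotation is quantitatively equidistributed because \<open>r ^ n\<close> and \<open>S ^ p\<close> are distinct integers;
  this makes the rate in \<open>f\<close> explicit, a threefold iterated logarithm.\<close>

section \<open>Exponential sums and the Fejer kernel\<close>

text \<open>Blocks of length \<open>2k + 1\<close> put exactly \<open>k ^ 2\<close> digits before
  stage \<open>k\<close>. An initial segment of an orbit that ends inside a stage then exceeds the
  complete stages by a proportion of order \<open>1 / k\<close> only, so nothing has to be proved
  about partial blocks. The function \<open>f\<close> is fixed before \<open>g\<close>, while the
  levels depend on \<open>g\<close> and may grow arbitrarily slowly. So in the independent bases the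
  precision has to improve with \<open>k\<close> while the level, and with it \<open>S\<close>,
  stays fixed. The saving from two factors is fixed once \<open>S\<close> is; the saving from the
  rotation improves with the number \<open>a\<close> of factors. Its price is a stage of length
  about \<open>r ^ (S ^ (4 * a))\<close>, which the rotation needs to equidistribute at the required
  scale. Here \<open>r\<close> and \<open>S\<close> are bounded in terms of the level but stand
  inside a double exponential in \<open>a\<close>, so a twofold iterated logarithm of
  \<open>k\<close> would not do as \<open>a\<close>; the third exponential absorbs all these
  constants.\<close>

definition ee :: "real \<Rightarrow> complex" where
  "ee x = cis (2 * pi * x)"

lemma norm_ee [simp]: "norm (ee x) = 1"
  by (simp add: ee_def)

lemma ee_add: "ee (x + y) = ee x * ee y"
  by (simp add: ee_def cis_mult algebra_simps)

lemma ee_0 [simp]: "ee 0 = 1"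
  by (simp add: ee_def)

lemma ee_minus: "ee (- x) = cnj (ee x)"
  by (simp add: ee_def complex_eq_iff)

lemma ee_int: "x \<in> \<int> \<Longrightarrow> ee x = 1"
proof -
  assume "x \<in> \<int>"
  then obtain k where "x = of_int k" by (auto elim: Ints_cases)
  then show ?thesis
    by (simp add: ee_def complex_eq_iff cos_int_2pin sin_int_2pin flip: of_int_mult)
qed

lemma ee_of_nat_mult: "ee (real n * x) = ee x ^ n"
  unfolding ee_def Complex.DeMoivre by (simp add: mult_ac)

lemma ee_cong: "x - y \<in> \<int> \<Longrightarrow> ee x = ee y"
  using ee_add[of "x - y" y] by (simp add: ee_int)

lemma norm_ee_diff_1: "norm (ee x - 1) = 2 * \<bar>sin (pi * x)\<bar>"
proof -
  have "(norm (ee x - 1))\<^sup>2 = (cos (2*pi*x) - 1)\<^sup>2 + (sin (2*pi*x))\<^sup>2"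
    by (simp add: ee_def cmod_def)
  also have "\<dots> = 2 - 2 * cos (2*(pi*x))"
    using sin_cos_squared_add[of "2*pi*x"] by (simp add: power2_eq_square algebra_simps)
  also have "\<dots> = (2 * \<bar>sin (pi * x)\<bar>)\<^sup>2"
    by (subst cos_double_sin) (simp add: power_mult_distrib)
  finally show ?thesis
    by (rule power2_eq_imp_eq) auto
qed

lemma norm_ee_diff_1_le: "norm (ee x - 1) \<le> 2 * pi * \<bar>x\<bar>"
  using abs_sin_x_le_abs_x[of "pi * x"] by (simp add: norm_ee_diff_1 abs_mult)

lemma norm_ee_diff_le: "norm (ee x - ee y) \<le> 2 * pi * \<bar>x - y\<bar>"
proof -
  have "ee x - ee y = ee y * (ee (x - y) - 1)"
    using ee_add[of y "x - y"] by (simp add: algebra_simps)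
  then show ?thesis
    using norm_ee_diff_1_le[of "x - y"] by (simp add: norm_mult)
qed

text \<open>Jordan's inequality: \<open>sin\<close> is concave on \<open>[0, pi]\<close>, so it lies
  above its chord between \<open>0\<close> and \<open>pi / 2\<close>; reflection in
  \<open>1 / 2\<close> gives the other half.\<close>

lemma sin_pi_ge:
  assumes "0 \<le> d" "d \<le> y" "y \<le> 1 - d"
  shows "2 * d \<le> sin (pi * y)"
proof -
  have jordan: "2 * z \<le> sin (pi * z)" if "0 \<le> z" "z \<le> 1/2" for z :: real
  proof -
    have "concave_on {0..pi} sin"
    proof (rule f''_le0_imp_concave)
      show "(sin has_real_derivative cos x) (at x)" for x :: real
        by (rule DERIV_sin)
      show "(cos has_real_derivative - sin x) (at x)" for x :: real
        by (rule DERIV_cos)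
      show "- sin x \<le> 0" if "x \<in> {0..pi}" for x :: real
        using that sin_ge_zero by auto
    qed simp
    from concave_onD[OF this, of "2*z" 0 "pi/2"] that show ?thesis
      by (simp add: algebra_simps)
  qed
  show ?thesis
  proof (cases "y \<le> 1/2")
    case True
    then show ?thesis using jordan[of y] assms by simp
  next
    case False
    have "sin (pi * (1 - y)) = sin (pi * y)"
      by (simp add: algebra_simps sin_diff)
    then show ?thesis using jordan[of "1 - y"] assms False by simp
  qed
qed

lemma norm_geometric_ee_le:
  assumes "0 < d" "d \<le> y" "y \<le> 1 - d"
  shows "norm (\<Sum>l<n. ee (real l * y)) \<le> 1 / (2 * d)"
proof -
  have s: "2 * d \<le> sin (pi * y)" using sin_pi_ge[of d y] assms by simp
  then have n1: "4 * d \<le> norm (ee y - 1)"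
    using assms by (simp add: norm_ee_diff_1)
  then have ne: "ee y \<noteq> 1" using assms by auto
  have "(\<Sum>l<n. ee (real l * y)) = (ee y ^ n - 1) / (ee y - 1)"
    by (simp add: ee_of_nat_mult geometric_sum[OF ne])
  also have "norm \<dots> \<le> 2 / (4 * d)"
    unfolding norm_divide
  proof (rule frac_le)
    show "norm (ee y ^ n - 1) \<le> 2"
      using norm_triangle_ineq4[of "ee y ^ n" 1] by (simp add: norm_power)
  qed (use assms n1 in auto)
  finally show ?thesis by simp
qed

text \<open>Orthogonality of the characters of the cyclic group of order \<open>Q\<close>: the ratio
  of the geometric sum is \<open>1\<close> exactly when \<open>Q\<close> divides
  \<open>k\<close>.\<close>

lemma sum_ee_grid:
  assumes "Q > 0"
  shows "(\<Sum>c<Q. ee (of_int k * real c / real Q)) = (if int Q dvd k then of_nat Q else 0)"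
proof (cases "int Q dvd k")
  case True
  then obtain m where "k = int Q * m" by blast
  then have "ee (of_int k * real c / real Q) = 1" for c
    using assms by (intro ee_int) (simp add: field_simps)
  with True show ?thesis by simp
next
  case False
  let ?z = "ee (of_int k / real Q)"
  have ne: "?z \<noteq> 1"
  proof
    assume "?z = 1"
    then have "norm (?z - 1) = 0" by simp
    then have "sin (pi * (of_int k / real Q)) = 0" by (simp add: norm_ee_diff_1)
    then obtain i where "pi * (of_int k / real Q) = of_int i * pi"
      by (auto simp: sin_zero_iff_int2)
    then have "real_of_int k = of_int i * real Q" using assms by (simp add: field_simps)
    then have "real_of_int k = real_of_int (i * int Q)" by simp
    then have "k = i * int Q" by linarith
    with False show False by simp
  qed
  have "(\<Sum>c<Q. ee (of_int k * real c / real Q)) = (\<Sum>c<Q. ?z ^ c)"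
    by (intro sum.cong refl) (simp flip: ee_of_nat_mult, simp add: mult_ac)
  also have "\<dots> = (?z ^ Q - 1) / (?z - 1)"
    by (rule geometric_sum[OF ne])
  also have "?z ^ Q = 1"
    using assms by (simp flip: ee_of_nat_mult, intro ee_int) simp
  finally show ?thesis using False by simp
qed

lemma norm_sum_squared:
  fixes u :: "'a \<Rightarrow> complex"
  shows "complex_of_real ((norm (\<Sum>a\<in>A. u a))\<^sup>2) = (\<Sum>a\<in>A. \<Sum>b\<in>A. u a * cnj (u b))"
  unfolding complex_norm_square by (simp add: sum_product)

text \<open>Frequencies below \<open>Q\<close> that are distinct stay distinct modulo
  \<open>Q\<close>, so all cross terms vanish. This serves the Fejer kernel as well as
  \<open>psi\<close>.\<close>

lemma grid_parseval:
  fixes u :: "nat \<Rightarrow> complex"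
  assumes A: "A \<subseteq> {..<Q}"
  shows "(\<Sum>c<Q. (norm (\<Sum>a\<in>A. u a * ee (real a * real c / real Q)))\<^sup>2) = real Q * (\<Sum>a\<in>A. (norm (u a))\<^sup>2)"
proof (cases "Q = 0")
  case True
  then show ?thesis by simp
next
  case False
  then have Q: "Q > 0" by simp
  have fin: "finite A" using A finite_subset by blast
  have "complex_of_real (\<Sum>c<Q. (norm (\<Sum>a\<in>A. u a * ee (real a * real c / real Q)))\<^sup>2)
      = (\<Sum>c<Q. \<Sum>a\<in>A. \<Sum>b\<in>A. u a * cnj (u b) * ee (of_int (int a - int b) * real c / real Q))"
    unfolding of_real_sum norm_sum_squared
  proof (intro sum.cong refl)
    fix c a b
    have "of_int (int a - int b) * real c / real Q = real a * real c / real Q + - (real b * real c / real Q)"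
      by (simp add: diff_divide_distrib left_diff_distrib)
    then have "ee (of_int (int a - int b) * real c / real Q)
      = ee (real a * real c / real Q) * cnj (ee (real b * real c / real Q))"
      by (simp only: ee_add ee_minus)
    then show "u a * ee (real a * real c / real Q) * cnj (u b * ee (real b * real c / real Q)) =
      u a * cnj (u b) * ee (of_int (int a - int b) * real c / real Q)"
      by simp
  qed
  also have "\<dots> = (\<Sum>a\<in>A. \<Sum>b\<in>A. u a * cnj (u b) * (\<Sum>c<Q. ee (of_int (int a - int b) * real c / real Q)))"
    unfolding sum_distrib_left
    by (rule trans[OF sum.swap], rule sum.cong[OF refl], rule sum.swap)
  also have "\<dots> = (\<Sum>a\<in>A. \<Sum>b\<in>A. if b = a then u a * cnj (u a) * of_nat Q else 0)"
  proof (intro sum.cong refl)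
    fix a b assume ab: "a \<in> A" "b \<in> A"
    have "int Q dvd int a - int b \<longleftrightarrow> b = a"
    proof
      assume d: "int Q dvd int a - int b"
      have "a < Q" "b < Q" using ab A by auto
      then have "\<bar>int a - int b\<bar> < int Q" by linarith
      then have "int a - int b = 0"
        using d dvd_imp_le_int[of "int a - int b" "int Q"] by auto
      then show "b = a" by simp
    qed simp
    then show "u a * cnj (u b) * (\<Sum>c<Q. ee (of_int (int a - int b) * real c / real Q)) =
       (if b = a then u a * cnj (u a) * of_nat Q else 0)"
      by (subst sum_ee_grid[OF Q]) auto
  qed
  also have "\<dots> = (\<Sum>a\<in>A. u a * cnj (u a) * of_nat Q)"
    using fin by (simp add: sum.delta)
  also have "\<dots> = complex_of_real (real Q * (\<Sum>a\<in>A. (norm (u a))\<^sup>2))"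
    unfolding of_real_mult of_real_sum complex_norm_square by (simp add: sum_distrib_left mult_ac)
  finally show ?thesis using of_real_eq_iff by blast
qed

lemma norm_sum_ee_minus: "norm (\<Sum>n\<in>W. ee (- f n)) = norm (\<Sum>n\<in>W. ee (f n))"
proof -
  have "(\<Sum>n\<in>W. ee (- f n)) = cnj (\<Sum>n\<in>W. ee (f n))"
    unfolding ee_minus cnj_sum ..
  then show ?thesis by (simp only: complex_mod_cnj)
qed

text \<open>The shift by \<open>t\<close> contributes only a factor of modulus \<open>1\<close>, and
  conjugation reverses the sign of a frequency, so positive frequencies below \<open>H\<close>
  suffice.\<close>

lemma exp_sum_diff_le:
  fixes z :: "'a \<Rightarrow> real"
  assumes "\<And>l. l \<in> {1..<H} \<Longrightarrow> norm (\<Sum>n\<in>W. ee (real l * z n)) \<le> C"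
    and "l < H" "l' < H" "l \<noteq> l'"
  shows "norm (\<Sum>n\<in>W. ee ((real l - real l') * (t - z n))) \<le> C"
proof -
  have "(\<Sum>n\<in>W. ee ((real l - real l') * (t - z n)))
      = ee ((real l - real l') * t) * (\<Sum>n\<in>W. ee (- ((real l - real l') * z n)))"
    unfolding sum_distrib_left ee_add[symmetric] by (simp add: algebra_simps)
  then have "norm (\<Sum>n\<in>W. ee ((real l - real l') * (t - z n)))
      = norm (\<Sum>n\<in>W. ee ((real l - real l') * z n))"
    by (simp add: norm_mult norm_sum_ee_minus)
  also have "\<dots> \<le> C"
  proof (cases "l' < l")
    case True
    then show ?thesis using assms(1)[of "l - l'"] assms(2) by (simp add: of_nat_diff Suc_le_eq)
  next
    case False
    have "norm (\<Sum>n\<in>W. ee ((real l - real l') * z n)) = norm (\<Sum>n\<in>W. ee (- (real (l' - l) * z n)))"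
      using False by (simp add: of_nat_diff left_diff_distrib)
    also have "\<dots> = norm (\<Sum>n\<in>W. ee (real (l' - l) * z n))"
      by (rule norm_sum_ee_minus)
    also have "\<dots> \<le> C"
      using False assms(2-4) by (intro assms(1)) auto
    finally show ?thesis .
  qed
  finally show ?thesis .
qed

text \<open>Expanding the square leaves the \<open>H\<close> diagonal pairs, each contributing
  \<open>card W\<close>, and fewer than \<open>H ^ 2\<close> others, each controlled by
  \<open>C\<close>.\<close>

lemma fejer_upper:
  fixes z :: "'a \<Rightarrow> real"
  assumes "\<And>l. l \<in> {1..<H} \<Longrightarrow> norm (\<Sum>n\<in>W. ee (real l * z n)) \<le> C" "0 \<le> C"
  shows "(\<Sum>n\<in>W. (norm (\<Sum>l<H. ee (real l * (t - z n))))\<^sup>2) \<le> real H * card W + (real H)\<^sup>2 * C"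
proof -
  have "complex_of_real (\<Sum>n\<in>W. (norm (\<Sum>l<H. ee (real l * (t - z n))))\<^sup>2)
      = (\<Sum>n\<in>W. \<Sum>l<H. \<Sum>l'<H. ee ((real l - real l') * (t - z n)))"
    unfolding of_real_sum norm_sum_squared
  proof (intro sum.cong refl)
    fix n l l'
    have "(real l - real l') * (t - z n) = real l * (t - z n) + - (real l' * (t - z n))"
      by (simp add: algebra_simps)
    then show "ee (real l * (t - z n)) * cnj (ee (real l' * (t - z n))) = ee ((real l - real l') * (t - z n))"
      by (simp only: ee_add ee_minus)
  qed
  also have "\<dots> = (\<Sum>l<H. \<Sum>l'<H. \<Sum>n\<in>W. ee ((real l - real l') * (t - z n)))"
    by (rule trans[OF sum.swap], rule sum.cong[OF refl], rule sum.swap)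
  finally have "norm (complex_of_real (\<Sum>n\<in>W. (norm (\<Sum>l<H. ee (real l * (t - z n))))\<^sup>2))
      = norm (\<Sum>l<H. \<Sum>l'<H. \<Sum>n\<in>W. ee ((real l - real l') * (t - z n)))"
    by (rule arg_cong)
  then have "\<bar>\<Sum>n\<in>W. (norm (\<Sum>l<H. ee (real l * (t - z n))))\<^sup>2\<bar>
      = norm (\<Sum>l<H. \<Sum>l'<H. \<Sum>n\<in>W. ee ((real l - real l') * (t - z n)))"
    unfolding norm_of_real .
  also have "\<dots> \<le> (\<Sum>l<H. \<Sum>l'<H. norm (\<Sum>n\<in>W. ee ((real l - real l') * (t - z n))))"
    by (intro order.trans[OF norm_sum] sum_mono norm_sum)
  also have "\<dots> \<le> (\<Sum>l<H. \<Sum>l'<H. (if l' = l then real (card W) else 0) + C)"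
  proof (intro sum_mono)
    fix l l' assume "l \<in> {..<H}" "l' \<in> {..<H}"
    then show "norm (\<Sum>n\<in>W. ee ((real l - real l') * (t - z n))) \<le> (if l' = l then real (card W) else 0) + C"
      using exp_sum_diff_le[OF assms(1), where l = l and l' = l'] assms(2) by auto
  qed
  also have "\<dots> = real H * card W + (real H)\<^sup>2 * C"
    by (simp add: sum.distrib power2_eq_square algebra_simps)
  finally show ?thesis by linarith
qed

text \<open>The shifts \<open>j / H\<close> sample a trigonometric polynomial with \<open>H\<close>
  frequencies at \<open>H\<close> equidistant points, so Parseval makes the total mass independent
  of \<open>z\<close>.\<close>

lemma fejer_total:
  "(\<Sum>j<H. (norm (\<Sum>l<H. ee (real l * (real j / real H - z))))\<^sup>2) = (real H)\<^sup>2"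
proof -
  have "(\<Sum>l<H. ee (real l * (real j / real H - z))) = (\<Sum>l<H. ee (- (real l * z)) * ee (real l * real j / real H))" for j
  proof (intro sum.cong refl)
    fix l
    have "real l * (real j / real H - z) = - (real l * z) + real l * real j / real H"
      by (simp add: algebra_simps)
    then show "ee (real l * (real j / real H - z)) = ee (- (real l * z)) * ee (real l * real j / real H)"
      by (simp only: ee_add)
  qed
  then have "(\<Sum>j<H. (norm (\<Sum>l<H. ee (real l * (real j / real H - z))))\<^sup>2)
      = real H * (\<Sum>l<H. (norm (ee (- (real l * z))))\<^sup>2)"
    by (simp only: grid_parseval[OF order_refl])
  then show ?thesis by (simp add: power2_eq_square)
qed

lemma fejer_far:
  fixes z :: real
  assumes "0 < d" "d \<le> t - frac z" "t - frac z \<le> 1 - d"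
  shows "(norm (\<Sum>l<H. ee (real l * (t - z))))\<^sup>2 \<le> 1 / (4 * d\<^sup>2)"
proof -
  have "ee (real l * (t - z)) = ee (real l * (t - frac z))" for l
    by (rule ee_cong) (simp add: frac_def algebra_simps)
  then have "norm (\<Sum>l<H. ee (real l * (t - z))) \<le> 1 / (2 * d)"
    using norm_geometric_ee_le[of d "t - frac z" H] assms by simp
  then have "(norm (\<Sum>l<H. ee (real l * (t - z))))\<^sup>2 \<le> (1 / (2 * d))\<^sup>2"
    by (intro power_mono) auto
  then show ?thesis by (simp add: power_divide power_mult_distrib)
qed

text \<open>Double counting of kernel mass. A point of the cell spends almost all of its mass
  \<open>H ^ 2\<close> on the shifts \<open>j / H\<close> within \<open>1 / (8 q ^ 2)\<close> of the
  cell, and each shift receives little more than \<open>H * card W\<close> from all points together.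
  The cell starts at \<open>1 / (8 q ^ 2)\<close>, so that together with its margins it begins at
  \<open>0\<close> and does not wrap around.\<close>

lemma fejer_cell_bound:
  fixes z :: "'a \<Rightarrow> real" and q :: nat
  assumes W: "finite W" and q: "q \<ge> 1"
    and S: "\<And>l. l \<in> {1..<128 * q^5} \<Longrightarrow> norm (\<Sum>n\<in>W. ee (real l * z n)) \<le> card W / (2048 * q^6)"
  shows "real q ^ 2 * card {n\<in>W. 1 / (8 * real q ^ 2) \<le> frac (z n) \<and> frac (z n) < 1 / (8 * real q ^ 2) + 1 / real q} \<le> (q + 1) * card W"
proof -
  \<comment> \<open>In units of \<open>1 / H\<close>, \<open>P\<close> is the width of the cell and
    \<open>D\<close> the margin on either side. The mass beyond the margin, at most
    \<open>16 q ^ 4\<close> per shift, is then at most \<open>1 / (8 q)\<close> of the total, and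
    the hypothesis makes the off-diagonal part, \<open>8 q ^ 4 * card W\<close>, a fraction
    \<open>1 / (16 q)\<close> of \<open>H * card W\<close>.\<close>
  define H where "H = 128 * q^5"
  define P where "P = 128 * q^4"
  define D where "D = 16 * q^3"
  define G where "G = {n\<in>W. 1 / (8 * real q ^ 2) \<le> frac (z n) \<and> frac (z n) < 1 / (8 * real q ^ 2) + 1 / real q}"
  define Z where "Z j n = (norm (\<Sum>l<H. ee (real l * (real j / real H - z n))))\<^sup>2" for j n
  define M where "M = real (card W)"
  have rq: "real q \<ge> 1" using q by simp
  have H0: "H > 0" using q by (simp add: H_def)
  have DH: "real D / real H = 1 / (8 * real q ^ 2)"
    using q by (simp add: D_def H_def field_simps flip: power_add)
  have PH: "real P / real H = 1 / real q"
    using q by (simp add: P_def H_def field_simps flip: power_add power_Suc)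
  have G: "finite G" "G \<subseteq> W" using W by (auto simp: G_def)
  have Znn: "0 \<le> Z j n" for j n by (simp add: Z_def)
  have low: "(real H)\<^sup>2 - real H * (16 * real q ^ 4) \<le> (\<Sum>j<P+2*D+1. Z j n)" if n: "n \<in> G" for n
  proof -
    have "(real H)\<^sup>2 = (\<Sum>j<H. Z j n)" by (simp add: Z_def fejer_total)
    also have "\<dots> \<le> (\<Sum>j\<in>{..<P+2*D+1} \<union> {P+2*D+1..<H}. Z j n)"
      by (rule sum_mono2) (auto simp: Znn)
    also have "\<dots> = (\<Sum>j<P+2*D+1. Z j n) + (\<Sum>j\<in>{P+2*D+1..<H}. Z j n)"
      by (rule sum.union_disjoint) auto
    also have "(\<Sum>j\<in>{P+2*D+1..<H}. Z j n) \<le> (\<Sum>j\<in>{P+2*D+1..<H}. 16 * real q ^ 4)"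
    proof (rule sum_mono)
      fix j assume j: "j \<in> {P+2*D+1..<H}"
      let ?d = "1 / (8 * real q ^ 2)"
      have "1 / real q + 2 * ?d = (real P + 2 * real D) / real H"
        using DH PH by (simp add: add_divide_distrib)
      also have "\<dots> \<le> real j / real H"
        using j by (intro divide_right_mono) auto
      finally have a: "1 / real q + 2 * ?d \<le> real j / real H" .
      have b: "real j / real H \<le> 1" using j H0 by simp
      have "Z j n \<le> 1 / (4 * ?d\<^sup>2)"
        unfolding Z_def
      proof (rule fejer_far)
        show "0 < ?d" using rq by simp
        have "frac (z n) < ?d + 1 / real q" "?d \<le> frac (z n)" using n by (auto simp: G_def)
        then show "?d \<le> real j / real H - frac (z n)" "real j / real H - frac (z n) \<le> 1 - ?d"
          using a b by linarith+
      qed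
      also have "1 / (4 * ?d\<^sup>2) = 16 * real q ^ 4"
        by (simp add: power_divide power_mult_distrib flip: power_mult)
      finally show "Z j n \<le> 16 * real q ^ 4" .
    qed
    also have "\<dots> = real (H - (P+2*D+1)) * (16 * real q ^ 4)" by simp
    also have "\<dots> \<le> real H * (16 * real q ^ 4)"
      by (intro mult_right_mono) auto
    finally show ?thesis by simp
  qed
  have "real (card G) * ((real H)\<^sup>2 - real H * (16 * real q ^ 4)) = (\<Sum>n\<in>G. (real H)\<^sup>2 - real H * (16 * real q ^ 4))"
    by simp
  also have "\<dots> \<le> (\<Sum>n\<in>G. \<Sum>j<P+2*D+1. Z j n)"
    by (rule sum_mono[OF low])
  also have "\<dots> \<le> (\<Sum>n\<in>W. \<Sum>j<P+2*D+1. Z j n)"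
    by (rule sum_mono2) (use W G Znn in \<open>auto intro!: sum_nonneg simp del: sum.lessThan_Suc\<close>)
  also have "\<dots> = (\<Sum>j<P+2*D+1. \<Sum>n\<in>W. Z j n)" by (rule sum.swap)
  also have "\<dots> \<le> (\<Sum>j<P+2*D+1. real H * M + (real H)\<^sup>2 * (M / (2048 * q^6)))"
    unfolding Z_def M_def by (intro sum_mono fejer_upper) (use S H_def in auto)
  also have "\<dots> = (P + 2*D + 1) * (real H * M + (real H)\<^sup>2 * (M / (2048 * q^6)))" by simp
  finally have main: "real (card G) * ((real H)\<^sup>2 - real H * (16 * real q ^ 4)) \<le>
      (P + 2*D + 1) * (real H * M + (real H)\<^sup>2 * (M / (2048 * q^6)))" .
  define x where "x = real q"
  define g where "g = real (card G)"
  have x: "x \<ge> 1" and g: "g \<ge> 0" and M: "M \<ge> 0" using rq by (simp_all add: x_def g_def M_def)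
  have main': "g * ((128*x^5)^2 - (128*x^5) * (16 * x^4)) \<le> (128*x^4 + 32 * x^3 + 1) * ((128*x^5) * M + (128*x^5)^2 * (M / (2048 * x^6)))"
    using main by (simp add: x_def g_def H_def P_def D_def add_ac)
  have "(128*x^5)^2 * (M / (2048 * x^6)) = 8 * x^4 * M"
    using x by (simp add: field_simps flip: power_add power_mult)
  then have "g * ((128*x^5)^2 - (128*x^5) * (16 * x^4)) \<le> (128*x^4 + 32 * x^3 + 1) * ((128*x^5) * M + 8 * x^4 * M)"
    using main' by simp
  also have "g * ((128*x^5)^2 - (128*x^5) * (16 * x^4)) = (8*x^4) * (2048*x^6*g - 256*x^5*g)"
    by (simp add: algebra_simps flip: power_add power_mult)
  also have "(128*x^4 + 32 * x^3 + 1) * ((128*x^5) * M + 8 * x^4 * M) = (8*x^4) * ((128*x^4 + 32 * x^3 + 1) * (16 * x + 1) * M)"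
    by (simp add: algebra_simps numeral_eq_Suc)
  finally have "2048*x^6*g - 256*x^5*g \<le> (128*x^4 + 32 * x^3 + 1) * (16 * x + 1) * M"
    using x by (subst (asm) mult_le_cancel_left_pos) auto
  also have "\<dots> \<le> (256 * x^3 * (8 * x - 1) * (x + 1)) * M"
  proof (rule mult_right_mono[OF _ M])
    have p: "1 \<le> x^3" "x^3 \<le> x^4" "x \<le> x^4" using x by (auto intro: one_le_power power_increasing simp: self_le_power)
    have "(128*x^4 + 32 * x^3 + 1) * (16 * x + 1) = 2048 * x^5 + 640 * x^4 + 32 * x^3 + 16 * x + 1"
      by (simp add: algebra_simps numeral_eq_Suc)
    also have "\<dots> \<le> 2048 * x^5 + 1792 * x^4 - 256 * x^3" using p by linarith
    also have "\<dots> = 256 * x^3 * (8 * x - 1) * (x + 1)" 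
      by (simp add: algebra_simps numeral_eq_Suc)
    finally show "(128*x^4 + 32 * x^3 + 1) * (16 * x + 1) \<le> 256 * x^3 * (8 * x - 1) * (x + 1)" .
  qed
  also have "2048*x^6*g - 256*x^5*g = (256 * x^3 * (8 * x - 1)) * (x^2 * g)"
    by (simp add: algebra_simps numeral_eq_Suc)
  also have "(256 * x^3 * (8 * x - 1) * (x + 1)) * M = (256 * x^3 * (8 * x - 1)) * ((x + 1) * M)"
    by simp
  finally have "x^2 * g \<le> (x + 1) * M"
    using x by (subst (asm) mult_le_cancel_left_pos) auto
  then show ?thesis by (simp add: x_def g_def M_def G_def algebra_simps)
qed

text \<open>Translation carries the cell to the position required by \<open>fejer_cell_bound\<close>
  and multiplies the exponential sums by factors of modulus \<open>1\<close>. For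
  \<open>q = 1\<close> the translated cell would pass \<open>1\<close>, but there the claim is
  trivial.\<close>

lemma cell_bound:
  fixes x :: "'a \<Rightarrow> real" and q c :: nat
  assumes W: "finite W" and q: "q \<ge> 1" and c: "c < q"
    and S: "\<And>l. l \<in> {1..<128 * q^5} \<Longrightarrow> norm (\<Sum>n\<in>W. ee (real l * x n)) \<le> card W / (2048 * q^6)"
  shows "q ^ 2 * card {n\<in>W. real c \<le> real q * frac (x n) \<and> real q * frac (x n) < real c + 1} \<le> (q + 1) * card W"
proof -
  define G where "G = {n\<in>W. real c \<le> real q * frac (x n) \<and> real q * frac (x n) < real c + 1}"
  have G: "G \<subseteq> W" by (auto simp: G_def)
  show ?thesis
  proof (cases "q = 1")
    case True
    then show ?thesis using card_mono[OF W G] by (simp add: G_def)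
  next
    case False
    define d where "d = 1 / (8 * real q ^ 2)"
    define z where "z n = x n + (d - real c / real q)" for n
    have rq: "real q \<ge> 2" using q False by simp
    have d: "0 < d" "d \<le> 1 / real q / 8"
      using rq by (auto simp: d_def field_simps power2_eq_square)
    have "G \<subseteq> {n\<in>W. d \<le> frac (z n) \<and> frac (z n) < d + 1 / real q}"
    proof
      fix n assume "n \<in> G"
      then have h: "n \<in> W" "real c \<le> real q * frac (x n)" "real q * frac (x n) < real c + 1"
        by (auto simp: G_def)
      define y where "y = frac (x n) - real c / real q"
      have y: "0 \<le> y" "y < 1 / real q"
        using h rq by (auto simp: y_def divide_simps) (simp_all add: algebra_simps)
      have "1 / real q \<le> 1/2" using rq by (simp add: field_simps)
      moreover have "d \<le> 1/2"
        using d(2) \<open>1 / real q \<le> 1/2\<close> by simp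
      ultimately have "0 \<le> d + y" "d + y < 1" using y d(1) by linarith+
      moreover have "z n - (d + y) \<in> \<int>"
        by (simp add: z_def y_def frac_def)
      ultimately have "frac (z n) = d + y"
        by (simp add: frac_unique_iff)
      then show "n \<in> {n\<in>W. d \<le> frac (z n) \<and> frac (z n) < d + 1 / real q}"
        using y h by auto
    qed
    then have "card G \<le> card {n\<in>W. d \<le> frac (z n) \<and> frac (z n) < d + 1 / real q}"
      using W by (intro card_mono) auto
    then have "real q ^ 2 * card G \<le> real q ^ 2 * card {n\<in>W. d \<le> frac (z n) \<and> frac (z n) < d + 1 / real q}"
      by (intro mult_left_mono) auto
    also have "\<dots> \<le> (q + 1) * card W"
      unfolding d_def
    proof (rule fejer_cell_bound[OF W q])
      fix l assume l: "l \<in> {1..<128 * q^5}"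
      have "(\<Sum>n\<in>W. ee (real l * z n)) = ee (real l * (d - real c / real q)) * (\<Sum>n\<in>W. ee (real l * x n))"
        unfolding z_def distrib_left ee_add sum_distrib_left by (simp only: mult.commute)
      then show "norm (\<Sum>n\<in>W. ee (real l * z n)) \<le> card W / (2048 * q^6)"
        using S[OF l] by (simp add: norm_mult)
    qed
    finally have "real (q ^ 2 * card G) \<le> real ((q + 1) * card W)" by simp
    then show ?thesis unfolding G_def of_nat_le_iff .
  qed
qed

section \<open>Rotations by logarithm ratios\<close>

text \<open>Dirichlet yields a multiple of \<open>\<theta>\<close> within
  \<open>\<delta> < 1 / \<Lambda>\<close> of an integer, possibly far closer than wanted. Bad
  approximability bounds \<open>\<delta>\<close> from below, so a factor \<open>g\<close> of order
  \<open>1 / (\<Lambda> * \<delta>)\<close> brings the step into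
  \<open>[1 / \<Lambda>, 2 / \<Lambda>)\<close> at bounded cost; fewer than
  \<open>\<Lambda> / 4\<close> such steps do not get past \<open>1 / 2\<close>.\<close>

lemma rotation_separated:
  fixes \<theta> c \<rho> :: real
  assumes c: "c > 0" and \<rho>: "\<rho> \<ge> 1"
    and badly: "\<And>n p. n \<ge> 1 \<Longrightarrow> c / \<rho> ^ n \<le> \<bar>real n * \<theta> - of_int p\<bar>"
    and L: "\<Lambda> \<ge> (8::nat)"
  obtains N :: nat where "0 < N" "real N \<le> 2 / c * \<rho> ^ \<Lambda>"
    "\<And>j p. 1 \<le> j \<Longrightarrow> j < \<Lambda> div 4 \<Longrightarrow> 1 / \<Lambda> \<le> \<bar>real (j * N) * \<theta> - of_int p\<bar>"
proof -
  obtain h k where k: "0 < k" "k \<le> int \<Lambda>" "\<bar>of_int k * \<theta> - of_int h\<bar> < 1 / \<Lambda>"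
  proof -
    have "0 < \<Lambda>" using L by simp
    then show thesis by (rule Dirichlet_approx[of \<Lambda> \<theta>]) (rule that)
  qed
  define n where "n = nat k"
  have n: "1 \<le> n" "n \<le> \<Lambda>" "real n = of_int k" using k by (auto simp: n_def)
  define \<delta> where "\<delta> = \<bar>of_int k * \<theta> - of_int h\<bar>"
  have "c / \<rho> ^ \<Lambda> \<le> c / \<rho> ^ n"
    using n \<rho> c by (intro divide_left_mono power_increasing) auto
  also have "\<dots> \<le> \<delta>" using badly[OF n(1), of h] n(3) by (simp add: \<delta>_def)
  finally have low: "c / \<rho> ^ \<Lambda> \<le> \<delta>" .
  have pos: "0 < \<rho> ^ \<Lambda>" using \<rho> by simp
  have \<delta>0: "0 < \<delta>" using low c pos by (meson divide_pos_pos less_le_trans)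
  have \<delta>1: "\<delta> < 1 / \<Lambda>" using k by (simp add: \<delta>_def)
  have inv: "1 / \<delta> \<le> \<rho> ^ \<Lambda> / c"
    using low c pos \<delta>0 by (simp add: field_simps)
  have L0: "real \<Lambda> > 0" using L by simp
  define x where "x = 1 / (\<Lambda> * \<delta>)"
  have x1: "1 < x" using \<delta>0 \<delta>1 L0 by (simp add: x_def field_simps)
  define g where "g = nat \<lceil>x\<rceil>"
  have "real g = of_int \<lceil>x\<rceil>" using x1 by (simp add: g_def)
  then have gl: "x \<le> real g" and gu2: "real g < 2 * x"
    using x1 by linarith+
  have a: "1 / \<Lambda> \<le> real g * \<delta>" using gl \<delta>0 L0 by (simp add: x_def field_simps)
  have b: "real g * \<delta> < 2 / \<Lambda>" using gu2 \<delta>0 L0 by (simp add: x_def field_simps)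
  have g0: "0 < g" using gl x1 by (cases g) auto
  show thesis
  proof (rule that[of "g * n"])
    show "0 < g * n" using g0 n by simp
    have "real (g * n) \<le> 2 * x * \<Lambda>"
      unfolding of_nat_mult using gu2 n x1 by (intro mult_mono) auto
    also have "\<dots> = 2 * (1 / \<delta>)" using L0 by (simp add: x_def)
    also have "\<dots> \<le> 2 * (\<rho> ^ \<Lambda> / c)" using inv by simp
    finally show "real (g * n) \<le> 2 / c * \<rho> ^ \<Lambda>" by (simp add: mult_ac)
  next
    fix j :: nat and p :: int
    assume j: "1 \<le> j" "j < \<Lambda> div 4"
    define e where "e = of_int k * \<theta> - of_int h"
    have e: "\<bar>e\<bar> = \<delta>" by (simp add: e_def \<delta>_def)
    have eq: "real (j * (g * n)) * \<theta> = real (j * g) * e + of_int (int (j * g) * h)"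
      using n(3) by (simp add: e_def algebra_simps)
    have lo: "1 / \<Lambda> \<le> real (j * g) * \<delta>"
    proof -
      have "1 * (real g * \<delta>) \<le> real j * (real g * \<delta>)" using j \<delta>0 by (intro mult_right_mono) auto
      with a show ?thesis by (simp add: mult.assoc)
    qed
    have hi: "real (j * g) * \<delta> \<le> 1/2"
    proof -
      have "real (j * g) * \<delta> = real j * (real g * \<delta>)" by simp
      also have "\<dots> \<le> real j * (2 / \<Lambda>)" using b by (intro mult_left_mono) auto
      also have "\<dots> \<le> (\<Lambda> / 4) * (2 / \<Lambda>)" using j L0 by (intro mult_right_mono) auto
      finally show ?thesis using L0 by simp
    qed
    have L18: "1 / \<Lambda> \<le> 1/2" using L by simp
    have abs: "\<bar>real (j * g) * e\<bar> = real (j * g) * \<delta>" by (simp add: abs_mult e)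
    show "1 / \<Lambda> \<le> \<bar>real (j * (g * n)) * \<theta> - of_int p\<bar>"
    proof (cases "p = int (j * g) * h")
      case True
      then show ?thesis using lo abs eq by simp
    next
      case False
      define w where "w = int (j * g) * h - p"
      have "w \<noteq> 0" using False by (simp add: w_def)
      then have "1 \<le> \<bar>real_of_int w\<bar>" by linarith
      moreover have "real (j * (g * n)) * \<theta> - of_int p = real (j * g) * e + of_int w"
        unfolding eq w_def by simp
      ultimately show ?thesis using hi abs L18 by linarith
    qed
  qed
qed

text \<open>\<open>G\<close> and its translates by multiples of \<open>N\<close> are disjoint, so \<open>G\<close> cannot be large.\<close>

lemma rotation_count:
  fixes \<theta> c \<rho> :: real
  assumes c: "c > 0" and \<rho>: "\<rho> \<ge> 1"
    and badly: "\<And>n p. n \<ge> 1 \<Longrightarrow> c / \<rho> ^ n \<le> \<bar>real n * \<theta> - of_int p\<bar>"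
    and L: "\<Lambda> \<ge> (8::nat)"
    and G: "G \<subseteq> {a..<a + M :: nat}"
    and close: "\<And>m m'. m \<in> G \<Longrightarrow> m' \<in> G \<Longrightarrow> \<exists>p. \<bar>(real m - real m') * \<theta> - of_int p\<bar> < 1 / \<Lambda>"
  shows "real (card G) \<le> 8 * real M / real \<Lambda> + 2 / c * \<rho> ^ \<Lambda>"
proof -
  obtain N :: nat where N: "0 < N" "real N \<le> 2 / c * \<rho> ^ \<Lambda>"
    "\<And>j p. 1 \<le> j \<Longrightarrow> j < \<Lambda> div 4 \<Longrightarrow> 1 / \<Lambda> \<le> \<bar>real (j * N) * \<theta> - of_int p\<bar>"
    using rotation_separated[OF c \<rho> badly L] by metis
  define B where "B = \<Lambda> div 4"
  have B: "real \<Lambda> / 8 \<le> real B" "1 \<le> B" using L unfolding B_def by linarith+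
  have ord: False if "m \<in> G" "m' \<in> G" "i < i'" "i' < B" "m + i * N = m' + i' * N" for m m' i i'
  proof -
    obtain p where p: "\<bar>(real m - real m') * \<theta> - of_int p\<bar> < 1 / \<Lambda>" using close \<open>m \<in> G\<close> \<open>m' \<in> G\<close> by blast
    have "real m + real i * real N = real m' + real i' * real N"
      using that(5) by (metis of_nat_add of_nat_mult)
    then have "real m - real m' = real ((i' - i) * N)"
      using that(3) by (simp add: of_nat_diff algebra_simps)
    then show False
      using p N(3)[of "i' - i" p] that(3,4) by (simp only: B_def) linarith
  qed
  have inj: "inj_on (\<lambda>(m, i). m + i * N) (G \<times> {..<B})"
  proof (rule inj_onI)
    fix x y assume xy: "x \<in> G \<times> {..<B}" "y \<in> G \<times> {..<B}"
      "(case x of (m, i) \<Rightarrow> m + i * N) = (case y of (m, i) \<Rightarrow> m + i * N)"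
    obtain m i m' i' where [simp]: "x = (m, i)" "y = (m', i')" by fastforce
    have h: "m \<in> G" "m' \<in> G" "i \<in> {..<B}" "i' \<in> {..<B}" "m + i * N = m' + i' * N"
      using xy by auto
    have "i = i'"
      using ord[of m m' i i'] ord[of m' m i' i] h by (metis lessThan_iff linorder_neqE_nat)
    then show "x = y" using h by simp
  qed
  have "(\<lambda>(m, i). m + i * N) ` (G \<times> {..<B}) \<subseteq> {a..<a + (M + B * N)}"
  proof (rule image_subsetI)
    fix x assume "x \<in> G \<times> {..<B}"
    then obtain m i where x: "x = (m, i)" "m \<in> G" "i \<in> {..<B}" by blast
    then have "a \<le> m" "m < a + M" "i * N \<le> B * N" using G by auto
    then have "a \<le> m + i * N" "m + i * N < a + (M + B * N)" by linarith+
    then show "(case x of (m, i) \<Rightarrow> m + i * N) \<in> {a..<a + (M + B * N)}" using x by simp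
  qed
  then have "card ((\<lambda>(m, i). m + i * N) ` (G \<times> {..<B})) \<le> M + B * N"
    using card_mono[of "{a..<a + (M + B * N)}"] by fastforce
  then have "card G * B \<le> M + B * N"
    by (simp add: card_image[OF inj] card_cartesian_product)
  then have "real (card G) * real B \<le> real M + real B * real N"
    by (metis of_nat_add of_nat_le_iff of_nat_mult)
  then have "real (card G) \<le> real M / real B + real N"
    using B(2) by (simp add: field_simps)
  also have "real M / real B \<le> real M / (real \<Lambda> / 8)"
    using B L by (intro divide_left_mono) (auto intro!: mult_pos_pos)
  finally show ?thesis using N(2) by (simp add: mult.commute)
qed

text \<open>Distinct positive integers \<open>a\<close> and \<open>b\<close> have logarithms at
  least \<open>1 / (2 * a)\<close> apart. For \<open>a = r ^ n\<close> and \<open>b = S ^ p\<close>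
  this gives an explicit exponential lower bound without any theory of linear forms in
  logarithms.\<close>

lemma log_ratio_badly_approximable:
  fixes r S :: nat
  assumes r: "r \<ge> 2" and S: "S \<ge> 2"
    and ind: "\<And>n p. n \<ge> 1 \<Longrightarrow> p \<ge> 1 \<Longrightarrow> r ^ n \<noteq> S ^ p"
    and n: "n \<ge> 1"
  shows "1 / (4 * ln S) / real r ^ n \<le> \<bar>real n * (ln r / ln S) - of_int p\<bar>"
proof -
  have lnS: "ln (real S) > 0" using S by simp
  have lnr: "ln (real r) > 0" using r by simp
  have step: "1 / (2 * real a) \<le> \<bar>ln (real a) - ln (real b)\<bar>" if "0 < a" "0 < b" "a \<noteq> b" for a b :: nat
  proof -
    have l2: "x / 2 \<le> ln (1 + x)" if "0 \<le> x" "x \<le> 1" for x :: real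
    proof -
      have "exp (x / 2) \<le> 1 + x"
        using exp_bound[of "x / 2"] that mult_left_le[of x x] by (simp add: power2_eq_square)
      then show ?thesis using that by (subst ln_ge_iff) auto
    qed
    show ?thesis
    proof (cases "b < a")
      case True
      have "1 / (2 * real a) \<le> 1 / real a" using that by (intro divide_left_mono) auto
      also have "1 / real a \<le> - ln (1 - 1 / real a)"
        using ln_add_one_self_le_self2[of "- (1 / real a)"] True that by simp
      also have "1 - 1 / real a = (real a - 1) / real a" using that by (simp add: field_simps)
      also have "- ln ((real a - 1) / real a) = ln (real a) - ln (real a - 1)"
        using True that by (subst ln_div) auto
      also have "\<dots> \<le> ln (real a) - ln (real b)"
        using True that by simp
      finally show ?thesis by simp
    next
      case False
      then have ab: "real a + 1 \<le> real b" using that by linarith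
      have "1 / (2 * real a) = (1 / real a) / 2" by simp
      also have "\<dots> \<le> ln (1 + 1 / real a)" using that by (intro l2) auto
      also have "1 + 1 / real a = (real a + 1) / real a" using that by (simp add: field_simps)
      also have "ln ((real a + 1) / real a) = ln (real a + 1) - ln (real a)"
        using that by (subst ln_div) auto
      also have "\<dots> \<le> ln (real b) - ln (real a)" using ab that by simp
      finally show ?thesis by simp
    qed
  qed
  have rn: "0 < r ^ n" using r by simp
  have eq: "\<bar>real n * (ln r / ln S) - of_int p\<bar> = \<bar>ln (real (r ^ n)) - of_int p * ln S\<bar> / ln S"
  proof -
    have "real n * (ln r / ln S) - of_int p = (ln (real (r ^ n)) - of_int p * ln S) / ln S"
      using lnS r by (simp add: ln_realpow diff_divide_distrib)
    then show ?thesis using lnS by (simp add: abs_div)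
  qed
  have main: "1 / (2 * real (r ^ n)) \<le> \<bar>ln (real (r ^ n)) - of_int p * ln S\<bar>"
  proof (cases "p \<ge> 1")
    case True
    define k where "k = nat p"
    have k: "k \<ge> 1" "of_int p = real k" using True by (auto simp: k_def)
    have "1 / (2 * real (r ^ n)) \<le> \<bar>ln (real (r ^ n)) - ln (real (S ^ k))\<bar>"
      by (rule step) (use r S ind[OF n k(1)] in auto)
    then show ?thesis using k S by (simp add: ln_realpow)
  next
    case False
    \<comment> \<open>For \<open>p \<le> 0\<close> the term \<open>- p * ln S\<close> only helps, so
      comparison with the integer \<open>1\<close> suffices.\<close>
    have "1 / (2 * real (r ^ n)) \<le> \<bar>ln (real (r ^ n)) - ln (real 1)\<bar>"
      by (rule step) (use r n in auto)
    also have "\<dots> = ln (real (r ^ n))" using r lnr by (simp add: ln_realpow)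
    also have "\<dots> \<le> ln (real (r ^ n)) - of_int p * ln S"
      using False lnS by (simp add: mult_nonpos_nonneg)
    finally show ?thesis by simp
  qed
  have "1 / (4 * ln S) / real r ^ n \<le> (1 / (2 * real (r ^ n))) / ln S"
    using lnS r by (simp add: field_simps)
  also have "\<dots> \<le> \<bar>ln (real (r ^ n)) - of_int p * ln S\<bar> / ln S"
    using main lnS by (intro divide_right_mono) auto
  finally show ?thesis using eq by simp
qed

section \<open>Numbers with missing digits\<close>

text \<open>The functions are extensional, so that a word is determined by its value; this is what
  makes \<open>word_val\<close> injective.\<close>

definition words :: "nat \<Rightarrow> nat \<Rightarrow> (nat \<Rightarrow> nat) set" where
  "words S N = PiE {..<N} (\<lambda>_. {..<S - 1})"

definition word_val :: "nat \<Rightarrow> nat \<Rightarrow> (nat \<Rightarrow> nat) \<Rightarrow> nat" where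
  "word_val S N d = (\<Sum>i<N. d i * S ^ i)"

definition phi :: "nat \<Rightarrow> real \<Rightarrow> complex" where
  "phi S y = (\<Sum>a<S - 1. ee (real a * y))"

text \<open>Modulus of the characteristic function of \<open>word_val\<close> on a uniformly
  distributed word. Independence of the digits makes it a Riesz-type product.\<close>

definition psi :: "nat \<Rightarrow> nat \<Rightarrow> real \<Rightarrow> real" where
  "psi S N y = norm (\<Prod>i<N. phi S (real S ^ i * y)) / real (S - 1) ^ N"

lemma finite_words [simp]: "finite (words S N)"
  by (simp add: words_def finite_PiE)

lemma card_words [simp]: "card (words S N) = (S - 1) ^ N"
  by (simp add: words_def card_PiE)

lemma word_val_Suc: "word_val S (Suc N) d = d 0 + S * word_val S N (\<lambda>i. d (Suc i))"
  by (simp add: word_val_def sum.lessThan_Suc_shift sum_distrib_left mult_ac del: sum.lessThan_Suc)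

lemma word_val_bound_digit:
  assumes "\<And>i. i < N \<Longrightarrow> d i < S"
  shows "word_val S N d < S ^ N \<and> (\<forall>i<N. word_val S N d div S ^ i mod S = d i)"
  using assms
proof (induction N arbitrary: d)
  case 0
  then show ?case by (simp add: word_val_def)
next
  case (Suc N)
  let ?d = "\<lambda>i. d (Suc i)"
  have IH: "word_val S N ?d < S ^ N" "\<And>i. i < N \<Longrightarrow> word_val S N ?d div S ^ i mod S = d (Suc i)"
    using Suc.IH[of ?d] Suc.prems by auto
  have d0: "d 0 < S" using Suc.prems by simp
  have "d 0 + S * word_val S N ?d < S * (word_val S N ?d + 1)" using d0 by simp
  also have "\<dots> \<le> S * S ^ N" using IH(1) by (intro mult_left_mono) auto
  finally have "word_val S (Suc N) d < S ^ Suc N" by (simp add: word_val_Suc)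
  moreover have "word_val S (Suc N) d div S ^ i mod S = d i" if "i < Suc N" for i
  proof (cases i)
    case 0
    then show ?thesis using d0 by (simp add: word_val_Suc)
  next
    case (Suc j)
    have "word_val S (Suc N) d div S ^ Suc j = (word_val S (Suc N) d div S) div S ^ j"
      by (simp add: div_mult2_eq)
    also have "word_val S (Suc N) d div S = word_val S N ?d" using d0 by (simp add: word_val_Suc)
    finally show ?thesis using IH(2)[of j] that Suc by simp
  qed
  ultimately show ?case by blast
qed

lemma words_lt: "d \<in> words S N \<Longrightarrow> i < N \<Longrightarrow> d i < S - 1"
  by (auto simp: words_def)

lemma word_val_less: "d \<in> words S N \<Longrightarrow> word_val S N d < S ^ N"
  using word_val_bound_digit[of N d S] words_lt[of d S N] by fastforce

lemma digit_word_val: "d \<in> words S N \<Longrightarrow> i < N \<Longrightarrow> word_val S N d div S ^ i mod S = d i"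
  using word_val_bound_digit[of N d S] words_lt[of d S N] by fastforce

lemma inj_on_word_val: "inj_on (word_val S N) (words S N)"
proof (rule inj_onI)
  fix d d' assume h: "d \<in> words S N" "d' \<in> words S N" "word_val S N d = word_val S N d'"
  show "d = d'"
  proof
    fix i
    show "d i = d' i"
    proof (cases "i < N")
      case True
      then show ?thesis using digit_word_val h by metis
    next
      case False
      then show ?thesis using h by (auto simp: words_def PiE_def extensional_def)
    qed
  qed
qed

lemma ee_sum: "finite A \<Longrightarrow> ee (\<Sum>i\<in>A. f i) = (\<Prod>i\<in>A. ee (f i))"
  by (induction A rule: finite_induct) (auto simp: ee_add)

lemma sum_words_ee: "(\<Sum>d\<in>words S N. ee (real (word_val S N d) * y)) = (\<Prod>i<N. phi S (real S ^ i * y))"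
proof -
  have "(\<Prod>i<N. phi S (real S ^ i * y)) = (\<Sum>d\<in>words S N. \<Prod>i<N. ee (real (d i) * (real S ^ i * y)))"
    unfolding phi_def words_def by (rule prod_sum_PiE) auto
  also have "\<dots> = (\<Sum>d\<in>words S N. ee (real (word_val S N d) * y))"
    by (intro sum.cong refl) (simp add: word_val_def ee_sum[symmetric] sum_distrib_left mult_ac)
  finally show ?thesis by simp
qed

lemma psi_eq: "psi S N y = norm (\<Sum>d\<in>words S N. ee (real (word_val S N d) * y)) / real (S - 1) ^ N"
  by (simp add: psi_def sum_words_ee)

lemma psi_nonneg [simp]: "0 \<le> psi S N y"
  by (simp add: psi_def)

lemma norm_phi_le: "norm (phi S y) \<le> real (S - 1)"
  using norm_sum[of "\<lambda>a. ee (real a * y)" "{..<S - 1}"] by (simp add: phi_def)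

lemma psi_minus: "psi S N (- y) = psi S N y"
proof -
  have "(\<Sum>d\<in>words S N. ee (real (word_val S N d) * - y)) = cnj (\<Sum>d\<in>words S N. ee (real (word_val S N d) * y))"
    unfolding mult_minus_right ee_minus cnj_sum ..
  then show ?thesis unfolding psi_eq by (simp only: complex_mod_cnj)
qed

lemma psi_le_1: "psi S N y \<le> 1"
proof -
  have "norm (\<Sum>d\<in>words S N. ee (real (word_val S N d) * y)) \<le> real (S - 1) ^ N"
    using norm_sum[of "\<lambda>d. ee (real (word_val S N d) * y)" "words S N"] by simp
  moreover have "real (S - 1) ^ N \<ge> 0" by simp
  ultimately show ?thesis
    unfolding psi_eq by (metis divide_eq_0_iff divide_le_eq_1_pos le_numeral_extra(1) less_eq_real_def zero_le_one)
qed

text \<open>Each factor has modulus at most \<open>S - 1\<close>, so discarding the outer ones only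
  enlarges the normalized product; the \<open>K\<close> factors that remain are those of
  \<open>psi S K\<close> at the rescaled argument.\<close>

lemma psi_le_middle:
  assumes "i + K \<le> N" "S \<ge> 2"
  shows "psi S N y \<le> psi S K (real S ^ i * y)"
proof -
  let ?f = "\<lambda>i. phi S (real S ^ i * y)"
  let ?s = "real (S - 1)"
  have s: "?s > 0" using assms by simp
  have "(\<Prod>j<N. ?f j) = (\<Prod>j<i. ?f j) * ((\<Prod>j\<in>{i..<i+K}. ?f j) * (\<Prod>j\<in>{i+K..<N}. ?f j))"
    using prod.atLeastLessThan_concat[of 0 i N ?f] prod.atLeastLessThan_concat[of i "i + K" N ?f] assms
    by (simp only: lessThan_atLeast0)
  then have "norm (\<Prod>j<N. ?f j) = norm (\<Prod>j<i. ?f j) * (norm (\<Prod>j\<in>{i..<i+K}. ?f j) * norm (\<Prod>j\<in>{i+K..<N}. ?f j))"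
    by (simp add: norm_mult)
  also have "\<dots> \<le> ?s ^ i * (norm (\<Prod>j\<in>{i..<i+K}. ?f j) * ?s ^ (N - (i + K)))"
  proof (intro mult_mono)
    have *: "norm (\<Prod>j\<in>A. ?f j) \<le> ?s ^ card A" for A
      by (rule order.trans[OF norm_prod_le prod_le_power]) (use assms norm_phi_le[of S] in \<open>auto simp del: of_nat_diff simp flip: One_nat_def\<close>)
    show "norm (\<Prod>j<i. ?f j) \<le> ?s ^ i" using *[of "{..<i}"] by simp
    show "norm (\<Prod>j\<in>{i+K..<N}. ?f j) \<le> ?s ^ (N - (i + K))" using *[of "{i+K..<N}"] by simp
  qed auto
  also have "(\<Prod>j\<in>{i..<i+K}. ?f j) = (\<Prod>j<K. phi S (real S ^ j * (real S ^ i * y)))"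
    using prod.shift_bounds_nat_ivl[of ?f 0 i K]
    by (simp add: lessThan_atLeast0 power_add mult_ac add_ac)
  finally have *: "norm (\<Prod>j<N. ?f j) \<le> ?s ^ i * (norm (\<Prod>j<K. phi S (real S ^ j * (real S ^ i * y))) * ?s ^ (N - (i + K)))" .
  have "norm (\<Prod>j<N. ?f j) \<le> ?s ^ (N - K) * norm (\<Prod>j<K. phi S (real S ^ j * (real S ^ i * y)))"
  proof -
    have "?s ^ (N - K) = ?s ^ i * ?s ^ (N - (i + K))"
      using assms by (simp flip: power_add)
    then show ?thesis
      using * by (simp only: mult_ac)
  qed
  then have "psi S N y \<le> ?s ^ (N - K) * norm (\<Prod>j<K. phi S (real S ^ j * (real S ^ i * y))) / ?s ^ N"
    unfolding psi_def by (rule divide_right_mono) (use s in auto)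
  also have "?s ^ N = ?s ^ (N - K) * ?s ^ K" using assms by (simp flip: power_add)
  finally show ?thesis using s by (simp add: psi_def)
qed

text \<open>The average of a cross term over the words is a value of the characteristic function.
  The part \<open>x0\<close>, which stands for the digits already fixed, only rotates it, so the
  bound does not depend on those digits.\<close>

lemma second_moment_le:
  fixes f :: "'a \<Rightarrow> real"
  assumes "S \<ge> 2"
  shows "(\<Sum>d\<in>words S N. (norm (\<Sum>n\<in>C. ee (f n * (x0 + real (word_val S N d) / B))))\<^sup>2)
     \<le> real (S - 1) ^ N * (\<Sum>n\<in>C. \<Sum>m\<in>C. psi S N ((f n - f m) / B))"
proof -
  let ?X = "\<lambda>d. x0 + real (word_val S N d) / B"
  have "complex_of_real (\<Sum>d\<in>words S N. (norm (\<Sum>n\<in>C. ee (f n * ?X d)))\<^sup>2)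
      = (\<Sum>d\<in>words S N. \<Sum>n\<in>C. \<Sum>m\<in>C. ee ((f n - f m) * ?X d))"
    unfolding of_real_sum norm_sum_squared
  proof (intro sum.cong refl)
    fix d n m
    have "(f n - f m) * ?X d = f n * ?X d + - (f m * ?X d)" by (simp add: left_diff_distrib)
    then show "ee (f n * ?X d) * cnj (ee (f m * ?X d)) = ee ((f n - f m) * ?X d)"
      by (simp only: ee_add ee_minus)
  qed
  also have "\<dots> = (\<Sum>n\<in>C. \<Sum>m\<in>C. \<Sum>d\<in>words S N. ee ((f n - f m) * ?X d))"
    by (rule trans[OF sum.swap], rule sum.cong[OF refl], rule sum.swap)
  finally have "norm (complex_of_real (\<Sum>d\<in>words S N. (norm (\<Sum>n\<in>C. ee (f n * ?X d)))\<^sup>2))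
      = norm (\<Sum>n\<in>C. \<Sum>m\<in>C. \<Sum>d\<in>words S N. ee ((f n - f m) * ?X d))"
    by (rule arg_cong)
  then have "\<bar>\<Sum>d\<in>words S N. (norm (\<Sum>n\<in>C. ee (f n * ?X d)))\<^sup>2\<bar>
      = norm (\<Sum>n\<in>C. \<Sum>m\<in>C. \<Sum>d\<in>words S N. ee ((f n - f m) * ?X d))"
    unfolding norm_of_real .
  also have "\<dots> \<le> (\<Sum>n\<in>C. \<Sum>m\<in>C. norm (\<Sum>d\<in>words S N. ee ((f n - f m) * ?X d)))"
    by (intro order.trans[OF norm_sum] sum_mono norm_sum)
  also have "\<dots> = (\<Sum>n\<in>C. \<Sum>m\<in>C. real (S - 1) ^ N * psi S N ((f n - f m) / B))"
  proof (intro sum.cong refl)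
    fix n m
    have "(\<Sum>d\<in>words S N. ee ((f n - f m) * ?X d))
        = ee ((f n - f m) * x0) * (\<Sum>d\<in>words S N. ee (real (word_val S N d) * ((f n - f m) / B)))"
      unfolding sum_distrib_left ee_add[symmetric]
      by (intro sum.cong refl arg_cong[where f = ee]) (simp add: distrib_left)
    then have "norm (\<Sum>d\<in>words S N. ee ((f n - f m) * ?X d))
        = norm (\<Sum>d\<in>words S N. ee (real (word_val S N d) * ((f n - f m) / B)))"
      by (simp add: norm_mult)
    then show "norm (\<Sum>d\<in>words S N. ee ((f n - f m) * ?X d)) = real (S - 1) ^ N * psi S N ((f n - f m) / B)"
      unfolding psi_eq using assms by simp
  qed
  finally show ?thesis by (simp add: sum_distrib_left)
qed

text \<open>The words have distinct values below \<open>Q\<close>, so Parseval turns their number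
  \<open>(S - 1) ^ K\<close> into the mean square \<open>1 / (S - 1) ^ K\<close> of
  \<open>psi\<close> on the grid.\<close>

lemma psi_grid:
  assumes "S \<ge> 2" "S ^ K \<le> Q"
  shows "(\<Sum>c<Q. (psi S K (real c / real Q))\<^sup>2) = real Q / real (S - 1) ^ K"
proof -
  let ?V = "word_val S K ` words S K"
  have V: "?V \<subseteq> {..<Q}" using word_val_less assms by (fastforce dest: word_val_less)
  have "(\<Sum>d\<in>words S K. ee (real (word_val S K d) * (real c / real Q))) = (\<Sum>a\<in>?V. 1 * ee (real a * real c / real Q))" for c
    by (simp add: sum.reindex[OF inj_on_word_val])
  then have "(\<Sum>c<Q. (psi S K (real c / real Q))\<^sup>2)
      = (\<Sum>c<Q. (norm (\<Sum>a\<in>?V. 1 * ee (real a * real c / real Q)))\<^sup>2) / (real (S - 1) ^ K)\<^sup>2"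
    unfolding psi_eq by (simp only: power_divide sum_divide_distrib)
  also have "\<dots> = (real Q * (\<Sum>a\<in>?V. (norm (1::complex))\<^sup>2)) / (real (S - 1) ^ K)\<^sup>2"
    unfolding grid_parseval[OF V] ..
  also have "(\<Sum>a\<in>?V. (norm (1::complex))\<^sup>2) = real (S - 1) ^ K"
    by (simp add: card_image[OF inj_on_word_val])
  finally show ?thesis using assms by (simp add: power2_eq_square)
qed

lemma psi_lipschitz:
  assumes "S \<ge> 2"
  shows "\<bar>psi S K y - psi S K y'\<bar> \<le> 2 * pi * real S ^ K * \<bar>y - y'\<bar>"
proof -
  let ?s = "real (S - 1) ^ K"
  let ?F = "\<lambda>y. \<Sum>d\<in>words S K. ee (real (word_val S K d) * y)"
  have s: "?s > 0" using assms by simp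
  have "psi S K y - psi S K y' = (norm (?F y) - norm (?F y')) / ?s"
    by (simp add: psi_eq diff_divide_distrib)
  then have "\<bar>psi S K y - psi S K y'\<bar> = \<bar>norm (?F y) - norm (?F y')\<bar> / ?s"
    using s by (simp add: abs_div)
  also have "\<dots> \<le> norm (?F y - ?F y') / ?s"
    by (intro divide_right_mono norm_triangle_ineq3) auto
  also have "\<dots> \<le> (\<Sum>d\<in>words S K. 2 * pi * real S ^ K * \<bar>y - y'\<bar>) / ?s"
  proof (rule divide_right_mono)
    show "norm (?F y - ?F y') \<le> (\<Sum>d\<in>words S K. 2 * pi * real S ^ K * \<bar>y - y'\<bar>)"
      unfolding sum_subtractf[symmetric]
    proof (rule order.trans[OF norm_sum sum_mono])
      fix d assume d: "d \<in> words S K"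
      let ?v = "real (word_val S K d)"
      have v: "?v \<le> real S ^ K" using word_val_less[OF d] by (simp flip: of_nat_power)
      have "norm (ee (?v * y) - ee (?v * y')) \<le> 2 * pi * \<bar>?v * y - ?v * y'\<bar>" by (rule norm_ee_diff_le)
      also have "\<dots> = 2 * pi * (?v * \<bar>y - y'\<bar>)" by (simp add: abs_mult flip: right_diff_distrib)
      also have "\<dots> \<le> 2 * pi * (real S ^ K * \<bar>y - y'\<bar>)" using v by (intro mult_left_mono mult_right_mono) auto
      finally show "norm (ee (?v * y) - ee (?v * y')) \<le> 2 * pi * real S ^ K * \<bar>y - y'\<bar>" by (simp add: mult_ac)
    qed
  qed auto
  also have "\<dots> = 2 * pi * real S ^ K * \<bar>y - y'\<bar>"
    unfolding sum_constant card_words of_nat_power using s by (intro nonzero_mult_div_cancel_left less_imp_neq[symmetric])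
  finally show ?thesis .
qed

text \<open>The two factors together are close to the corresponding sum over all \<open>S ^ 2\<close> pairs of digits,
  which is geometric.\<close>

lemma psi_square:
  fixes U :: nat
  assumes U: "U \<ge> 2" and S: "S = U\<^sup>2" and y: "1 / real U ^ 3 \<le> y" "y < 1 / real U"
  shows "psi S 2 y \<le> 5 / real U"
proof -
  define F where "F z = (\<Sum>a<S. ee (real a * z))" for z
  have S4: "S \<ge> 4" using U S power_mono[of 2 U 2] by simp
  have phiF: "phi S z = F z - ee (real (S - 1) * z)" for z
  proof -
    have "S = Suc (S - 1)" using S4 by simp
    then have "F z = (\<Sum>a<Suc (S - 1). ee (real a * z))" by (simp add: F_def)
    then show ?thesis by (simp add: phi_def)
  qed
  have geo: "F z * (ee z - 1) = ee (real S * z) - 1" for z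
    unfolding F_def ee_of_nat_mult by (simp add: power_diff_1_eq mult.commute)
  have Fle: "norm (F z) \<le> real S" for z
    using norm_sum[of "\<lambda>a. ee (real a * z)" "{..<S}"] by (simp add: F_def)
  have rU: "real U \<ge> 2" using U by simp
  \<comment> \<open>This lower end is \<open>(1 / U) / S\<close>, so the window spans one factor
    \<open>S\<close>. The geometric sum loses at most a factor of order \<open>U ^ 3\<close> here,
    against the \<open>S ^ 2 = U ^ 4\<close> pairs of digits.\<close>
  let ?d = "1 / real U ^ 3"
  have "1 / real U \<le> 1/2" using rU by (simp add: field_simps)
  moreover have "?d \<le> 1/2"
  proof -
    have "2 \<le> real U ^ 3" using self_le_power[of "real U" 3] rU by linarith
    then show ?thesis using rU by (simp add: divide_simps)
  qed
  ultimately have "2 * ?d \<le> sin (pi * y)" using y by (intro sin_pi_ge) auto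
  then have d4: "4 * ?d \<le> norm (ee y - 1)" by (simp add: norm_ee_diff_1)
  have dpos: "?d > 0" using rU by simp
  have "F (real S * y) * F y * (ee y - 1) = ee (real S * (real S * y)) - 1"
    using geo[of y] geo[of "real S * y"] by (simp add: mult.assoc)
  then have "norm (F (real S * y) * F y) * norm (ee y - 1) = norm (ee (real S * (real S * y)) - 1)"
    by (metis norm_mult)
  also have "\<dots> \<le> 2" using norm_triangle_ineq4[of "ee (real S * (real S * y))" 1] by simp
  finally have "norm (F (real S * y) * F y) * (4 * ?d) \<le> 2"
    using d4 by (meson mult_left_mono norm_ge_zero order_trans)
  then have FF: "norm (F (real S * y) * F y) \<le> real U ^ 3 / 2"
    using rU by (simp add: field_simps)
  have "phi S y * phi S (real S * y) = F (real S * y) * F y - F y * ee (real (S - 1) * (real S * y))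
      - ee (real (S - 1) * y) * phi S (real S * y)"
    by (simp add: phiF algebra_simps)
  then have "norm (phi S y * phi S (real S * y)) \<le> norm (F (real S * y) * F y) + norm (F y * ee (real (S - 1) * (real S * y)))
      + norm (ee (real (S - 1) * y) * phi S (real S * y))"
    by (simp only:) (rule order.trans[OF norm_triangle_ineq4 add_right_mono[OF norm_triangle_ineq4]])
  also have "\<dots> \<le> real U ^ 3 / 2 + real S + real S"
    using FF Fle[of y] norm_phi_le[of S "real S * y"] S4 by (simp add: norm_mult)
  finally have num: "norm (phi S y * phi S (real S * y)) \<le> real U ^ 3 / 2 + 2 * real U ^ 2" by (simp add: S)
  have den: "real U ^ 4 / 2 \<le> real (S - 1) ^ 2"
  proof -
    have "real U ^ 2 \<ge> 4" using power_mono[of 2 "real U" 2] rU by simp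
    then have "0 \<le> (real U ^ 2 - 4) * real U ^ 2 / 2 + 1" by simp
    then have "real U ^ 4 / 2 \<le> (real U ^ 2 - 1) ^ 2" by (simp add: power2_eq_square field_simps numeral_eq_Suc)
    also have "real U ^ 2 - 1 = real (S - 1)" using S4 S by (simp add: of_nat_diff)
    finally show ?thesis .
  qed
  have "psi S 2 y = norm (phi S y * phi S (real S * y)) / real (S - 1) ^ 2"
    by (simp add: psi_def numeral_2_eq_2)
  also have "\<dots> \<le> (real U ^ 3 / 2 + 2 * real U ^ 2) / (real U ^ 4 / 2)"
    using num den rU by (intro frac_le) auto
  also have "\<dots> = 1 / real U + 4 / real U ^ 2" using rU by (simp add: field_simps numeral_eq_Suc)
  also have "4 / real U ^ 2 \<le> 4 / real U" using rU self_le_power[of "real U" 2] by (intro divide_left_mono) auto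
  finally show ?thesis by simp
qed

text \<open>Consecutive values \<open>z * S ^ i\<close> differ by the factor \<open>S\<close>, which
  is the ratio of the ends of the window, so the last value below \<open>\<tau>\<close> lies in
  it.\<close>

lemma scale_into_window:
  fixes z \<tau> :: real
  assumes "z < \<tau>" "\<tau> \<le> z * real S ^ J" "S \<ge> 2"
  obtains i where "i < J" "\<tau> / real S \<le> real S ^ i * z" "real S ^ i * z < \<tau>"
proof -
  define j where "j = (LEAST j. \<tau> \<le> z * real S ^ j)"
  have j: "\<tau> \<le> z * real S ^ j" unfolding j_def by (rule LeastI[of _ J]) (rule assms)
  have "j \<le> J" unfolding j_def by (rule Least_le) (rule assms)
  have "j \<noteq> 0" using j assms(1) by (intro notI) simp
  then obtain i where i: "j = Suc i" using not0_implies_Suc by blast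
  have "\<not> \<tau> \<le> z * real S ^ i" using not_less_Least[of i "\<lambda>j. \<tau> \<le> z * real S ^ j"] i unfolding j_def by auto
  with j i \<open>j \<le> J\<close> assms(3) show thesis
    by (intro that[of i]) (auto simp: field_simps)
qed

lemma abs_ln_diff_le:
  fixes y y' :: real
  assumes "0 < c" "c \<le> y" "c \<le> y'"
  shows "\<bar>ln y - ln y'\<bar> \<le> \<bar>y - y'\<bar> / c"
proof -
  have *: "ln b - ln a \<le> (b - a) / c" if "c \<le> a" "a \<le> b" for a b
  proof -
    have "ln b - ln a = ln (b / a)" using that assms(1) by (simp add: ln_div)
    also have "\<dots> \<le> b / a - 1" using that assms(1) by (intro ln_le_minus_one) auto
    also have "\<dots> = (b - a) / a" using that assms(1) by (simp add: field_simps)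
    also have "\<dots> \<le> (b - a) / c" using that assms(1) by (intro divide_left_mono) auto
    finally show ?thesis .
  qed
  show ?thesis
  proof (cases "y \<le> y'")
    case True
    then have "ln y \<le> ln y'" using assms by simp
    then show ?thesis using *[of y y'] True assms by simp
  next
    case False
    then have "ln y' \<le> ln y" using assms by simp
    then show ?thesis using *[of y' y] False assms by simp
  qed
qed

text \<open>The logarithm of \<open>y m\<close> in base \<open>S\<close> is
  \<open>m * ln r / ln S\<close> up to a constant and an integer. So the indices that share a grid
  cell of width \<open>1 / Q\<close> are close under the rotation, and \<open>rotation_count\<close>
  bounds their number. Replacing \<open>y m\<close> by its cell costs a Lipschitz error, and
  Parseval evaluates the sum over the cells.\<close>

lemma sum_psi_sq_rotation:
  fixes r S K M a :: nat and y :: "nat \<Rightarrow> real"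
  assumes r: "r \<ge> 2" and S: "S \<ge> 4" and K: "K \<ge> 1"
    and ind: "\<And>n p. n \<ge> 1 \<Longrightarrow> p \<ge> 1 \<Longrightarrow> r ^ n \<noteq> S ^ p"
    and C: "C \<subseteq> {a..<a + M}" and h: "h > 0"
    and y: "\<And>m. m \<in> C \<Longrightarrow> 1 / real S \<le> y m \<and> y m < 1"
    and rel: "\<And>m. m \<in> C \<Longrightarrow> \<exists>i. y m = real S ^ i * (h * real r ^ m)"
  defines "\<Lambda> \<equiv> S ^ (2 * K)"
  shows "(\<Sum>m\<in>C. (psi S K (y m))\<^sup>2) \<le>
    (8 * real M + 8 * ln S * real r ^ \<Lambda> * real \<Lambda>) * (5 * real S) / real (S - 1) ^ K"
proof -
  \<comment> \<open>As \<open>y \<ge> 1 / S\<close>, a cell has logarithmic width at most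
    \<open>S / Q\<close>, and the factor \<open>2 * S\<close> puts this below
    \<open>1 / \<Lambda>\<close>. The exponent \<open>2 * K\<close> in \<open>\<Lambda>\<close>
    keeps the total Lipschitz error \<open>2 * Q * \<epsilon> ^ 2\<close> at
    \<open>4 * pi ^ 2 / S\<close>.\<close>
  define Q where "Q = 2 * S * \<Lambda>"
  define cell where "cell m = nat \<lfloor>real Q * y m\<rfloor>" for m
  define E where "E = 8 * real M / real \<Lambda> + 8 * ln S * real r ^ \<Lambda>"
  define \<epsilon> where "\<epsilon> = 2 * pi * real S ^ K / real Q"
  have L16: "\<Lambda> \<ge> 8"
  proof -
    have "4 ^ 2 \<le> S ^ 2" using S by (rule power_mono) simp
    also have "\<dots> \<le> S ^ (2 * K)" using S K by (intro power_increasing) auto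
    finally show ?thesis by (simp add: \<Lambda>_def)
  qed
  have Q0: "Q > 0" using S L16 by (simp add: Q_def)
  have rS: "real S > 0" using S by simp
  have finC: "finite C" using C finite_subset by blast
  have lnS: "1 \<le> ln (real S)"
  proof -
    have "exp 1 \<le> real S" using exp_le S by linarith
    then show ?thesis using S by (subst ln_ge_iff) auto
  qed
  have ypos: "0 < y m" if "m \<in> C" for m
  proof -
    have "0 < 1 / real S" using rS by simp
    then show ?thesis using y[OF that] by linarith
  qed
  have cell: "real (cell m) \<le> real Q * y m" "real Q * y m < real (cell m) + 1" if "m \<in> C" for m
  proof -
    have "0 \<le> real Q * y m" using ypos[OF that] by simp
    then have "real (cell m) = of_int \<lfloor>real Q * y m\<rfloor>" unfolding cell_def by simp
    then show "real (cell m) \<le> real Q * y m" "real Q * y m < real (cell m) + 1" by linarith+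
  qed
  have cellQ: "cell m < Q" if "m \<in> C" for m
  proof -
    have "real Q * y m < real Q * 1" using y[OF that] Q0 by (intro mult_strict_left_mono) auto
    then have "real (cell m) < real Q" using cell(1)[OF that] by linarith
    then show ?thesis by simp
  qed
  have count: "real (card {m\<in>C. cell m = c}) \<le> E" for c
  proof -
    have "real (card {m\<in>C. cell m = c}) \<le> 8 * real M / real \<Lambda> + 2 / (1 / (4 * ln (real S))) * real r ^ \<Lambda>"
    proof (rule rotation_count[where \<theta> = "ln r / ln S"])
      show "0 < 1 / (4 * ln (real S))" using lnS by simp
      show "1 \<le> real r" using r by simp
      show "1 / (4 * ln (real S)) / real r ^ n \<le> \<bar>real n * (ln r / ln S) - of_int p\<bar>" if "1 \<le> n" for n p
        by (rule log_ratio_badly_approximable) (use r S ind that in auto)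
      show "8 \<le> \<Lambda>" by (rule L16)
      show "{m \<in> C. cell m = c} \<subseteq> {a..<a + M}" using C by auto
      fix m m' assume "m \<in> {m \<in> C. cell m = c}" "m' \<in> {m \<in> C. cell m = c}"
      then have mC: "m \<in> C" "m' \<in> C" and eq: "cell m = cell m'" by auto
      obtain i where i: "y m = real S ^ i * (h * real r ^ m)" using rel[OF mC(1)] by blast
      obtain i' where i': "y m' = real S ^ i' * (h * real r ^ m')" using rel[OF mC(2)] by blast
      have r0: "real r > 0" using r by simp
      have l1: "ln (y m) = real i * ln S + (ln h + real m * ln r)"
        unfolding i using rS h r0 by (simp add: ln_mult ln_realpow)
      have l2: "ln (y m') = real i' * ln S + (ln h + real m' * ln r)"
        unfolding i' using rS h r0 by (simp add: ln_mult ln_realpow)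
      have "(real m - real m') * (ln r / ln S) - of_int (int i' - int i) = (ln (y m) - ln (y m')) / ln S"
        unfolding l1 l2 using lnS by (simp add: field_simps)
      then have "\<bar>(real m - real m') * (ln r / ln S) - of_int (int i' - int i)\<bar> = \<bar>ln (y m) - ln (y m')\<bar> / ln S"
        using lnS by (simp add: abs_div)
      also have "\<dots> \<le> \<bar>ln (y m) - ln (y m')\<bar> / 1"
        using lnS by (intro divide_left_mono) auto
      also have "\<dots> \<le> \<bar>y m - y m'\<bar> / (1 / real S)"
        using abs_ln_diff_le[of "1 / real S" "y m" "y m'"] y mC rS by simp
      also have "\<dots> = \<bar>real Q * y m - real Q * y m'\<bar> * (real S / real Q)"
        using Q0 by (simp add: abs_mult flip: right_diff_distrib)
      also have "\<dots> \<le> 1 * (real S / real Q)"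
      proof (rule mult_right_mono)
        show "\<bar>real Q * y m - real Q * y m'\<bar> \<le> 1"
          using cell[OF mC(1)] cell[OF mC(2)] eq by linarith
      qed simp
      also have "\<dots> < 1 / real \<Lambda>"
        using S L16 by (simp add: Q_def field_simps)
      finally show "\<exists>p. \<bar>(real m - real m') * (ln r / ln S) - of_int p\<bar> < 1 / real \<Lambda>" by blast
    qed
    then show ?thesis by (simp add: E_def)
  qed
  have E0: "0 \<le> E" unfolding E_def using lnS by simp
  have pt: "(psi S K (y m))\<^sup>2 \<le> 2 * (psi S K (real (cell m) / real Q))\<^sup>2 + 2 * \<epsilon>\<^sup>2" if "m \<in> C" for m
  proof -
    have "\<bar>psi S K (y m) - psi S K (real (cell m) / real Q)\<bar> \<le> 2 * pi * real S ^ K * \<bar>y m - real (cell m) / real Q\<bar>"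
      by (rule psi_lipschitz) (use S in simp)
    also have "\<dots> \<le> 2 * pi * real S ^ K * (1 / real Q)"
    proof (rule mult_left_mono)
      have "y m - real (cell m) / real Q = (real Q * y m - real (cell m)) / real Q"
        using Q0 by (simp add: field_simps)
      then have "\<bar>y m - real (cell m) / real Q\<bar> = \<bar>real Q * y m - real (cell m)\<bar> / real Q"
        by simp
      also have "\<dots> \<le> 1 / real Q" using cell[OF that] by (intro divide_right_mono) auto
      finally show "\<bar>y m - real (cell m) / real Q\<bar> \<le> 1 / real Q" .
    qed auto
    finally have d: "\<bar>psi S K (y m) - psi S K (real (cell m) / real Q)\<bar> \<le> \<epsilon>" by (simp add: \<epsilon>_def)
    define u v where "u = psi S K (y m)" and "v = psi S K (real (cell m) / real Q)"
    have uv: "0 \<le> u" "0 \<le> v" "u \<le> v + \<epsilon>" using d by (auto simp: u_def v_def)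
    then have "u\<^sup>2 \<le> (v + \<epsilon>)\<^sup>2" by (intro power_mono) auto
    also have "\<dots> \<le> 2 * v\<^sup>2 + 2 * \<epsilon>\<^sup>2" using sum_squares_bound[of v \<epsilon>] by (simp add: power2_sum)
    finally show ?thesis by (simp add: u_def v_def)
  qed
  have "(\<Sum>m\<in>C. (psi S K (y m))\<^sup>2) = (\<Sum>c<Q. \<Sum>m\<in>{m\<in>C. cell m = c}. (psi S K (y m))\<^sup>2)"
    by (rule sum.group[symmetric]) (use finC cellQ in auto)
  also have "\<dots> \<le> (\<Sum>c<Q. E * (2 * (psi S K (real c / real Q))\<^sup>2 + 2 * \<epsilon>\<^sup>2))"
  proof (rule sum_mono)
    fix c
    have "(\<Sum>m\<in>{m\<in>C. cell m = c}. (psi S K (y m))\<^sup>2) \<le> (\<Sum>m\<in>{m\<in>C. cell m = c}. 2 * (psi S K (real c / real Q))\<^sup>2 + 2 * \<epsilon>\<^sup>2)"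
      by (rule sum_mono) (use pt in auto)
    also have "\<dots> = real (card {m\<in>C. cell m = c}) * (2 * (psi S K (real c / real Q))\<^sup>2 + 2 * \<epsilon>\<^sup>2)" by simp
    also have "\<dots> \<le> E * (2 * (psi S K (real c / real Q))\<^sup>2 + 2 * \<epsilon>\<^sup>2)"
      by (intro mult_right_mono count) auto
    finally show "(\<Sum>m\<in>{m\<in>C. cell m = c}. (psi S K (y m))\<^sup>2) \<le> E * (2 * (psi S K (real c / real Q))\<^sup>2 + 2 * \<epsilon>\<^sup>2)" .
  qed
  also have "\<dots> = E * (2 * (\<Sum>c<Q. (psi S K (real c / real Q))\<^sup>2) + 2 * real Q * \<epsilon>\<^sup>2)"
    by (simp add: sum.distrib flip: sum_distrib_left)
  also have "(\<Sum>c<Q. (psi S K (real c / real Q))\<^sup>2) = real Q / real (S - 1) ^ K"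
  proof (rule psi_grid)
    have "S ^ K \<le> S ^ (2 * K)" using S by (intro power_increasing) auto
    also have "\<dots> \<le> Q" using S by (simp add: Q_def \<Lambda>_def)
    finally show "S ^ K \<le> Q" .
  qed (use S in simp)
  also have "E * (2 * (real Q / real (S - 1) ^ K) + 2 * real Q * \<epsilon>\<^sup>2) \<le> E * (5 * real S * real \<Lambda> / real (S - 1) ^ K)"
  proof (rule mult_left_mono[OF _ E0])
    have e: "2 * real Q * \<epsilon>\<^sup>2 = 4 * pi\<^sup>2 / real S"
      using S by (simp add: \<epsilon>_def Q_def \<Lambda>_def power_mult_distrib power_divide power2_eq_square field_simps flip: power_mult power_add mult_2)
    have "4 * pi\<^sup>2 / real S \<le> 4 * 16 / 4"
    proof (rule frac_le)
      show "4 * pi\<^sup>2 \<le> 4 * 16" using power_mono[of pi 4 2] pi_less_4 by simp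
    qed (use S in auto)
    also have "\<dots> \<le> real S * 4" using S by simp
    also have "\<dots> \<le> real S * (real \<Lambda> / real (S - 1) ^ K)"
    proof (rule mult_left_mono)
      have "4 \<le> real S" using S by simp
      also have "\<dots> \<le> real S ^ K" using S K by (intro self_le_power) auto
      also have "\<dots> = real \<Lambda> / real S ^ K" using S by (simp add: \<Lambda>_def mult_2 power_add)
      also have "\<dots> \<le> real \<Lambda> / real (S - 1) ^ K"
        using S by (intro divide_left_mono power_mono mult_pos_pos) auto
      finally show "4 \<le> real \<Lambda> / real (S - 1) ^ K" .
    qed simp
    finally have "2 * real Q * \<epsilon>\<^sup>2 \<le> real S * real \<Lambda> / real (S - 1) ^ K" using e by simp
    moreover have "2 * (real Q / real (S - 1) ^ K) = 4 * (real S * real \<Lambda> / real (S - 1) ^ K)"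
      by (simp add: Q_def)
    moreover have "5 * real S * real \<Lambda> / real (S - 1) ^ K = 5 * (real S * real \<Lambda> / real (S - 1) ^ K)" by simp
    ultimately show "2 * (real Q / real (S - 1) ^ K) + 2 * real Q * \<epsilon>\<^sup>2 \<le> 5 * real S * real \<Lambda> / real (S - 1) ^ K"
      by linarith
  qed
  also have "\<dots> = (8 * real M + 8 * ln S * real r ^ \<Lambda> * real \<Lambda>) * (5 * real S) / real (S - 1) ^ K"
  proof -
    have "E = (8 * real M + 8 * ln S * real r ^ \<Lambda> * real \<Lambda>) / real \<Lambda>"
      using L16 by (simp add: E_def add_divide_distrib)
    then show ?thesis using L16 by simp
  qed
  finally show ?thesis .
qed

text \<open>Grouping pairs by their difference \<open>d\<close> is what makes the rotation
  applicable: for fixed \<open>d\<close> the frequency \<open>r ^ (m + d) - r ^ m\<close> is a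
  constant times \<open>r ^ m\<close>.\<close>

lemma sum_pairs_le:
  fixes g :: "nat \<Rightarrow> nat \<Rightarrow> real"
  assumes C: "C \<subseteq> {a..<a + M}" and sym: "\<And>n m. g n m = g m n" and diag: "\<And>n. g n n \<le> 1"
  shows "(\<Sum>n\<in>C. \<Sum>m\<in>C. g n m) \<le> real M + 2 * (\<Sum>d\<in>{1..<M}. \<Sum>m\<in>{m\<in>C. m + d \<in> C}. g (m + d) m)"
proof -
  have fin: "finite C" using C finite_subset by blast
  define T where "T = (\<Sum>m\<in>C. \<Sum>n\<in>C. if m < n then g n m else 0)"
  have "(\<Sum>n\<in>C. \<Sum>m\<in>C. g n m) = (\<Sum>n\<in>C. \<Sum>m\<in>C. (if m = n then g n n else 0) + (if m < n then g n m else 0) + (if n < m then g m n else 0))"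
    by (intro sum.cong refl) (auto simp: sym)
  also have "\<dots> = (\<Sum>n\<in>C. g n n) + (\<Sum>n\<in>C. \<Sum>m\<in>C. if m < n then g n m else 0) + (\<Sum>n\<in>C. \<Sum>m\<in>C. if n < m then g m n else 0)"
    using fin by (simp add: sum.distrib sum.delta)
  also have "(\<Sum>n\<in>C. \<Sum>m\<in>C. if m < n then g n m else 0) = T"
    unfolding T_def by (rule sum.swap)
  also have "(\<Sum>n\<in>C. \<Sum>m\<in>C. if n < m then g m n else 0) = T"
    unfolding T_def ..
  also have "(\<Sum>n\<in>C. g n n) \<le> real (card C)"
    using sum_mono[of C "\<lambda>n. g n n" "\<lambda>_. 1"] diag by simp
  also have "card C \<le> M" using card_mono[OF _ C] by simp
  also have "T = (\<Sum>m\<in>C. \<Sum>d\<in>{1..<M}. if m + d \<in> C then g (m + d) m else 0)"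
    unfolding T_def
  proof (rule sum.cong[OF refl])
    fix m assume m: "m \<in> C"
    have Ca: "a \<le> n \<and> n < a + M" if "n \<in> C" for n using C that by auto
    have "(\<Sum>n\<in>C. if m < n then g n m else 0) = (\<Sum>n\<in>{n\<in>C. m < n}. g n m)"
      using fin by (simp add: sum.inter_filter)
    also have "\<dots> = (\<Sum>d\<in>{d\<in>{1..<M}. m + d \<in> C}. g (m + d) m)"
    proof (rule sum.reindex_bij_witness[of _ "\<lambda>d. m + d" "\<lambda>n. n - m"])
      fix n assume n: "n \<in> {n \<in> C. m < n}"
      then show "m + (n - m) = n" "g (m + (n - m)) m = g n m" by auto
      show "n - m \<in> {d \<in> {1..<M}. m + d \<in> C}" using n Ca[of n] Ca[OF m] by auto
    qed auto
    also have "\<dots> = (\<Sum>d\<in>{1..<M}. if m + d \<in> C then g (m + d) m else 0)"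
      by (rule sum.inter_filter) simp
    finally show "(\<Sum>n\<in>C. if m < n then g n m else 0) = (\<Sum>d\<in>{1..<M}. if m + d \<in> C then g (m + d) m else 0)" .
  qed
  also have "\<dots> = (\<Sum>d\<in>{1..<M}. \<Sum>m\<in>{m\<in>C. m + d \<in> C}. g (m + d) m)"
    using fin by (subst sum.swap) (simp add: sum.inter_filter)
  finally show ?thesis by simp
qed

section \<open>Closure properties of relative computability\<close>

text \<open>The rules of \<open>recursive_in\<close> leave accidental values on lists of the wrong
  length. Identifying functions that agree on lists of length \<open>k\<close> makes the closure
  properties below compositional.\<close>

definition rc :: "(nat \<Rightarrow> nat) set \<Rightarrow> nat \<Rightarrow> (nat list \<Rightarrow> nat) \<Rightarrow> bool" where
  "rc A k F \<longleftrightarrow> (\<exists>F'. recursive_in A k F' \<and> (\<forall>xs. length xs = k \<longrightarrow> F' xs = F xs))"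

lemma rcI: "recursive_in A k F \<Longrightarrow> rc A k F"
  unfolding rc_def by blast

lemma rc_cong: "rc A k F \<Longrightarrow> (\<And>xs. length xs = k \<Longrightarrow> F xs = F' xs) \<Longrightarrow> rc A k F'"
  unfolding rc_def by fastforce

lemma rc_comp:
  assumes F: "rc A (length Gs) F" and G: "\<And>G. G \<in> set Gs \<Longrightarrow> rc A k G"
  shows "rc A k (\<lambda>xs. F (map (\<lambda>G. G xs) Gs))"
proof -
  obtain F' where F': "recursive_in A (length Gs) F'" "\<And>xs. length xs = length Gs \<Longrightarrow> F' xs = F xs"
    using F unfolding rc_def by blast
  have "\<forall>G\<in>set Gs. \<exists>G'. recursive_in A k G' \<and> (\<forall>xs. length xs = k \<longrightarrow> G' xs = G xs)"
    using G unfolding rc_def by blast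
  then obtain h where h: "\<forall>G\<in>set Gs. recursive_in A k (h G) \<and> (\<forall>xs. length xs = k \<longrightarrow> h G xs = G xs)"
    by metis
  have "recursive_in A k (\<lambda>xs. F' (map (\<lambda>G. G xs) (map h Gs)))"
    by (rule recursive_in.comp) (use F' h in auto)
  moreover have "F' (map (\<lambda>G. G xs) (map h Gs)) = F (map (\<lambda>G. G xs) Gs)" if "length xs = k" for xs
  proof -
    have "map (\<lambda>G. G xs) (map h Gs) = map (\<lambda>G. G xs) Gs" using h that by simp
    then show ?thesis by (simp only: F'(2) length_map)
  qed
  ultimately show ?thesis unfolding rc_def by blast
qed

lemma rc_prim_rec:
  assumes F: "rc A k F" and G: "rc A (Suc (Suc k)) G"
  shows "rc A (Suc k) (\<lambda>xs. rec_nat (F (tl xs)) (\<lambda>n y. G (n # y # tl xs)) (hd xs))"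
proof -
  obtain F' where F': "recursive_in A k F'" "\<And>xs. length xs = k \<Longrightarrow> F' xs = F xs"
    using F unfolding rc_def by blast
  obtain G' where G': "recursive_in A (Suc (Suc k)) G'" "\<And>xs. length xs = Suc (Suc k) \<Longrightarrow> G' xs = G xs"
    using G unfolding rc_def by blast
  have "rec_nat (F' (tl xs)) (\<lambda>n y. G' (n # y # tl xs)) m = rec_nat (F (tl xs)) (\<lambda>n y. G (n # y # tl xs)) m"
    if "length xs = Suc k" for xs m
    by (induction m) (use that in \<open>auto simp: F' G'\<close>)
  then show ?thesis
    unfolding rc_def using recursive_in.prim_rec[OF F'(1) G'(1)] by blast
qed

lemma rc_nth: "i < k \<Longrightarrow> rc A k (\<lambda>xs. xs ! i)"
  by (intro rcI recursive_in.proj)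

lemma rc_hd: "rc A (Suc k) hd"
proof (rule rc_cong[OF rc_nth[of 0]])
  show "xs ! 0 = hd xs" if "length xs = Suc k" for xs :: "nat list"
    using that by (cases xs) auto
qed simp

lemma map_nth_offset: "length xs = m + k \<Longrightarrow> map (\<lambda>i. xs ! (m + i)) [0..<k] = drop m xs"
  by (rule nth_equalityI) auto

lemma rc_tl:
  assumes "rc A k F"
  shows "rc A (Suc k) (\<lambda>ys. F (tl ys))"
proof -
  have "rc A (Suc k) (\<lambda>ys. F (map (\<lambda>G. G ys) (map (\<lambda>i ys. ys ! Suc i) [0..<k])))"
    by (rule rc_comp) (auto simp: assms intro!: rc_nth)
  then show ?thesis
  proof (rule rc_cong)
    fix ys :: "nat list" assume "length ys = Suc k"
    then show "F (map (\<lambda>G. G ys) (map (\<lambda>i ys. ys ! Suc i) [0..<k])) = F (tl ys)"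
      using map_nth_offset[of ys 1 k] by (simp add: comp_def drop_Suc)
  qed
qed

text \<open>The convention for binders is fixed here: a body \<open>F i xs\<close> with bound
  variable \<open>i\<close> is presented as a function of the list \<open>i # xs\<close>. Sums,
  counts and searches below all take their bodies in this form.\<close>

lemma rc_subst_hd:
  assumes "rc A (Suc k) (\<lambda>ys. F (hd ys) (tl ys))" "rc A k b"
  shows "rc A k (\<lambda>xs. F (b xs) xs)"
proof -
  have "rc A k (\<lambda>xs. (\<lambda>ys. F (hd ys) (tl ys)) (map (\<lambda>G. G xs) (b # map (\<lambda>i xs. xs ! i) [0..<k])))"
    by (rule rc_comp) (auto simp: assms intro!: rc_nth)
  then show ?thesis
  proof (rule rc_cong)
    fix xs :: "nat list" assume "length xs = k"
    then show "(\<lambda>ys. F (hd ys) (tl ys)) (map (\<lambda>G. G xs) (b # map (\<lambda>i xs. xs ! i) [0..<k])) = F (b xs) xs"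
      using map_nth_offset[of xs 0 k] by (simp add: comp_def)
  qed
qed

lemma rc_subst1: "rc A 1 (\<lambda>xs. f (xs ! 0)) \<Longrightarrow> rc A k a \<Longrightarrow> rc A k (\<lambda>xs. f (a xs))"
  using rc_comp[of A "[a]" "\<lambda>xs. f (xs ! 0)" k] by simp

lemma rc_Suc: "rc A k a \<Longrightarrow> rc A k (\<lambda>xs. Suc (a xs))"
  by (rule rc_subst1) (intro rcI recursive_in.succ)

lemma rc_const: "rc A k (\<lambda>_. c)"
proof (induction c)
  case 0
  then show ?case by (intro rcI recursive_in.zero)
next
  case (Suc c)
  then show ?case by (rule rc_Suc)
qed

lemma rc_oracle: "g \<in> A \<Longrightarrow> rc A k a \<Longrightarrow> rc A k (\<lambda>xs. g (a xs))"
  by (rule rc_subst1) (intro rcI recursive_in.oracle_call)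

lemma rc_rec_nat:
  assumes F: "rc A k F" and G: "rc A (Suc (Suc k)) (\<lambda>zs. G (hd zs) (hd (tl zs)) (tl (tl zs)))" and n: "rc A k n"
  shows "rc A k (\<lambda>xs. rec_nat (F xs) (\<lambda>i y. G i y xs) (n xs))"
proof -
  have "rc A (Suc k) (\<lambda>ys. rec_nat (F (tl ys)) (\<lambda>i y. G i y (tl ys)) (hd ys))"
    using rc_prim_rec[OF F G] by simp
  then show ?thesis by (rule rc_subst_hd[OF _ n])
qed

lemma rc_add: "rc A k a \<Longrightarrow> rc A k b \<Longrightarrow> rc A k (\<lambda>xs. a xs + b xs)"
proof -
  assume ab: "rc A k a" "rc A k b"
  have "rc A k (\<lambda>xs. rec_nat (a xs) (\<lambda>i y. Suc y) (b xs))"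
    by (intro rc_rec_nat rc_Suc rc_tl rc_hd ab)
  moreover have "rec_nat m (\<lambda>i. Suc) n = m + n" for m n :: nat by (induction n) auto
  ultimately show ?thesis by simp
qed

text \<open>In a recursion the accumulator stands between the counter and the parameters, so a body
  that ignores it has to be carried past that entry.\<close>

lemma rc_skip:
  assumes F: "rc A (Suc k) (\<lambda>ys. F (hd ys) (tl ys))"
  shows "rc A (Suc (Suc k)) (\<lambda>zs. F (hd zs) (tl (tl zs)))"
proof (rule rc_cong)
  show "rc A (Suc (Suc k)) (\<lambda>zs. (\<lambda>ys. F (hd ys) (tl ys))
      (map (\<lambda>G. G zs) ((\<lambda>zs. zs ! 0) # map (\<lambda>i zs. zs ! (2 + i)) [0..<k])))"
    by (rule rc_comp) (auto simp: F intro!: rc_nth)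
  fix zs :: "nat list" assume l: "length zs = Suc (Suc k)"
  then have "map (\<lambda>G. G zs) ((\<lambda>zs. zs ! 0) # map (\<lambda>i zs. zs ! (2 + i)) [0..<k]) = hd zs # tl (tl zs)"
    using map_nth_offset[of zs 2 k] by (cases zs) (auto simp: comp_def numeral_2_eq_2 drop_Suc)
  then show "(\<lambda>ys. F (hd ys) (tl ys)) (map (\<lambda>G. G zs) ((\<lambda>zs. zs ! 0) # map (\<lambda>i zs. zs ! (2 + i)) [0..<k]))
    = F (hd zs) (tl (tl zs))" by (simp only: list.sel)
qed

lemma rc_sum:
  assumes b: "rc A k b" and F: "rc A (Suc k) (\<lambda>ys. F (hd ys) (tl ys))"
  shows "rc A k (\<lambda>xs. \<Sum>i<b xs. F i xs)"
proof -
  have "rc A (Suc (Suc k)) (\<lambda>zs. hd (tl zs) + F (hd zs) (tl (tl zs)))"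
    by (intro rc_add rc_skip[OF F] rc_tl rc_hd)
  then have "rc A k (\<lambda>xs. rec_nat 0 (\<lambda>i y. y + F i xs) (b xs))"
    by (intro rc_rec_nat rc_const b)
  moreover have "rec_nat 0 (\<lambda>i y. y + f i) n = (\<Sum>i<n. f i)" for f :: "nat \<Rightarrow> nat" and n
    by (induction n) auto
  ultimately show ?thesis by simp
qed

lemma rc_mult: "rc A k a \<Longrightarrow> rc A k b \<Longrightarrow> rc A k (\<lambda>xs. a xs * b xs)"
proof -
  assume ab: "rc A k a" "rc A k b"
  have "rc A k (\<lambda>xs. \<Sum>i<a xs. b xs)" by (intro rc_sum rc_tl ab)
  then show ?thesis by simp
qed

lemma rc_power: "rc A k a \<Longrightarrow> rc A k b \<Longrightarrow> rc A k (\<lambda>xs. a xs ^ b xs)"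
proof -
  assume ab: "rc A k a" "rc A k b"
  have "rc A k (\<lambda>xs. rec_nat 1 (\<lambda>i y. a xs * y) (b xs))"
    by (intro rc_rec_nat rc_mult rc_const rc_tl rc_hd ab)
  moreover have "rec_nat 1 (\<lambda>i y. m * y) n = m ^ n" for m n :: nat by (induction n) auto
  ultimately show ?thesis by simp
qed

lemma rc_pred: "rc A k a \<Longrightarrow> rc A k (\<lambda>xs. a xs - 1)"
proof -
  assume a: "rc A k a"
  have "rc A k (\<lambda>xs. rec_nat 0 (\<lambda>i y. i) (a xs))"
    by (intro rc_rec_nat rc_const rc_hd a)
  moreover have "rec_nat 0 (\<lambda>i y. i) n = n - 1" for n :: nat by (cases n) auto
  ultimately show ?thesis by simp
qed

lemma rc_diff: "rc A k a \<Longrightarrow> rc A k b \<Longrightarrow> rc A k (\<lambda>xs. a xs - b xs)"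
proof -
  assume ab: "rc A k a" "rc A k b"
  have "rc A k (\<lambda>xs. rec_nat (a xs) (\<lambda>i y. y - 1) (b xs))"
    by (intro rc_rec_nat rc_pred rc_tl rc_hd ab)
  moreover have "rec_nat m (\<lambda>i y. y - 1) n = m - n" for m n :: nat by (induction n) auto
  ultimately show ?thesis by simp
qed

definition dec :: "(nat \<Rightarrow> nat) set \<Rightarrow> nat \<Rightarrow> (nat list \<Rightarrow> bool) \<Rightarrow> bool" where
  "dec A k P \<longleftrightarrow> rc A k (\<lambda>xs. of_bool (P xs))"

lemma dec_le: "rc A k a \<Longrightarrow> rc A k b \<Longrightarrow> dec A k (\<lambda>xs. a xs \<le> b xs)"
proof -
  assume ab: "rc A k a" "rc A k b"
  have "rc A k (\<lambda>xs. 1 - (a xs - b xs))" by (intro rc_diff rc_const ab)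
  then show ?thesis unfolding dec_def by (rule rc_cong) auto
qed

lemma dec_less: "rc A k a \<Longrightarrow> rc A k b \<Longrightarrow> dec A k (\<lambda>xs. a xs < b xs)"
  using dec_le[OF rc_Suc, of A k a b] by (simp add: Suc_le_eq)

lemma dec_not: "dec A k P \<Longrightarrow> dec A k (\<lambda>xs. \<not> P xs)"
proof -
  assume "dec A k P"
  then have "rc A k (\<lambda>xs. 1 - of_bool (P xs))" unfolding dec_def by (intro rc_diff rc_const)
  then show ?thesis unfolding dec_def by (rule rc_cong) auto
qed

lemma dec_conj: "dec A k P \<Longrightarrow> dec A k P' \<Longrightarrow> dec A k (\<lambda>xs. P xs \<and> P' xs)"
proof -
  assume "dec A k P" "dec A k P'"
  then have "rc A k (\<lambda>xs. of_bool (P xs) * of_bool (P' xs))" unfolding dec_def by (intro rc_mult)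
  then show ?thesis unfolding dec_def by (rule rc_cong) auto
qed

lemma dec_imp: "dec A k P \<Longrightarrow> dec A k P' \<Longrightarrow> dec A k (\<lambda>xs. P xs \<longrightarrow> P' xs)"
  using dec_not[OF dec_conj[OF _ dec_not], of A k P P'] by simp

lemma dec_eq: "rc A k a \<Longrightarrow> rc A k b \<Longrightarrow> dec A k (\<lambda>xs. a xs = b xs)"
  using dec_conj[OF dec_le dec_le, of A k a b b a] by (simp add: eq_iff)

lemma dec_ex:
  assumes "rc A k n" "dec A (Suc k) (\<lambda>ys. P (hd ys) (tl ys))"
  shows "dec A k (\<lambda>xs. \<exists>i<n xs. P i xs)"
proof -
  have "rc A k (\<lambda>xs. \<Sum>i<n xs. of_bool (P i xs))"
    using assms unfolding dec_def by (intro rc_sum)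
  then have "dec A k (\<lambda>xs. \<not> (\<Sum>i<n xs. of_bool (P i xs)) \<le> (0::nat))"
    by (intro dec_not dec_le rc_const)
  moreover have "(\<not> (\<Sum>i<n xs. of_bool (P i xs)) \<le> (0::nat)) \<longleftrightarrow> (\<exists>i<n xs. P i xs)" for xs
    by auto
  ultimately show ?thesis by (simp only:)
qed

lemma dec_all:
  assumes "rc A k n" "dec A (Suc k) (\<lambda>ys. P (hd ys) (tl ys))"
  shows "dec A k (\<lambda>xs. \<forall>i<n xs. P i xs)"
  using dec_not[OF dec_ex[OF assms(1) dec_not[OF assms(2)]]] by simp

lemma rc_if: "dec A k P \<Longrightarrow> rc A k a \<Longrightarrow> rc A k b \<Longrightarrow> rc A k (\<lambda>xs. if P xs then a xs else b xs)"
proof -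
  assume h: "dec A k P" "rc A k a" "rc A k b"
  then have "rc A k (\<lambda>xs. of_bool (P xs) * a xs + of_bool (\<not> P xs) * b xs)"
    using dec_not[OF h(1)] unfolding dec_def by (intro rc_add rc_mult)
  then show ?thesis by (rule rc_cong) auto
qed

lemma rc_card:
  assumes "rc A k n" "dec A (Suc k) (\<lambda>ys. P (hd ys) (tl ys))"
  shows "rc A k (\<lambda>xs. card {i. i < n xs \<and> P i xs})"
proof -
  have "rc A k (\<lambda>xs. \<Sum>i<n xs. of_bool (P i xs))"
    using assms unfolding dec_def by (intro rc_sum)
  moreover have "(\<Sum>i<m. of_bool (p i)) = card {i. i < m \<and> p i}" for m :: nat and p
  proof -
    have "{..<m} \<inter> {i. p i} = {i. i < m \<and> p i}" by auto
    then show ?thesis by simp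
  qed
  ultimately show ?thesis by simp
qed

text \<open>The quotient counts the positive multiples of \<open>b\<close> up to \<open>a\<close>;
  the conjunct \<open>0 < b\<close> produces the value \<open>0\<close> for division by
  \<open>0\<close>.\<close>

lemma rc_div: "rc A k a \<Longrightarrow> rc A k b \<Longrightarrow> rc A k (\<lambda>xs. a xs div b xs)"
proof -
  assume ab: "rc A k a" "rc A k b"
  have "rc A k (\<lambda>xs. card {i. i < a xs \<and> (0 < b xs \<and> Suc i * b xs \<le> a xs)})"
    by (intro rc_card dec_conj dec_le dec_less rc_mult rc_Suc rc_tl rc_hd rc_const ab)
  moreover have "card {i. i < m \<and> (0 < n \<and> Suc i * n \<le> m)} = m div n" for m n :: nat
  proof (cases "n = 0")
    case False
    have "i < m \<and> (0 < n \<and> Suc i * n \<le> m) \<longleftrightarrow> i < m div n" for i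
    proof -
      have "Suc i * n \<le> m \<longleftrightarrow> Suc i \<le> m div n" using False by (simp add: less_eq_div_iff_mult_less_eq)
      moreover have "m div n \<le> m" by simp
      ultimately show ?thesis using False by linarith
    qed
    then show ?thesis by simp
  qed simp
  ultimately show ?thesis by simp
qed

lemma rc_mod: "rc A k a \<Longrightarrow> rc A k b \<Longrightarrow> rc A k (\<lambda>xs. a xs mod b xs)"
proof -
  assume ab: "rc A k a" "rc A k b"
  have "rc A k (\<lambda>xs. a xs - b xs * (a xs div b xs))"
    by (intro rc_diff rc_mult rc_div ab)
  then show ?thesis by (simp only: minus_mult_div_eq_mod)
qed

text \<open>Both searches are cardinalities, so that bounded counting covers them: the largest
  witness up to \<open>n\<close> is the number of \<open>i\<close> below some witness, the least one
  the number of \<open>i\<close> with no witness up to \<open>i\<close>. Without a witness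
  \<open>bmax\<close> is \<open>0\<close> and \<open>bleast\<close> is \<open>n\<close>.\<close>

definition bmax :: "(nat \<Rightarrow> bool) \<Rightarrow> nat \<Rightarrow> nat" where
  "bmax P n = card {i. i < n \<and> (\<exists>j<Suc n. i < j \<and> P j)}"

definition bleast :: "(nat \<Rightarrow> bool) \<Rightarrow> nat \<Rightarrow> nat" where
  "bleast P n = card {i. i < n \<and> (\<forall>j<Suc i. \<not> P j)}"

lemma bmax_eq:
  assumes "P j" "j \<le> n" "\<And>i. i \<le> n \<Longrightarrow> P i \<Longrightarrow> i \<le> j"
  shows "bmax P n = j"
proof -
  have "i < n \<and> (\<exists>j<Suc n. i < j \<and> P j) \<longleftrightarrow> i < j" for i
  proof
    assume "i < n \<and> (\<exists>j<Suc n. i < j \<and> P j)"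
    then show "i < j" using assms(3) by (meson less_Suc_eq_le less_le_trans)
  next
    assume "i < j"
    then show "i < n \<and> (\<exists>j<Suc n. i < j \<and> P j)" using assms(1,2) by (auto intro!: exI[of _ j])
  qed
  then show ?thesis by (simp add: bmax_def)
qed

lemma bmax_le: "bmax P n \<le> n"
proof -
  have "bmax P n \<le> card {i. i < n}" unfolding bmax_def by (rule card_mono) auto
  then show ?thesis by simp
qed

lemma bmax_ge: "P j \<Longrightarrow> j \<le> n \<Longrightarrow> j \<le> bmax P n"
proof -
  assume "P j" "j \<le> n"
  then have "card {i. i < j} \<le> bmax P n" unfolding bmax_def by (intro card_mono) (auto intro!: exI[of _ j])
  then show ?thesis by simp
qed

lemma bmax_sat: "bmax P n \<noteq> 0 \<Longrightarrow> P (bmax P n)"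
proof -
  assume "bmax P n \<noteq> 0"
  then have "{i. i < n \<and> (\<exists>j<Suc n. i < j \<and> P j)} \<noteq> {}" unfolding bmax_def by (metis card.empty)
  then have "\<exists>j0\<le>n. P j0" using less_Suc_eq_le by auto
  then obtain j0 where j0: "j0 \<le> n" "P j0" by blast
  define j where "j = Max {j. j \<le> n \<and> P j}"
  have "j \<in> {j. j \<le> n \<and> P j}" unfolding j_def by (rule Max_in) (use j0 in auto)
  moreover have "i \<le> j" if "i \<le> n" "P i" for i unfolding j_def by (rule Max_ge) (use that in auto)
  ultimately have "bmax P n = j" by (intro bmax_eq) auto
  then show ?thesis using \<open>j \<in> _\<close> by simp
qed

lemma bleast_sat:
  assumes "\<exists>v<n. P v"
  shows "P (bleast P n)" "bleast P n < n"
proof -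
  define v where "v = (LEAST v. P v)"
  have v: "P v" unfolding v_def by (rule LeastI_ex) (use assms in auto)
  have le: "v \<le> u" if "P u" for u unfolding v_def by (rule Least_le[of P, OF that])
  have vn: "v < n" using assms le by (meson le_less_trans)
  have "i < n \<and> (\<forall>j<Suc i. \<not> P j) \<longleftrightarrow> i < v" for i
  proof
    assume "i < n \<and> (\<forall>j<Suc i. \<not> P j)"
    then show "i < v" using v by (meson not_less_eq)
  next
    assume "i < v"
    then show "i < n \<and> (\<forall>j<Suc i. \<not> P j)" using vn le by (metis Suc_leI leD less_trans order_less_le_trans)
  qed
  then have "bleast P n = v" by (simp add: bleast_def)
  then show "P (bleast P n)" "bleast P n < n" using v vn by auto
qed

lemma rc_bmax:
  assumes "rc A k n" "dec A (Suc k) (\<lambda>ys. P (hd ys) (tl ys))"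
  shows "rc A k (\<lambda>xs. bmax (\<lambda>j. P j xs) (n xs))"
proof -
  have "dec A (Suc (Suc k)) (\<lambda>ys. P (hd ys) (tl (tl ys)))"
    using assms(2) unfolding dec_def by (rule rc_skip)
  then show ?thesis unfolding bmax_def
    by (intro rc_card dec_ex dec_conj dec_less rc_Suc rc_tl rc_hd assms)
qed

lemma rc_bleast:
  assumes "rc A k n" "dec A (Suc k) (\<lambda>ys. P (hd ys) (tl ys))"
  shows "rc A k (\<lambda>xs. bleast (\<lambda>j. P j xs) (n xs))"
proof -
  have "dec A (Suc (Suc k)) (\<lambda>ys. P (hd ys) (tl (tl ys)))"
    using assms(2) unfolding dec_def by (rule rc_skip)
  then show ?thesis unfolding bleast_def
    by (intro rc_card dec_all dec_not rc_Suc rc_tl rc_hd assms)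
qed

lemma rc_gcd:
  assumes "rc A k a" "rc A k b" "\<And>xs. 0 < b xs"
  shows "rc A k (\<lambda>xs. gcd (a xs) (b xs))"
proof -
  have "rc A k (\<lambda>xs. bmax (\<lambda>d. a xs mod d = 0 \<and> b xs mod d = 0) (b xs))"
    by (intro rc_bmax dec_conj dec_eq rc_mod rc_tl rc_hd rc_const assms(1,2))
  moreover have "bmax (\<lambda>d. m mod d = 0 \<and> n mod d = 0) n = gcd m n" if "0 < n" for m n :: nat
  proof (rule bmax_eq)
    show "gcd m n \<le> n" using that by (intro gcd_le2_nat) simp
    fix i assume "m mod i = 0 \<and> n mod i = 0"
    then have "i dvd gcd m n" by (simp add: mod_eq_0_iff_dvd)
    then show "i \<le> gcd m n" using that by (intro dvd_imp_le) auto
  qed (simp add: mod_eq_0_iff_dvd)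
  ultimately show ?thesis using assms(3) by simp
qed

lemma rc_prod_encode:
  assumes "rc A k a" "rc A k b"
  shows "rc A k (\<lambda>xs. prod_encode (a xs, b xs))"
  unfolding prod_encode_def triangle_def prod.case
  by (intro rc_add rc_div rc_mult rc_Suc rc_const assms)

text \<open>On nonnegative integers \<open>int_encode\<close> is doubling, and dividing by the gcd
  reduces the fraction.\<close>

lemma rat_encode_frac:
  fixes a b :: nat
  assumes "b > 0"
  shows "rat_encode (of_nat a / of_nat b) = prod_encode (2 * (a div gcd a b), b div gcd a b)"
proof -
  have "(of_nat a / of_nat b :: rat) = Fract (int a) (int b)"
    by (simp add: Fract_of_int_quotient)
  then have "quotient_of (of_nat a / of_nat b) = Rat.normalize (int a, int b)"
    by (simp add: quotient_of_Fract)
  also have "\<dots> = (int (a div gcd a b), int (b div gcd a b))"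
    using assms by (simp add: Rat.normalize_def Let_def zdiv_int)
  finally show ?thesis
    by (simp add: rat_encode_def int_encode_def sum_encode_def)
qed

lemma computable_rat_fun_in_fracI:
  fixes a b :: "nat \<Rightarrow> nat"
  assumes "rc A 1 (\<lambda>xs. a (hd xs))" "rc A 1 (\<lambda>xs. b (hd xs))" "\<And>n. 0 < b n"
  shows "computable_rat_fun_in A (\<lambda>n. of_nat (a n) / of_nat (b n))"
proof -
  have "rc A 1 (\<lambda>xs. prod_encode (2 * (a (hd xs) div gcd (a (hd xs)) (b (hd xs))), b (hd xs) div gcd (a (hd xs)) (b (hd xs))))"
    by (intro rc_prod_encode rc_mult rc_div rc_gcd rc_const assms)
  then have "rc A 1 (\<lambda>xs. rat_encode (of_nat (a (hd xs)) / of_nat (b (hd xs))))"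
    by (simp only: rat_encode_frac[OF assms(3)])
  then obtain F where F: "recursive_in A 1 F"
    "\<And>xs. length xs = 1 \<Longrightarrow> F xs = rat_encode (of_nat (a (hd xs)) / of_nat (b (hd xs)))"
    unfolding rc_def by blast
  then have "\<forall>n. F [n] = rat_encode (of_nat (a n) / of_nat (b n))" by simp
  with F(1) show ?thesis unfolding computable_rat_fun_in_def computable_in_def by blast
qed

section \<open>The construction\<close>

text \<open>\<open>nr s r A\<close> is the number of \<open>n\<close> with \<open>r ^ n < s ^ A\<close>, that is, the length of the initial part
  of the orbit in base \<open>r\<close> that is essentially determined by \<open>A\<close> digits in base \<open>s\<close>. The bound
  \<open>n < s ^ A\<close> only makes the count bounded.\<close>

definition nr :: "nat \<Rightarrow> nat \<Rightarrow> nat \<Rightarrow> nat" where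
  "nr s r A = card {n. n < s ^ A \<and> r ^ n < s ^ A}"

definition tower :: "nat \<Rightarrow> nat" where
  "tower a = 2 ^ (2 ^ (2 ^ a))"

text \<open>Searching only up to \<open>k\<close> loses nothing because
  \<open>a \<le> tower a\<close>. As \<open>tower 0 = 4\<close>, the value \<open>0\<close> is a
  default for \<open>k < 4\<close>.\<close>

definition itlog :: "nat \<Rightarrow> nat" where
  "itlog k = bmax (\<lambda>a. tower a \<le> k) k"

text \<open>For \<open>x = W / s ^ (Suc k ^ 2)\<close>, the part of the orbit of \<open>x\<close> in base \<open>r\<close> that belongs to stage \<open>k\<close>
  visits each of the \<open>q\<close> cells \<open>[c / q, (c + 1) / q)\<close> at most \<open>1 / q + 1 / q ^ 2\<close> of the time.\<close>

definition cell_ok :: "nat \<Rightarrow> nat \<Rightarrow> nat \<Rightarrow> nat \<Rightarrow> nat \<Rightarrow> bool" where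
  "cell_ok s k r q W \<longleftrightarrow> (\<forall>c<q. q ^ 2 *
     card {n. n < nr s r (Suc k ^ 2) \<and> (nr s r (k ^ 2) \<le> n \<and>
       (c * s ^ (Suc k ^ 2) \<le> q * (r ^ n * W mod s ^ (Suc k ^ 2)) \<and>
        q * (r ^ n * W mod s ^ (Suc k ^ 2)) < Suc c * s ^ (Suc k ^ 2)))}
     \<le> Suc q * (nr s r (Suc k ^ 2) - nr s r (k ^ 2)))"

text \<open>Positions beyond \<open>v\<close> need no test: the digits of \<open>v\<close> vanish
  there, and \<open>0\<close> differs from \<open>s - 1\<close>. So bounded quantifiers
  suffice.\<close>

definition no_run :: "nat \<Rightarrow> nat \<Rightarrow> nat \<Rightarrow> bool" where
  "no_run s l v \<longleftrightarrow> (\<forall>i<Suc v. \<exists>t<l. v div s ^ (i + t) mod s \<noteq> s - 1)"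

text \<open>The blocks of level \<open>T\<close> have no digit \<open>S - 1\<close> in base \<open>S = U ^ 2\<close> with \<open>U = s ^ uexp T\<close>. The
  savings of order \<open>1 / U\<close> in the second moments have to beat a polynomial in \<open>T\<close>, for which
  \<open>U \<ge> 2 ^ 60 * T ^ 20\<close> suffices.\<close>

definition uexp :: "nat \<Rightarrow> nat" where
  "uexp T = 60 + 20 * T"

text \<open>Twice the number \<open>2 * uexp T\<close> of digits in base \<open>s\<close> that form
  one digit in base \<open>S\<close>: any stretch of this length contains a complete aligned digit
  in base \<open>S\<close>.\<close>

definition runlen :: "nat \<Rightarrow> nat" where
  "runlen T = 4 * uexp T"

text \<open>Whether \<open>r\<close> and \<open>s\<close> are independent need not be decided: dependent bases are
  recognized at all sufficiently late stages.\<close>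

definition seems_independent :: "nat \<Rightarrow> nat \<Rightarrow> nat \<Rightarrow> bool" where
  "seems_independent s k r \<longleftrightarrow> (\<forall>a<k. \<forall>b<k. r ^ Suc a \<noteq> s ^ Suc b)"

text \<open>Two precisions are needed. \<open>T\<close> tends to infinity at a rate dictated by
  \<open>g\<close> and serves every base. \<open>(itlog k + 2) ^ 2\<close> does not depend on
  \<open>g\<close>; the square leaves room for the constants when an error of order
  \<open>1 / q\<close> is compared with \<open>1 / (1 + itlog N)\<close>.\<close>

definition good :: "nat \<Rightarrow> nat \<Rightarrow> nat \<Rightarrow> nat \<Rightarrow> nat \<Rightarrow> bool" where
  "good s k w T v \<longleftrightarrow> no_run s (runlen T) v \<and>
     (\<forall>r<Suc T. 2 \<le> r \<longrightarrow> cell_ok s k r T (w * s ^ (2 * k + 1) + v) \<and>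
       (seems_independent s k r \<longrightarrow> cell_ok s k r ((itlog k + 2) ^ 2) (w * s ^ (2 * k + 1) + v)))"

text \<open>If \<open>c\<close> encodes a rational number \<open>q \<ge> 0\<close>, this says \<open>s ^ runlen T * q \<le> 1\<close>.\<close>

definition small_enough :: "nat \<Rightarrow> nat \<Rightarrow> nat \<Rightarrow> bool" where
  "small_enough s c T \<longleftrightarrow> (\<exists>a<Suc c. \<exists>b<Suc c. c = prod_encode (2 * a, b) \<and> s ^ runlen T * a \<le> b)"

text \<open>The existence of a good block is tested by search, so the construction never has to know
  from which stage on such blocks exist.\<close>

definition admissible :: "nat \<Rightarrow> nat \<Rightarrow> nat \<Rightarrow> nat \<Rightarrow> nat \<Rightarrow> bool" where
  "admissible s c k w T \<longleftrightarrow> 0 < T \<and> small_enough s c T \<and> (\<exists>v<s ^ (2 * k). good s k w T v)"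

definition level :: "nat \<Rightarrow> nat \<Rightarrow> nat \<Rightarrow> nat \<Rightarrow> nat" where
  "level s c k w = bmax (admissible s c k w) (itlog k)"

text \<open>Level \<open>0\<close> means that no level is admissible; then zeros are appended, which
  create no run.\<close>

definition extension :: "nat \<Rightarrow> nat \<Rightarrow> nat \<Rightarrow> nat \<Rightarrow> nat" where
  "extension s c k w =
     (if level s c k w = 0 then 0 else bleast (good s k w (level s c k w)) (s ^ (2 * k)))"

definition wseq :: "nat \<Rightarrow> (nat \<Rightarrow> nat) \<Rightarrow> nat \<Rightarrow> nat" where
  "wseq s G = rec_nat 0 (\<lambda>k w. w * s ^ (2 * k + 1) + extension s (G k) k w)"

section \<open>Computability of the construction\<close>

lemma rc_nr: "rc A k r \<Longrightarrow> rc A k a \<Longrightarrow> rc A k (\<lambda>xs. nr s (r xs) (a xs))"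
  unfolding nr_def by (intro rc_card dec_less rc_power rc_const rc_tl rc_hd)

lemma rc_itlog: "rc A k a \<Longrightarrow> rc A k (\<lambda>xs. itlog (a xs))"
  unfolding itlog_def tower_def by (intro rc_bmax dec_le rc_power rc_const rc_tl rc_hd)

lemma dec_cell_ok:
  assumes "rc A j k" "rc A j r" "rc A j q" "rc A j W"
  shows "dec A j (\<lambda>xs. cell_ok s (k xs) (r xs) (q xs) (W xs))"
  unfolding cell_ok_def
  by (intro dec_all dec_le rc_mult rc_card dec_conj dec_less rc_diff rc_nr rc_power rc_mod rc_Suc rc_const rc_tl rc_hd assms)

lemma rc_runlen: "rc A j T \<Longrightarrow> rc A j (\<lambda>xs. runlen (T xs))"
  unfolding runlen_def uexp_def by (intro rc_mult rc_add rc_const)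

lemma dec_no_run:
  assumes "rc A j l" "rc A j v"
  shows "dec A j (\<lambda>xs. no_run s (l xs) (v xs))"
  unfolding no_run_def
  by (intro dec_all dec_ex dec_not dec_eq rc_mod rc_div rc_power rc_add rc_Suc rc_const rc_tl rc_hd assms)

lemma dec_good:
  assumes "rc A j k" "rc A j w" "rc A j T" "rc A j v"
  shows "dec A j (\<lambda>xs. good s (k xs) (w xs) (T xs) (v xs))"
  unfolding good_def seems_independent_def
  by (intro dec_conj dec_all dec_imp dec_le dec_no_run dec_cell_ok dec_not dec_eq rc_runlen rc_itlog
      rc_add rc_mult rc_power rc_Suc rc_const rc_tl rc_hd assms)

lemma dec_admissible:
  assumes "rc A j c" "rc A j k" "rc A j w" "rc A j T"
  shows "dec A j (\<lambda>xs. admissible s (c xs) (k xs) (w xs) (T xs))"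
  unfolding admissible_def small_enough_def
  by (intro dec_conj dec_ex dec_less dec_le dec_eq dec_good rc_prod_encode rc_runlen
      rc_mult rc_power rc_Suc rc_const rc_tl rc_hd assms)

lemma rc_level:
  assumes "rc A j c" "rc A j k" "rc A j w"
  shows "rc A j (\<lambda>xs. level s (c xs) (k xs) (w xs))"
  unfolding level_def by (intro rc_bmax dec_admissible rc_itlog rc_tl rc_hd assms)

lemma rc_extension:
  assumes "rc A j c" "rc A j k" "rc A j w"
  shows "rc A j (\<lambda>xs. extension s (c xs) (k xs) (w xs))"
  unfolding extension_def
  by (intro rc_if dec_eq rc_bleast dec_good rc_level rc_mult rc_power rc_const rc_tl rc_hd assms)

lemma rc_wseq:
  assumes "G \<in> A" "rc A j n"
  shows "rc A j (\<lambda>xs. wseq s G (n xs))"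
  unfolding wseq_def
  by (intro rc_rec_nat rc_extension rc_oracle[OF assms(1)] rc_add rc_mult rc_power rc_const rc_tl rc_hd assms(2))

lemma real_computable_from_wseq:
  assumes "s \<ge> 2" and approx: "\<And>k. \<bar>\<xi> - real (wseq s (\<lambda>n. rat_encode (g n)) k) / real s ^ (k ^ 2)\<bar> \<le> 1 / real s ^ (k ^ 2)"
  shows "real_computable_from g \<xi>"
proof -
  let ?G = "\<lambda>n. rat_encode (g n)"
  let ?q = "\<lambda>k. of_nat (wseq s ?G k) / of_nat (s ^ (k ^ 2)) :: rat"
  have "computable_rat_fun_in {?G} ?q"
    by (rule computable_rat_fun_in_fracI)
      (use assms(1) in \<open>auto intro!: rc_wseq rc_power rc_const rc_hd simp flip: One_nat_def simp: rc_hd[of _ 0, simplified]\<close>)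
  moreover have "\<bar>\<xi> - real_of_rat (?q k)\<bar> \<le> 1 / 2 ^ k" for k
  proof -
    have "\<bar>\<xi> - real_of_rat (?q k)\<bar> \<le> 1 / real s ^ (k ^ 2)"
      using approx[of k] by (simp add: of_rat_divide of_rat_power)
    also have "\<dots> \<le> 1 / real s ^ k"
      using assms(1) by (intro divide_left_mono power_increasing) (auto simp: power2_eq_square)
    also have "\<dots> \<le> 1 / 2 ^ k"
      using assms(1) by (intro divide_left_mono power_mono) auto
    finally show ?thesis .
  qed
  ultimately show ?thesis
    unfolding real_computable_from_def real_computable_in_def by blast
qed

lemma computable_inverse_itlog: "computable_rat_fun (\<lambda>n. 1 / of_nat (1 + itlog n))"
proof -
  have "computable_rat_fun_in {} (\<lambda>n. of_nat 1 / of_nat (1 + itlog n))"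
    by (rule computable_rat_fun_in_fracI)
      (auto intro!: rc_itlog rc_const rc_Suc simp: rc_hd[of _ 0, simplified])
  then show ?thesis by (simp add: computable_rat_fun_def)
qed

section \<open>Growth of the iterated logarithm\<close>

lemma tower_strict_mono: "strict_mono tower"
  by (rule strict_monoI) (simp add: tower_def)

lemma itlog_ge: "tower a \<le> k \<Longrightarrow> a \<le> itlog k"
proof -
  assume h: "tower a \<le> k"
  have "a \<le> tower a" by (rule strict_mono_imp_increasing[OF tower_strict_mono])
  with h show ?thesis unfolding itlog_def by (intro bmax_ge) auto
qed

lemma tower_itlog: "4 \<le> k \<Longrightarrow> tower (itlog k) \<le> k"
proof (cases "itlog k = 0")
  case False
  then show ?thesis unfolding itlog_def by (rule bmax_sat)
qed (simp add: tower_def)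

lemma itlog_mono: "mono itlog"
proof (rule monoI)
  fix k l :: nat assume "k \<le> l"
  show "itlog k \<le> itlog l"
  proof (cases "itlog k = 0")
    case False
    then have "tower (itlog k) \<le> k" unfolding itlog_def by (rule bmax_sat)
    with \<open>k \<le> l\<close> show ?thesis by (intro itlog_ge) simp
  qed simp
qed

lemma filterlim_itlog: "filterlim itlog at_top sequentially"
  unfolding filterlim_at_top
proof
  fix a
  show "\<forall>\<^sub>F k in sequentially. a \<le> itlog k"
    using eventually_ge_at_top[of "tower a"] by eventually_elim (rule itlog_ge)
qed

section \<open>Runs of the digit \<open>s - 1\<close> under concatenation\<close>

lemma no_run_digit:
  assumes "s \<ge> 2" "l \<ge> 1" "no_run s l v"
  obtains t where "t < l" "v div s ^ (i + t) mod s \<noteq> s - 1"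
proof (cases "i \<le> v")
  case True
  then show ?thesis using assms(3) that unfolding no_run_def by (meson less_Suc_eq_le)
next
  case False
  have "v < s ^ v" using assms(1) by (simp add: power_gt_expt)
  also have "\<dots> \<le> s ^ i" using assms(1) False by (intro power_increasing) auto
  finally have "v div s ^ (i + 0) mod s \<noteq> s - 1" using assms(1) by simp
  then show ?thesis using assms(2) by (intro that[of 0]) auto
qed

lemma no_runI:
  "(\<And>i. \<exists>t<l. v div s ^ (i + t) mod s \<noteq> s - 1) \<Longrightarrow> no_run s l v"
  unfolding no_run_def by blast

lemma no_run_mono: "no_run s l v \<Longrightarrow> l \<le> l' \<Longrightarrow> no_run s l' v"
  unfolding no_run_def by (meson less_le_trans)

lemma no_run_0: "s \<ge> 2 \<Longrightarrow> l \<ge> 1 \<Longrightarrow> no_run s l 0"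
  by (rule no_runI) (auto intro!: exI[of _ 0])

lemma digit_append:
  fixes s v w L e :: nat
  assumes "s \<ge> 2" "v < s ^ L"
  shows "(w * s ^ L + v) div s ^ e mod s = (if e < L then v div s ^ e mod s else w div s ^ (e - L) mod s)"
proof (cases "e < L")
  case True
  have "s ^ L = s ^ e * s * s ^ (L - Suc e)"
    unfolding power_Suc2[symmetric] power_add[symmetric] using True by simp
  then have "w * s ^ L + v = (w * s ^ (L - Suc e) * s) * s ^ e + v" by simp
  then have "(w * s ^ L + v) div s ^ e = w * s ^ (L - Suc e) * s + v div s ^ e"
    using assms(1) by (simp only:) (rule div_mult_self3, simp)
  then show ?thesis using True by simp
next
  case False
  then have "s ^ e = s ^ L * s ^ (e - L)" by (simp flip: power_add)
  then have "(w * s ^ L + v) div s ^ e = ((w * s ^ L + v) div s ^ L) div s ^ (e - L)"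
    by (simp add: div_mult2_eq)
  also have "(w * s ^ L + v) div s ^ L = w" using assms by simp
  finally show ?thesis using False by simp
qed

text \<open>The first digit of \<open>v\<close>, viewed as a block of length \<open>Suc L\<close>, is \<open>0\<close>; so no run
  of digits \<open>s - 1\<close> crosses the boundary between \<open>w\<close> and \<open>v\<close>.\<close>

lemma no_run_append:
  assumes s: "s \<ge> 2" and l: "l \<ge> 1" and v: "v < s ^ L" and w: "no_run s l w" and vr: "no_run s l v"
  shows "no_run s l (w * s ^ Suc L + v)"
proof (rule no_runI)
  fix i
  have v': "v < s ^ Suc L" using v s by (simp add: less_le_trans)
  note dig = digit_append[OF s v', of w]
  consider "Suc L \<le> i" | "i \<le> L" "L < i + l" | "i + l \<le> L" by linarith
  then show "\<exists>t<l. (w * s ^ Suc L + v) div s ^ (i + t) mod s \<noteq> s - 1"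
  proof cases
    case 1
    obtain t where "t < l" "w div s ^ (i - Suc L + t) mod s \<noteq> s - 1"
      using no_run_digit[OF s l w, of "i - Suc L"] by blast
    then show ?thesis using 1 dig[of "i + t"] by (intro exI[of _ t]) (simp del: power_Suc)
  next
    case 2
    then have "(w * s ^ Suc L + v) div s ^ (i + (L - i)) mod s \<noteq> s - 1"
      using dig[of L] v s by (simp del: power_Suc)
    then show ?thesis using 2 by (intro exI[of _ "L - i"]) auto
  next
    case 3
    obtain t where "t < l" "v div s ^ (i + t) mod s \<noteq> s - 1"
      using no_run_digit[OF s l vr, of i] by blast
    then show ?thesis using 3 dig[of "i + t"] by (intro exI[of _ t]) (simp del: power_Suc)
  qed
qed

section \<open>Second moments over one block\<close>

lemma less_nr_iff:
  assumes "r \<ge> 2"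
  shows "n < nr s r A \<longleftrightarrow> r ^ n < s ^ A"
proof -
  have lt: "n < r ^ n" for n using assms by (simp add: power_gt_expt)
  have eq: "{n. n < s ^ A \<and> r ^ n < s ^ A} = {n. r ^ n < s ^ A}"
    using lt by (auto intro: less_trans)
  have fin: "finite {n. r ^ n < s ^ A}" unfolding eq[symmetric] by simp
  have mono: "r ^ m \<le> r ^ n" if "m \<le> n" for m n using assms that by (intro power_increasing) auto
  show ?thesis
  proof
    assume "r ^ n < s ^ A"
    then have "{..n} \<subseteq> {n. r ^ n < s ^ A}" using mono by (auto intro: le_less_trans)
    then have "card {..n} \<le> nr s r A" unfolding nr_def eq by (rule card_mono[OF fin])
    then show "n < nr s r A" by simp
  next
    assume n: "n < nr s r A"
    show "r ^ n < s ^ A"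
    proof (rule ccontr)
      assume "\<not> r ^ n < s ^ A"
      then have "{n. r ^ n < s ^ A} \<subseteq> {..<n}" using mono by (auto simp: not_less) (meson le_less_trans linorder_not_less order_trans)
      then have "nr s r A \<le> card {..<n}" unfolding nr_def eq by (rule card_mono[OF finite_lessThan])
      with n show False by simp
    qed
  qed
qed

text \<open>Exceptional exponents always turn out to be those for which \<open>r ^ n\<close> lies in
  a range of bounded ratio, and as \<open>r \<ge> 2\<close> a ratio below \<open>2 ^ p\<close>
  leaves room for at most \<open>p\<close> of them.\<close>

lemma card_power_ratio_le:
  fixes r p :: nat
  assumes r: "r \<ge> 2" and fin: "finite G"
    and ratio: "\<And>n n'. n \<in> G \<Longrightarrow> n' \<in> G \<Longrightarrow> r ^ n < r ^ n' * 2 ^ p"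
  shows "card G \<le> p"
proof (cases "G = {}")
  case False
  define n0 where "n0 = Min G"
  have n0: "n0 \<in> G" using False fin by (simp add: n0_def)
  have "G \<subseteq> {n0..<n0 + p}"
  proof
    fix n assume n: "n \<in> G"
    have "n < n0 + p"
    proof (rule ccontr)
      assume "\<not> n < n0 + p"
      then have "r ^ (n0 + p) \<le> r ^ n" using r by (intro power_increasing) auto
      moreover have "r ^ n0 * 2 ^ p \<le> r ^ n0 * r ^ p" using r by (intro mult_left_mono power_mono) auto
      ultimately show False using ratio[OF n n0] by (simp add: power_add)
    qed
    moreover have "n0 \<le> n" using n fin by (simp add: n0_def)
    ultimately show "n \<in> {n0..<n0 + p}" by simp
  qed
  then show ?thesis using card_mono[of "{n0..<n0 + p}" G] by simp
qed simp

lemma norm_sum_square_split: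
  fixes e :: "'a \<Rightarrow> complex"
  assumes "finite W" "C \<subseteq> W" "real (card (W - C)) \<le> X" "\<And>n. norm (e n) \<le> 1"
  shows "(norm (\<Sum>n\<in>W. e n))\<^sup>2 \<le> 2 * (norm (\<Sum>n\<in>C. e n))\<^sup>2 + 2 * X\<^sup>2"
proof -
  have "(\<Sum>n\<in>W. e n) = (\<Sum>n\<in>W - C. e n) + (\<Sum>n\<in>C. e n)"
    by (rule sum.subset_diff) (use assms in auto)
  then have "norm (\<Sum>n\<in>W. e n) \<le> norm (\<Sum>n\<in>W - C. e n) + norm (\<Sum>n\<in>C. e n)"
    using norm_triangle_ineq by metis
  also have "norm (\<Sum>n\<in>W - C. e n) \<le> X"
  proof -
    have "norm (\<Sum>n\<in>W - C. e n) \<le> (\<Sum>n\<in>W - C. 1)"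
      by (rule order.trans[OF norm_sum sum_mono]) (use assms in auto)
    then show ?thesis using assms(3) by simp
  qed
  finally have le: "norm (\<Sum>n\<in>W. e n) \<le> X + norm (\<Sum>n\<in>C. e n)" by simp
  define y where "y = norm (\<Sum>n\<in>C. e n)"
  have "(norm (\<Sum>n\<in>W. e n))\<^sup>2 \<le> (X + y)\<^sup>2"
    using le by (intro power_mono) (auto simp: y_def)
  also have "\<dots> \<le> 2 * y\<^sup>2 + 2 * X\<^sup>2" using sum_squares_bound[of X y] by (simp add: power2_sum)
  finally show ?thesis by (simp add: y_def)
qed

locale word_block =
  fixes s b N A L w :: nat
  assumes s: "s \<ge> 2" and b: "b \<ge> 2" and L: "L \<le> b * (N + 1)"
begin

definition S :: nat where "S = s ^ b"
definition B :: nat where "B = s ^ (A + L)"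
definition pt :: "(nat \<Rightarrow> nat) \<Rightarrow> real" where
  "pt d = real (w * s ^ L) / real B + real (word_val S N d) / real B"
definition Wn :: "nat \<Rightarrow> nat set" where "Wn r = {nr s r A..<nr s r (A + L)}"
definition wsum :: "nat \<Rightarrow> nat \<Rightarrow> (nat \<Rightarrow> nat) \<Rightarrow> complex" where
  "wsum r l d = (\<Sum>n\<in>Wn r. ee (real l * (real r ^ n * pt d)))"
definition moment :: "nat \<Rightarrow> nat \<Rightarrow> real" where
  "moment r l = (\<Sum>d\<in>words S N. (norm (wsum r l d))\<^sup>2)"
text \<open>Exponents whose frequency differences can be scaled into a window with \<open>K\<close>
  factors still to come: the lower bound on \<open>r ^ n\<close> keeps the differences large enough
  for that, the upper bound keeps \<open>l * r ^ n / B\<close> at most \<open>1 / U\<close>.\<close>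

definition core :: "nat \<Rightarrow> nat \<Rightarrow> nat \<Rightarrow> nat \<Rightarrow> nat set" where
  "core r l U K = {n\<in>Wn r. s ^ (A + b * (K + 1)) \<le> r ^ n \<and> l * r ^ n * U \<le> B}"

lemma S4: "S \<ge> 4"
proof -
  have "(2::nat) ^ 2 \<le> s ^ 2" using s by (rule power_mono) simp
  also have "\<dots> \<le> s ^ b" using s b by (intro power_increasing) auto
  finally show ?thesis by (simp add: S_def)
qed

lemma B0: "B > 0" using s by (simp add: B_def)

lemma mem_Wn: "r \<ge> 2 \<Longrightarrow> n \<in> Wn r \<longleftrightarrow> s ^ A \<le> r ^ n \<and> r ^ n < B"
  unfolding Wn_def B_def using less_nr_iff[of r n s A] less_nr_iff[of r n s "A + L"]
  by (auto simp flip: not_less)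

lemma finite_Wn [simp]: "finite (Wn r)" by (simp add: Wn_def)

text \<open>Each of the two conditions excludes powers of \<open>r\<close> from a range whose ratio
  depends on \<open>s\<close>, \<open>b\<close>, \<open>K\<close> and \<open>l\<close> but not on
  the stage, so the loss is negligible in long windows.\<close>

lemma card_noncore:
  assumes r: "r \<ge> 2" and U: "U \<le> S"
  shows "card (Wn r - core r l U K) \<le> s * b * (K + 2) + l"
proof -
  have s2: "s \<le> 2 ^ s" by (rule less_imp_le) (rule less_exp)
  have pow: "s ^ j \<le> 2 ^ (s * j)" for j
    using power_mono[OF s2, of j] by (simp add: power_mult)
  let ?G1 = "{n\<in>Wn r. r ^ n < s ^ (A + b * (K + 1))}"
  let ?G2 = "{n\<in>Wn r. B < l * r ^ n * U}"
  have "card ?G1 \<le> s * (b * (K + 1))"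
  proof (rule card_power_ratio_le[OF r])
    fix n n' assume h: "n \<in> ?G1" "n' \<in> ?G1"
    then have "r ^ n < s ^ A * s ^ (b * (K + 1))" by (simp add: power_add)
    also have "\<dots> \<le> r ^ n' * 2 ^ (s * (b * (K + 1)))"
      using h r by (intro mult_mono pow) (auto simp: mem_Wn)
    finally show "r ^ n < r ^ n' * 2 ^ (s * (b * (K + 1)))" .
  qed simp
  moreover have "card ?G2 \<le> l + s * b"
  proof (rule card_power_ratio_le[OF r])
    fix n n' assume h: "n \<in> ?G2" "n' \<in> ?G2"
    then have "r ^ n < r ^ n' * (l * U)" using r by (auto simp: mem_Wn mult_ac)
    also have "\<dots> \<le> r ^ n' * 2 ^ (l + s * b)"
      unfolding power_add
    proof (intro mult_left_mono mult_mono)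
      show "l \<le> 2 ^ l" by (rule less_imp_le) (rule less_exp)
      show "U \<le> 2 ^ (s * b)" using U pow[of b] by (simp add: S_def)
    qed auto
    finally show "r ^ n < r ^ n' * 2 ^ (l + s * b)" .
  qed simp
  moreover have "card (Wn r - core r l U K) \<le> card (?G1 \<union> ?G2)"
    by (rule card_mono) (auto simp: core_def not_le)
  moreover have "card (?G1 \<union> ?G2) \<le> card ?G1 + card ?G2" by (rule card_Un_le)
  ultimately show ?thesis by (simp add: algebra_simps)
qed

text \<open>As \<open>r \<ge> 2\<close>, the difference \<open>r ^ n - r ^ m\<close> lies between
  \<open>r ^ m\<close> and \<open>r ^ n\<close>, so the two conditions in \<open>core\<close> bound
  it on both sides.\<close>

lemma core_scale:
  assumes r: "r \<ge> 2" and l: "l \<ge> 1" and U: "U \<ge> 1" and K: "K \<le> N"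
    and nm: "n \<in> core r l U K" "m \<in> core r l U K" "m < n"
  defines "z \<equiv> (real l * real r ^ n - real l * real r ^ m) / real B"
  shows "z < 1 / real U" "1 \<le> z * real S ^ (N - K)"
proof -
  have B: "real B > 0" using B0 by simp
  have "real l * real r ^ n * real U \<le> real B"
    using nm(1) unfolding core_def by (simp flip: of_nat_mult of_nat_power)
  then have "real l * real r ^ n / real B \<le> 1 / real U" using U B by (simp add: field_simps)
  moreover have "z < real l * real r ^ n / real B"
    unfolding z_def using l r B by (intro divide_strict_right_mono) auto
  ultimately show "z < 1 / real U" by linarith
  have "2 * r ^ m \<le> r ^ Suc m" using r by simp
  also have "\<dots> \<le> r ^ n" using nm r by (intro power_increasing) auto
  finally have "real (2 * r ^ m) \<le> real (r ^ n)" by (simp only: of_nat_le_iff)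
  then have d: "2 * real r ^ m \<le> real r ^ n" by simp
  have "real s ^ (A + b * (K + 1)) \<le> real r ^ m"
    using nm(2) unfolding core_def by (simp flip: of_nat_power)
  also have "\<dots> \<le> real l * real r ^ m" using l mult_right_mono[of 1 "real l" "real r ^ m"] by simp
  also have "\<dots> \<le> real l * (real r ^ n - real r ^ m)" using d l by (intro mult_left_mono) auto
  finally have z1: "real s ^ (A + b * (K + 1)) / real B \<le> z"
    unfolding z_def using B by (intro divide_right_mono) (auto simp: algebra_simps)
  have eN: "A + b * (K + 1) + b * (N - K) = A + b * (N + 1)"
    using K by (simp add: algebra_simps flip: distrib_left)
  have "real B \<le> real s ^ (A + b * (N + 1))"
    unfolding B_def using s L by (simp flip: of_nat_power) 
  also have "\<dots> = real s ^ (A + b * (K + 1)) * real S ^ (N - K)"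
    unfolding S_def of_nat_power power_mult[symmetric] power_add[symmetric] eN ..
  finally have "1 \<le> real s ^ (A + b * (K + 1)) / real B * real S ^ (N - K)"
    using B by (simp add: field_simps)
  also have "\<dots> \<le> z * real S ^ (N - K)" using z1 by (intro mult_right_mono) auto
  finally show "1 \<le> z * real S ^ (N - K)" .
qed

lemma window_moment_le:
  assumes r: "r \<ge> 2" and U: "U \<le> S"
    and P: "(\<Sum>n\<in>core r l U K. \<Sum>m\<in>core r l U K. psi S N ((real l * real r ^ n - real l * real r ^ m) / real B)) \<le> P"
  shows "moment r l \<le> real (S - 1) ^ N * (2 * P + 2 * (real (s * b * (K + 2) + l))\<^sup>2)"
proof -
  let ?X = "real (s * b * (K + 2) + l)"
  let ?C = "core r l U K"
  have "moment r l
     \<le> (\<Sum>d\<in>words S N. 2 * (norm (\<Sum>n\<in>?C. ee (real l * (real r ^ n * pt d))))\<^sup>2 + 2 * ?X\<^sup>2)"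
    unfolding moment_def wsum_def by (intro sum_mono norm_sum_square_split)
      (use card_noncore[OF r U, of l K] in \<open>auto simp: core_def simp flip: of_nat_add of_nat_mult\<close>)
  also have "\<dots> = 2 * (\<Sum>d\<in>words S N. (norm (\<Sum>n\<in>?C. ee (real l * (real r ^ n * pt d))))\<^sup>2) + real (S - 1) ^ N * (2 * ?X\<^sup>2)"
    by (simp add: sum.distrib sum_distrib_left)
  also have "(\<Sum>d\<in>words S N. (norm (\<Sum>n\<in>?C. ee (real l * (real r ^ n * pt d))))\<^sup>2) \<le>
      real (S - 1) ^ N * (\<Sum>n\<in>?C. \<Sum>m\<in>?C. psi S N ((real l * real r ^ n - real l * real r ^ m) / real B))"
    using second_moment_le[where S = S and N = N and C = ?C and B = "real B" and ?x0.0 = "real (w * s ^ L) / real B"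
        and f = "\<lambda>n. real l * real r ^ n"] S4
    by (simp add: pt_def mult.assoc)
  also have "\<dots> \<le> real (S - 1) ^ N * P" by (intro mult_left_mono P) auto
  finally show ?thesis by (simp add: algebra_simps)
qed

text \<open>Every off-diagonal pair is scaled to a point of \<open>[1 / U ^ 3, 1 / U)\<close>, where
  two factors give \<open>5 / U\<close>. No relation between \<open>r\<close> and \<open>s\<close>
  enters, so the bases dependent on \<open>s\<close> are covered.\<close>

lemma moment_all_bases:
  assumes r: "r \<ge> 2" and l: "l \<ge> 1" and U: "U \<ge> 2" "S = U\<^sup>2" and N: "N \<ge> 2"
  defines "M \<equiv> real (card (Wn r))"
  shows "moment r l \<le> real (S - 1) ^ N * (2 * (M + 5 * M\<^sup>2 / real U) + 2 * (real (s * b * 4 + l))\<^sup>2)"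
proof -
  let ?C = "core r l U 2"
  let ?z = "\<lambda>n m. (real l * real r ^ n - real l * real r ^ m) / real B"
  have US: "U \<le> S" using U self_le_power[of U 2] by simp
  have lt: "psi S N (?z n m) \<le> 5 / real U" if "n \<in> ?C" "m \<in> ?C" "m < n" for n m
  proof -
    have z: "?z n m < 1 / real U" "1 \<le> ?z n m * real S ^ (N - 2)"
      using core_scale[OF r l _ N that] U by auto
    moreover have "1 / real U \<le> 1" using U by simp
    ultimately obtain i where i: "i < N - 2" "1 / real U / real S \<le> real S ^ i * ?z n m" "real S ^ i * ?z n m < 1 / real U"
      using scale_into_window[of "?z n m" "1 / real U" S "N - 2"] S4 by auto
    have "psi S N (?z n m) \<le> psi S 2 (real S ^ i * ?z n m)"
      by (rule psi_le_middle) (use i S4 in auto)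
    also have "\<dots> \<le> 5 / real U"
      by (rule psi_square) (use U i in \<open>auto simp: power2_eq_square power3_eq_cube mult_ac\<close>)
    finally show ?thesis .
  qed
  have pair: "psi S N (?z n m) \<le> (if m = n then 1 else 0) + 5 / real U" if "n \<in> ?C" "m \<in> ?C" for n m
  proof -
    consider "m = n" | "m < n" | "n < m" by linarith
    then show ?thesis
    proof cases
      case 1
      then show ?thesis using psi_le_1[of S N 0] by (simp add: add_increasing2)
    next
      case 2
      then show ?thesis using lt[OF that] by simp
    next
      case 3
      have "?z n m = - ?z m n" by (simp add: minus_divide_left)
      then have "psi S N (?z n m) = psi S N (?z m n)" by (simp only: psi_minus)
      then show ?thesis using 3 lt[OF that(2,1)] by simp
    qed
  qed
  have fC: "finite ?C" "card ?C \<le> card (Wn r)" by (auto simp: core_def intro: card_mono)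
  have "(\<Sum>n\<in>?C. \<Sum>m\<in>?C. psi S N (?z n m)) \<le> (\<Sum>n\<in>?C. \<Sum>m\<in>?C. (if m = n then 1 else 0) + 5 / real U)"
    by (intro sum_mono pair)
  also have "\<dots> = real (card ?C) + (real (card ?C))\<^sup>2 * (5 / real U)"
    using fC(1) by (simp add: sum.distrib power2_eq_square sum.delta distrib_left)
  also have "\<dots> \<le> M + M\<^sup>2 * (5 / real U)"
    unfolding M_def using fC(2) by (intro add_mono mult_right_mono power_mono) auto
  finally have P: "(\<Sum>n\<in>?C. \<Sum>m\<in>?C. psi S N (?z n m)) \<le> M + 5 * M\<^sup>2 / real U" by (simp add: mult_ac)
  show ?thesis using window_moment_le[OF r US P] by simp
qed

text \<open>For a fixed difference of exponents, and in a window long enough for the rotation, the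
  mean square of a product of \<open>2 * \<kappa>\<close> factors is \<open>\<tau> ^ 2\<close> up to
  a multiple of \<open>S\<close>, where \<open>\<tau> = 1 / (S - 1) ^ \<kappa>\<close>. The
  pointwise inequality \<open>p \<le> \<tau> + p ^ 2 / \<tau>\<close> turns this into a mean of
  order \<open>\<tau>\<close>.\<close>

lemma moment_independent:
  assumes r: "r \<ge> 2" and l: "l \<ge> 1" and \<kappa>: "\<kappa> \<ge> 1" and N: "2 * \<kappa> \<le> N"
    and ind: "\<And>n p. n \<ge> 1 \<Longrightarrow> p \<ge> 1 \<Longrightarrow> r ^ n \<noteq> S ^ p"
  defines "M \<equiv> real (card (Wn r))" and "\<Lambda> \<equiv> S ^ (4 * \<kappa>)"
  shows "moment r l \<le> real (S - 1) ^ N * (2 * (M + 2 * M * ((41 * real S * M + 40 * real S * ln S * real r ^ \<Lambda> * real \<Lambda>) / real (S - 1) ^ \<kappa>))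
      + 2 * (real (s * b * (2 * \<kappa> + 2) + l))\<^sup>2)"
proof -
  let ?K = "2 * \<kappa>"
  let ?C = "core r l 1 ?K"
  let ?z = "\<lambda>n m. (real l * real r ^ n - real l * real r ^ m) / real B"
  define \<tau> where "\<tau> = 1 / real (S - 1) ^ \<kappa>"
  have \<tau>: "\<tau> > 0" using S4 by (simp add: \<tau>_def)
  have US: "1 \<le> S" using S4 by simp
  define G where "G = (41 * real S * M + 40 * real S * ln S * real r ^ \<Lambda> * real \<Lambda>) * \<tau>"
  have inner: "(\<Sum>m\<in>{m\<in>?C. m + d \<in> ?C}. psi S N (?z (m + d) m)) \<le> G" if d: "d \<ge> 1" for d
  proof -
    let ?Cd = "{m\<in>?C. m + d \<in> ?C}"
    have fin: "finite ?Cd" by (simp add: core_def)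
    have sub: "?Cd \<subseteq> {nr s r A..<nr s r A + card (Wn r)}" by (auto simp: core_def Wn_def)
    \<comment> \<open>The scaling power of \<open>S\<close> varies with \<open>m\<close>, but it
      shifts the logarithm in base \<open>S\<close> only by an integer, so the rotation is not
      affected.\<close>
    define y where "y m = (SOME y. \<exists>i. i < N - ?K \<and> y = real S ^ i * ?z (m + d) m \<and> 1 / real S \<le> y \<and> y < 1)" for m
    have y: "\<exists>i. i < N - ?K \<and> y m = real S ^ i * ?z (m + d) m \<and> 1 / real S \<le> y m \<and> y m < 1" if m: "m \<in> ?Cd" for m
      unfolding y_def
    proof (rule someI_ex)
      have z: "?z (m + d) m < 1" "1 \<le> ?z (m + d) m * real S ^ (N - ?K)"
        using core_scale[OF r l order.refl N, of "m + d" m] m d by auto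
      then obtain i where "i < N - ?K" "1 / real S \<le> real S ^ i * ?z (m + d) m" "real S ^ i * ?z (m + d) m < 1"
        using scale_into_window[of "?z (m + d) m" 1 S "N - ?K"] S4 by auto
      then show "\<exists>y i. i < N - ?K \<and> y = real S ^ i * ?z (m + d) m \<and> 1 / real S \<le> y \<and> y < 1" by blast
    qed
    have rot: "(\<Sum>m\<in>?Cd. (psi S ?K (y m))\<^sup>2) \<le>
      (8 * real (card (Wn r)) + 8 * ln S * real r ^ (S ^ (2 * ?K)) * real (S ^ (2 * ?K))) * (5 * real S) / real (S - 1) ^ ?K"
    proof (rule sum_psi_sq_rotation[where h = "real l * (real r ^ d - 1) / real B"])
      show "0 < real l * (real r ^ d - 1) / real B"
        using l r d B0 one_less_power[of "real r" d] by simp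
      show "1 / real S \<le> y m \<and> y m < 1" if "m \<in> ?Cd" for m using y[OF that] by blast
      show "\<exists>i. y m = real S ^ i * (real l * (real r ^ d - 1) / real B * real r ^ m)" if mC: "m \<in> ?Cd" for m
      proof -
        obtain i where "y m = real S ^ i * ?z (m + d) m" using y[OF mC] by blast
        moreover have "?z (m + d) m = real l * (real r ^ d - 1) / real B * real r ^ m"
          by (simp add: power_add algebra_simps)
        ultimately show ?thesis by auto
      qed
    qed (use r S4 \<kappa> ind sub in auto)
    have "(\<Sum>m\<in>?Cd. psi S N (?z (m + d) m)) \<le> (\<Sum>m\<in>?Cd. \<tau> + (psi S ?K (y m))\<^sup>2 / \<tau>)"
    proof (rule sum_mono)
      fix m assume m: "m \<in> ?Cd"
      obtain i where i: "i < N - ?K" "y m = real S ^ i * ?z (m + d) m" using y[OF m] by blast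
      have "psi S N (?z (m + d) m) \<le> psi S ?K (y m)"
        unfolding i(2) by (rule psi_le_middle) (use i S4 in auto)
      also have "\<dots> \<le> \<tau> + (psi S ?K (y m))\<^sup>2 / \<tau>"
      proof -
        define p where "p = psi S ?K (y m)"
        have "0 \<le> p" by (simp add: p_def)
        have "2 * p * \<tau> \<le> p\<^sup>2 + \<tau>\<^sup>2" by (rule sum_squares_bound)
        then have "p * \<tau> \<le> \<tau> * \<tau> + p\<^sup>2" using \<tau> mult_nonneg_nonneg[OF \<open>0 \<le> p\<close> less_imp_le[OF \<tau>]] by (simp add: power2_eq_square)
        then have "p \<le> \<tau> + p\<^sup>2 / \<tau>" using \<tau> by (simp add: field_simps)
        then show ?thesis by (simp add: p_def)
      qed
      finally show "psi S N (?z (m + d) m) \<le> \<tau> + (psi S ?K (y m))\<^sup>2 / \<tau>" .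
    qed
    also have "\<dots> = real (card ?Cd) * \<tau> + (\<Sum>m\<in>?Cd. (psi S ?K (y m))\<^sup>2) / \<tau>"
      by (simp add: sum.distrib sum_divide_distrib)
    also have "\<dots> \<le> M * \<tau> + ((8 * M + 8 * ln S * real r ^ \<Lambda> * real \<Lambda>) * (5 * real S) * \<tau>\<^sup>2) / \<tau>"
    proof (intro add_mono mult_right_mono divide_right_mono)
      show "real (card ?Cd) \<le> M" unfolding M_def using card_mono[OF _ sub] by simp
      show "(\<Sum>m\<in>?Cd. (psi S ?K (y m))\<^sup>2) \<le> (8 * M + 8 * ln S * real r ^ \<Lambda> * real \<Lambda>) * (5 * real S) * \<tau>\<^sup>2"
        using rot by (simp add: M_def \<Lambda>_def \<tau>_def power_divide mult.commute flip: power_mult)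
    qed (use \<tau> in auto)
    also have "\<dots> = (M + (8 * M + 8 * ln S * real r ^ \<Lambda> * real \<Lambda>) * (5 * real S)) * \<tau>"
      using \<tau> by (simp add: power2_eq_square field_simps)
    also have "\<dots> \<le> G"
      unfolding G_def
    proof (rule mult_right_mono)
      have "M * 1 \<le> M * real S" using S4 by (intro mult_left_mono) (auto simp: M_def)
      then show "M + (8 * M + 8 * ln S * real r ^ \<Lambda> * real \<Lambda>) * (5 * real S) \<le> 41 * real S * M + 40 * real S * ln S * real r ^ \<Lambda> * real \<Lambda>"
        by (simp add: algebra_simps)
    qed (use \<tau> in simp)
    finally show ?thesis .
  qed
  have lnS: "0 \<le> ln (real S)" using S4 by simp
  have G0: "0 \<le> G" unfolding G_def M_def using \<tau> lnS by simp
  have "(\<Sum>n\<in>?C. \<Sum>m\<in>?C. psi S N (?z n m)) \<le> real (card (Wn r)) + 2 * (\<Sum>d\<in>{1..<card (Wn r)}. \<Sum>m\<in>{m\<in>?C. m + d \<in> ?C}. psi S N (?z (m + d) m))"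
  proof (rule sum_pairs_le)
    show "?C \<subseteq> {nr s r A..<nr s r A + card (Wn r)}" by (auto simp: core_def Wn_def)
    show "psi S N (?z n m) = psi S N (?z m n)" for n m
    proof -
      have "?z n m = - ?z m n" by (simp add: minus_divide_left)
      then show ?thesis by (simp only: psi_minus)
    qed
    show "psi S N (?z n n) \<le> 1" for n by (rule psi_le_1)
  qed
  also have "(\<Sum>d\<in>{1..<card (Wn r)}. \<Sum>m\<in>{m\<in>?C. m + d \<in> ?C}. psi S N (?z (m + d) m)) \<le> (\<Sum>d\<in>{1..<card (Wn r)}. G)"
    by (rule sum_mono) (use inner in auto)
  also have "\<dots> = real (card (Wn r) - 1) * G" by simp
  also have "\<dots> \<le> M * G" unfolding M_def by (intro mult_right_mono G0) auto
  finally have P: "(\<Sum>n\<in>?C. \<Sum>m\<in>?C. psi S N (?z n m)) \<le> M + 2 * M * G" by (simp add: M_def mult.assoc)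
  show ?thesis using window_moment_le[OF r US P] by (simp add: G_def \<tau>_def)
qed

end

section \<open>Existence of good blocks\<close>

text \<open>The first moment method: as the averages add up to at most \<open>1\<close>, some
  element keeps the whole sum, hence each nonnegative term, at most \<open>1\<close>. This makes all
  tests succeed for the same word.\<close>

lemma averaging:
  fixes X :: "'i \<Rightarrow> 'd \<Rightarrow> real"
  assumes fin: "finite \<Omega>" "\<Omega> \<noteq> {}" "finite I" and nn: "\<And>i d. 0 \<le> X i d"
    and avg: "\<And>i. i \<in> I \<Longrightarrow> (\<Sum>d\<in>\<Omega>. X i d) \<le> real (card \<Omega>) * \<delta> i"
    and tot: "(\<Sum>i\<in>I. \<delta> i) \<le> 1"
  shows "\<exists>d\<in>\<Omega>. \<forall>i\<in>I. X i d \<le> 1"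
proof -
  have "\<exists>d\<in>\<Omega>. (\<Sum>i\<in>I. X i d) \<le> 1"
  proof (rule ccontr)
    assume "\<not> (\<exists>d\<in>\<Omega>. (\<Sum>i\<in>I. X i d) \<le> 1)"
    then have "(\<Sum>d\<in>\<Omega>. 1) < (\<Sum>d\<in>\<Omega>. \<Sum>i\<in>I. X i d)"
      using fin by (intro sum_strict_mono) auto
    also have "\<dots> = (\<Sum>i\<in>I. \<Sum>d\<in>\<Omega>. X i d)" by (rule sum.swap)
    also have "\<dots> \<le> (\<Sum>i\<in>I. real (card \<Omega>) * \<delta> i)" by (rule sum_mono[OF avg])
    also have "\<dots> = real (card \<Omega>) * (\<Sum>i\<in>I. \<delta> i)" by (simp add: sum_distrib_left)
    also have "\<dots> \<le> real (card \<Omega>) * 1" by (intro mult_left_mono tot) auto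
    finally show False by simp
  qed
  then obtain d where d: "d \<in> \<Omega>" "(\<Sum>i\<in>I. X i d) \<le> 1" by blast
  have "X i d \<le> 1" if "i \<in> I" for i
  proof -
    have "X i d \<le> (\<Sum>i\<in>I. X i d)" by (rule member_le_sum[OF that]) (use nn fin in auto)
    then show ?thesis using d(2) by simp
  qed
  then show ?thesis using d(1) by blast
qed

lemma mod_power_all_digits_max:
  fixes x s b :: nat
  assumes "s \<ge> 1" "\<And>t. t < b \<Longrightarrow> x div s ^ t mod s = s - 1"
  shows "x mod s ^ b = s ^ b - 1"
  using assms(2)
proof (induction b)
  case (Suc b)
  have "x mod s ^ Suc b = s ^ b * (x div s ^ b mod s) + x mod s ^ b"
    using mod_mult2_eq[of x "s ^ b" s] by (simp only: power_Suc2)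
  also have "\<dots> = s ^ b * (s - 1) + (s ^ b - 1)"
    using Suc.IH Suc.prems by simp
  also have "\<dots> = s ^ Suc b - 1"
    using assms(1) one_le_power[of s b] by (simp add: algebra_simps diff_mult_distrib2)
  finally show ?case .
qed simp

lemma frac_of_nat_divide: "frac (real a / real b) = real (a mod b) / real b"
proof (cases "b = 0")
  case False
  have "real a = real (a div b) * real b + real (a mod b)"
    by (metis div_mult_mod_eq of_nat_add of_nat_mult)
  then have "real a / real b = real (a div b) + real (a mod b) / real b"
    using False by (simp add: field_simps)
  moreover have "frac (real a / real b) = real a / real b - real (a div b)"
    by (simp add: frac_def floor_divide_of_nat_eq)
  ultimately show ?thesis by simp
qed simp

lemma le_cell_iff:
  assumes "B > (0::nat)"
  shows "c * B \<le> q * x \<longleftrightarrow> real c \<le> real q * (real x / real B)"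
proof -
  have "c * B \<le> q * x \<longleftrightarrow> real (c * B) \<le> real (q * x)" by (simp only: of_nat_le_iff)
  also have "\<dots> \<longleftrightarrow> real c \<le> real q * (real x / real B)" using assms by (simp add: pos_le_divide_eq)
  finally show ?thesis .
qed

lemma cell_less_iff:
  assumes "B > (0::nat)"
  shows "q * x < Suc c * B \<longleftrightarrow> real q * (real x / real B) < real c + 1"
proof -
  have "q * x < Suc c * B \<longleftrightarrow> real (q * x) < real (Suc c * B)" by (simp only: of_nat_less_iff)
  also have "\<dots> \<longleftrightarrow> real q * (real x / real B) < real c + 1"
    using assms by (simp add: pos_divide_less_eq distrib_right add.commute)
  finally show ?thesis .
qed

lemma nr_mono: "s \<ge> 2 \<Longrightarrow> r \<ge> 2 \<Longrightarrow> a \<le> a' \<Longrightarrow> nr s r a \<le> nr s r a'"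
proof -
  assume h: "s \<ge> 2" "r \<ge> 2" "a \<le> a'"
  then have "s ^ a \<le> s ^ a'" by (intro power_increasing) auto
  then have "n < nr s r a \<Longrightarrow> n < nr s r a'" for n using h by (auto simp: less_nr_iff intro: less_le_trans)
  then show ?thesis by (meson leI less_irrefl)
qed

context word_block
begin

lemma no_run_word_val:
  assumes d: "d \<in> words S N"
  shows "no_run s (2 * b) (word_val S N d)"
proof (rule no_runI)
  fix i
  let ?v = "word_val S N d"
  \<comment> \<open>The ceiling of \<open>i / b\<close>: block \<open>j\<close> is the first aligned
    digit in base \<open>S\<close> that starts at or after position \<open>i\<close>, and it ends by
    \<open>i + 2 * b\<close>.\<close>
  define j where "j = (i + b - 1) div b"
  have "b * j \<le> i + b - 1" unfolding j_def by (rule times_div_less_eq_dividend)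
  moreover have "i + b - 1 < b * j + b" unfolding j_def using b mod_less_divisor[of b "i + b - 1"] mult_div_mod_eq[of b "i + b - 1"] by linarith
  ultimately have j: "i \<le> b * j" "b * j + b \<le> i + 2 * b" using b by linarith+
  have Spow: "S ^ n = s ^ (b * n)" for n by (simp add: S_def power_mult)
  have "\<exists>t<b. ?v div s ^ (b * j + t) mod s \<noteq> s - 1"
  proof (cases "j < N")
    case True
    show ?thesis
    proof (rule ccontr)
      assume "\<not> ?thesis"
      then have "(?v div s ^ (b * j)) div s ^ t mod s = s - 1" if "t < b" for t
        using that by (simp add: div_mult2_eq power_add)
      then have "(?v div s ^ (b * j)) mod s ^ b = s ^ b - 1"
        using s by (intro mod_power_all_digits_max) auto
      then have "?v div S ^ j mod S = S - 1" by (simp add: Spow) (simp add: S_def)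
      then show False using digit_word_val[OF d True] words_lt[OF d True] by simp
    qed
  next
    case False
    then have "S ^ N \<le> S ^ j" using S4 by (intro power_increasing) auto
    then have "?v < s ^ (b * j)" using word_val_less[OF d] by (simp add: Spow)
    then have "?v div s ^ (b * j + 0) mod s \<noteq> s - 1" using s by simp
    then show ?thesis using b by (intro exI[of _ 0]) auto
  qed
  then obtain t where t: "t < b" "?v div s ^ (b * j + t) mod s \<noteq> s - 1" by blast
  have "b * j + t = i + (b * j + t - i)" using j by simp
  then show "\<exists>t<2 * b. ?v div s ^ (i + t) mod s \<noteq> s - 1"
    using t j by (intro exI[of _ "b * j + t - i"]) auto
qed

text \<open>The integer inequalities of \<open>cell_ok\<close> describe fractional parts exactly,
  because \<open>frac (x / B) = (x mod B) / B\<close>; the rest is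
  \<open>cell_bound\<close>.\<close>

lemma cell_ok_of_exp_sums:
  assumes A: "A = k ^ 2" "A + L = Suc k ^ 2" and q: "q \<ge> 1" and r: "r \<ge> 2"
    and S: "\<And>l. l \<in> {1..<128 * q^5} \<Longrightarrow> norm (wsum r l d) \<le> real (card (Wn r)) / real (2048 * q^6)"
  shows "cell_ok s k r q (w * s ^ L + word_val S N d)"
  unfolding cell_ok_def
proof (intro allI impI)
  fix c assume c: "c < q"
  let ?W = "w * s ^ L + word_val S N d"
  have B': "B = s ^ (Suc k ^ 2)" by (simp add: B_def A(2))
  have fr: "frac (real r ^ n * pt d) = real (r ^ n * ?W mod B) / real B" for n
  proof -
    have "real r ^ n * pt d = real (r ^ n * ?W) / real B"
      by (simp add: pt_def add_divide_distrib distrib_left)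
    then show ?thesis by (simp only: frac_of_nat_divide)
  qed
  have "{n. n < nr s r (Suc k ^ 2) \<and> (nr s r (k ^ 2) \<le> n \<and> (c * B \<le> q * (r ^ n * ?W mod B) \<and> q * (r ^ n * ?W mod B) < Suc c * B))}
     = {n\<in>Wn r. real c \<le> real q * frac (real r ^ n * pt d) \<and> real q * frac (real r ^ n * pt d) < real c + 1}"
  proof -
    show ?thesis unfolding fr Wn_def A(2)[symmetric] A(1)[symmetric] by (auto simp: le_cell_iff[OF B0] cell_less_iff[OF B0] simp del: mult_Suc)
  qed
  moreover have "card (Wn r) = nr s r (Suc k ^ 2) - nr s r (k ^ 2)"
    unfolding Wn_def A(2)[symmetric] A(1)[symmetric] by simp
  ultimately show "q ^ 2 * card {n. n < nr s r (Suc k ^ 2) \<and> (nr s r (k ^ 2) \<le> n \<and>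
       (c * s ^ (Suc k ^ 2) \<le> q * (r ^ n * ?W mod s ^ (Suc k ^ 2)) \<and>
        q * (r ^ n * ?W mod s ^ (Suc k ^ 2)) < Suc c * s ^ (Suc k ^ 2)))}
     \<le> Suc q * (nr s r (Suc k ^ 2) - nr s r (k ^ 2))"
    using cell_bound[OF finite_Wn q c S[unfolded wsum_def]] by (simp add: B' del: power_Suc)
qed

text \<open>Each step multiplies by \<open>r \<le> s ^ T\<close>, so at least \<open>L div T\<close>
  powers of \<open>r\<close> fit between \<open>s ^ A\<close> and \<open>s ^ (A + L)\<close>.
  Windows thus grow linearly with the stage, for all \<open>r \<le> T\<close> at once.\<close>

lemma card_Wn_ge:
  assumes r: "r \<ge> 2" "r \<le> T" and T: "T \<ge> 1"
  shows "L div T \<le> card (Wn r)"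
proof -
  define n1 where "n1 = nr s r A"
  have ge: "s ^ A \<le> r ^ n1" using less_nr_iff[OF r(1), of n1 s A] by (simp add: n1_def)
  have lt: "r ^ n1 < r * s ^ A"
  proof (cases n1)
    case 0
    have "1 * 1 < r * s ^ A" using r s by (intro mult_less_le_imp_less) auto
    then show ?thesis using 0 by simp
  next
    case (Suc m)
    then have "r ^ m < s ^ A" using less_nr_iff[OF r(1), of m s A] by (simp add: n1_def)
    then show ?thesis using Suc r by simp
  qed
  have rT: "r \<le> s ^ T"
  proof -
    have "r \<le> 2 ^ T" using r less_exp[of T] by linarith
    also have "\<dots> \<le> s ^ T" using s by (intro power_mono) auto
    finally show ?thesis .
  qed
  have "{n1..<n1 + L div T} \<subseteq> Wn r"
  proof
    fix n assume n: "n \<in> {n1..<n1 + L div T}"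
    define m where "m = n - n1"
    have m: "n = n1 + m" "Suc m \<le> L div T" using n by (auto simp: m_def)
    have "s ^ A \<le> r ^ n" using ge r m(1) power_increasing[of n1 n r] by (meson le_add1 le_trans one_le_numeral)
    moreover have "r ^ n < B"
    proof -
      have "r ^ n = r ^ n1 * r ^ m" by (simp add: m power_add)
      also have "\<dots> < (r * s ^ A) * r ^ m" using lt r by (intro mult_strict_right_mono) auto
      also have "\<dots> = s ^ A * r ^ Suc m" by simp
      also have "\<dots> \<le> s ^ A * (s ^ T) ^ Suc m" using rT by (intro mult_left_mono power_mono) auto
      also have "\<dots> = s ^ (A + T * Suc m)" by (simp add: power_add power_mult)
      also have "\<dots> \<le> s ^ (A + L)"
      proof (rule power_increasing)
        have "T * Suc m \<le> T * (L div T)" using m(2) by (rule mult_le_mono2)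
        also have "\<dots> \<le> L" by simp
        finally show "A + T * Suc m \<le> A + L" by simp
      qed (use s in simp)
      finally show ?thesis by (simp add: B_def)
    qed
    ultimately show "n \<in> Wn r" using mem_Wn[OF r(1)] by simp
  qed
  then have "card {n1..<n1 + L div T} \<le> card (Wn r)" by (rule card_mono[OF finite_Wn])
  then show ?thesis by simp
qed

end

section \<open>Growth estimates behind the rate\<close>

lemma eventually_small_term:
  fixes C S :: real
  assumes "S \<ge> 4"
  shows "\<forall>\<^sub>F a in sequentially. C * ((real a + 2)\<^sup>2) ^ 17 \<le> (S - 1) ^ a"
proof -
  have "\<forall>\<^sub>F a in sequentially. C * ((real a + 2)\<^sup>2) ^ 17 \<le> 3 ^ a" by real_asymp
  then show ?thesis
  proof eventually_elim
    case (elim a)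
    also have "(3::real) ^ a \<le> (S - 1) ^ a" using assms by (intro power_mono) auto
    finally show ?case .
  qed
qed

text \<open>Factoring out \<open>2 powr x\<close> with \<open>x = c * 2 powr (4 * c * a)\<close>
  leaves only comparisons with \<open>2 powr (2 powr a)\<close>: one for the remaining product, one
  for the exponents.\<close>

lemma eventually_below_tower_real:
  fixes c C D :: real
  assumes "c > 0" "C > 0" "D > 0"
  defines "P \<equiv> \<lambda>a. 2 + 2 * (D * (2 * real a + 2) + 128 * ((real a + 2)\<^sup>2) ^ 5)\<^sup>2"
    and "R \<equiv> \<lambda>a. C * ((real a + 2)\<^sup>2) ^ 17"
  shows "\<forall>\<^sub>F a in sequentially. (C * 2 powr (c * 2 powr (4 * c * real a)) * 2 powr (4 * c * real a) + P a) * R a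
     \<le> 2 powr (2 powr (2 powr real a))"
proof -
  have "\<forall>\<^sub>F a in sequentially. (C * 2 powr (4 * c * real a) + P a) * R a \<le> 2 powr (2 powr real a)"
    unfolding P_def R_def using assms(1-3) by real_asymp
  moreover have "\<forall>\<^sub>F a in sequentially. c * 2 powr (4 * c * real a) + 2 powr real a \<le> 2 powr (2 powr real a)"
    using assms(1-3) by real_asymp
  ultimately show ?thesis
  proof eventually_elim
    case (elim a)
    define x where "x = c * 2 powr (4 * c * real a)"
    have x: "1 \<le> 2 powr x" using assms(1) by (simp add: x_def ge_one_powr_ge_zero)
    have P: "0 \<le> P a" by (simp add: P_def)
    have R: "0 \<le> R a" using assms(2) by (simp add: R_def)
    have "C * 2 powr x * 2 powr (4 * c * real a) + P a \<le> 2 powr x * (C * 2 powr (4 * c * real a) + P a)"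
      using mult_right_mono[OF x P] by (simp add: algebra_simps)
    from mult_right_mono[OF this R]
    have "(C * 2 powr x * 2 powr (4 * c * real a) + P a) * R a \<le> 2 powr x * ((C * 2 powr (4 * c * real a) + P a) * R a)"
      by (simp only: mult.assoc)
    also have "\<dots> \<le> 2 powr x * 2 powr (2 powr real a)"
      by (intro mult_left_mono elim(1)) auto
    also have "\<dots> = 2 powr (x + 2 powr real a)" by (simp add: powr_add)
    also have "\<dots> \<le> 2 powr (2 powr (2 powr real a))"
      using elim(2) by (intro powr_mono) (auto simp: x_def)
    finally show ?case by (simp add: x_def)
  qed
qed

text \<open>Since \<open>n < 2 ^ n\<close>, both bases \<open>S\<close> and \<open>T\<close> are at
  most \<open>2 powr c\<close> for \<open>c = S + T\<close>, so all large terms become powers of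
  two.\<close>

lemma eventually_below_tower:
  fixes S T b s :: nat
  assumes S: "S \<ge> 4" and T: "T \<ge> 1" and s: "s * b \<ge> 1"
  shows "\<forall>\<^sub>F a in sequentially.
    (160 * real S * ln S * real T ^ (S ^ (4 * a)) * real (S ^ (4 * a)) + 2
      + 2 * (real (s * b * (2 * a + 2) + 128 * ((a + 2)\<^sup>2) ^ 5))\<^sup>2) * (2 ^ 31 * real T ^ 2 * (real ((a + 2)\<^sup>2)) ^ 17)
     \<le> real (tower a)"
proof -
  define c where "c = real (S + T)"
  define C where "C = max (160 * real S * ln S) (2 ^ 31 * real T ^ 2)"
  define D where "D = real (s * b)"
  have pos: "c > 0" "C > 0" "D > 0"
    using S T s by (auto simp: c_def C_def D_def less_max_iff_disj)
  have pw: "real n \<le> 2 powr c" if "n \<le> S + T" for n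
  proof -
    have "real n < 2 ^ n" by (rule of_nat_less_two_power)
    also have "\<dots> = 2 powr real n" by (simp add: powr_realpow)
    also have "\<dots> \<le> 2 powr c" using that by (intro powr_mono) (auto simp: c_def)
    finally show ?thesis by simp
  qed
  show ?thesis
    using eventually_below_tower_real[OF pos]
  proof eventually_elim
    case (elim a)
    define L where "L = S ^ (4 * a)"
    have L: "real L \<le> 2 powr (4 * c * real a)"
    proof -
      have "real L = real S ^ (4 * a)" by (simp add: L_def)
      also have "\<dots> \<le> (2 powr c) ^ (4 * a)" by (intro power_mono pw) auto
      also have "\<dots> = 2 powr (4 * c * real a)" by (simp add: powr_power mult_ac)
      finally show ?thesis .
    qed
    have TL: "real T ^ L \<le> 2 powr (c * 2 powr (4 * c * real a))"
    proof -
      have "real T ^ L \<le> (2 powr c) ^ L" by (intro power_mono pw) auto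
      also have "\<dots> = 2 powr (c * real L)" by (simp add: powr_power mult_ac)
      also have "\<dots> \<le> 2 powr (c * 2 powr (4 * c * real a))"
        using L pos by (intro powr_mono mult_left_mono) auto
      finally show ?thesis .
    qed
    have lnS: "0 \<le> ln (real S)" using S by simp
    have e1: "160 * real S * ln S * real T ^ L * real L \<le> C * 2 powr (c * 2 powr (4 * c * real a)) * 2 powr (4 * c * real a)"
      using L TL pos lnS by (intro mult_mono) (auto simp: C_def)
    have e2: "real (s * b * (2 * a + 2) + 128 * ((a + 2)\<^sup>2) ^ 5) = D * (2 * real a + 2) + 128 * ((real a + 2)\<^sup>2) ^ 5"
      by (simp add: D_def algebra_simps)
    have e3: "2 ^ 31 * real T ^ 2 * (real ((a + 2)\<^sup>2)) ^ 17 \<le> C * ((real a + 2)\<^sup>2) ^ 17"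
    proof -
      have "real ((a + 2)\<^sup>2) = (real a + 2)\<^sup>2" by (simp add: add.commute)
      then show ?thesis by (simp only:) (rule mult_right_mono, auto simp: C_def)
    qed
    have e4: "0 \<le> C * 2 powr (c * 2 powr (4 * c * real a)) * 2 powr (4 * c * real a) + (2 + 2 * (D * (2 * real a + 2) + 128 * ((real a + 2)\<^sup>2) ^ 5)\<^sup>2)"
      using pos by simp
    have "(160 * real S * ln S * real T ^ L * real L + 2 + 2 * (real (s * b * (2 * a + 2) + 128 * ((a + 2)\<^sup>2) ^ 5))\<^sup>2)
         * (2 ^ 31 * real T ^ 2 * (real ((a + 2)\<^sup>2)) ^ 17)
       \<le> (C * 2 powr (c * 2 powr (4 * c * real a)) * 2 powr (4 * c * real a) + (2 + 2 * (D * (2 * real a + 2) + 128 * ((real a + 2)\<^sup>2) ^ 5)\<^sup>2))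
         * (C * ((real a + 2)\<^sup>2) ^ 17)"
      unfolding e2 by (rule mult_mono[OF _ e3 e4]) (use e1 in linarith, simp)
    also have "\<dots> \<le> 2 powr (2 powr (2 powr real a))" by (rule elim)
    also have "\<dots> = real (tower a)"
      by (simp add: tower_def powr_realpow flip: of_nat_power) (metis of_nat_numeral of_nat_power powr_realpow zero_less_numeral)
    finally show ?case by (simp add: L_def)
  qed
qed

text \<open>The union bound: there are at most \<open>T * 128 * q ^ 5\<close> tests, and each of the
  two precisions may use half of the budget in \<open>averaging\<close>.\<close>

lemma test_count_bound:
  fixes f :: "nat \<Rightarrow> nat \<Rightarrow> real"
  assumes "I \<subseteq> {..T} \<times> {1..<128 * q ^ 5}" "0 \<notin> fst ` I" "T \<ge> 1" "q \<ge> 1"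
  shows "real (card I) * (1 / (256 * real T * real q ^ 5)) \<le> 1 / 2"
proof -
  have "I \<subseteq> {1..T} \<times> {1..<128 * q ^ 5}" using assms(1,2) by (force simp: Suc_le_eq image_iff)
  then have "card I \<le> card ({1..T} \<times> {1..<128 * q ^ 5})" by (rule card_mono[rotated]) simp
  also have "\<dots> \<le> T * (128 * q ^ 5)" by (simp add: card_cartesian_product)
  finally have "real (card I) \<le> real (T * (128 * q ^ 5))" by (simp only: of_nat_le_iff)
  then have "real (card I) * (1 / (256 * real T * real q ^ 5)) \<le> real (T * (128 * q ^ 5)) * (1 / (256 * real T * real q ^ 5))"
    by (rule mult_right_mono) simp
  also have "\<dots> = 1 / 2" using assms(3,4) by (simp add: field_simps)
  finally show ?thesis .
qed

context word_block
begin

text \<open>Measured in units of the threshold of \<open>cell_bound\<close>, so that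
  \<open>1\<close> is the borderline of success, and squared to match second moments.\<close>

definition test :: "nat \<Rightarrow> nat \<Rightarrow> nat \<Rightarrow> (nat \<Rightarrow> nat) \<Rightarrow> real" where
  "test q r l d = (norm (wsum r l d) / (real (card (Wn r)) / real (2048 * q ^ 6)))\<^sup>2"

lemma test_nonneg: "0 \<le> test q r l d"
  by (simp add: test_def)

lemma test_le_1_imp:
  assumes "test q r l d \<le> 1" "card (Wn r) > 0" "q \<ge> 1"
  shows "norm (wsum r l d) \<le> real (card (Wn r)) / real (2048 * q ^ 6)"
proof -
  let ?D = "real (card (Wn r)) / real (2048 * q ^ 6)"
  let ?N = "norm (wsum r l d)"
  have "?D > 0" using assms(2,3) by simp
  have "(?N / ?D)\<^sup>2 \<le> 1\<^sup>2" using assms(1) by (simp add: test_def)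
  then have "?N / ?D \<le> 1" by (rule power2_le_imp_le) simp
  then show ?thesis using \<open>?D > 0\<close> by (simp only: pos_divide_le_eq mult_1)
qed

lemma sum_test_le:
  assumes "moment r l \<le> real (S - 1) ^ N * Y"
    and "Y * (2 ^ 22 * real q ^ 12) \<le> (real (card (Wn r)))\<^sup>2 * \<delta>"
    and M: "card (Wn r) > 0" and q: "q \<ge> 1"
  shows "(\<Sum>d\<in>words S N. test q r l d) \<le> real (card (words S N)) * \<delta>"
proof -
  let ?M = "real (card (Wn r))"
  let ?c = "2 ^ 22 * real q ^ 12 / ?M\<^sup>2"
  have "(\<Sum>d\<in>words S N. test q r l d) = (\<Sum>d\<in>words S N. (norm (wsum r l d))\<^sup>2 * ?c)"
    using M q by (intro sum.cong refl) (simp add: test_def power_divide power_mult_distrib flip: power_mult)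
  also have "\<dots> = moment r l * ?c"
    by (simp only: moment_def sum_distrib_right)
  also have "\<dots> \<le> (real (S - 1) ^ N * Y) * ?c"
    by (rule mult_right_mono[OF assms(1)]) simp
  also have "\<dots> = real (S - 1) ^ N * (Y * (2 ^ 22 * real q ^ 12) / ?M\<^sup>2)" by simp
  also have "\<dots> \<le> real (S - 1) ^ N * \<delta>"
  proof (rule mult_left_mono)
    have "0 < ?M\<^sup>2" using M by (intro zero_less_power) (simp only: of_nat_0_less_iff)
    then show "Y * (2 ^ 22 * real q ^ 12) / ?M\<^sup>2 \<le> \<delta>"
      using assms(2) by (simp only: pos_divide_le_eq mult.commute)
  qed simp
  finally show ?thesis by simp
qed

text \<open>\<open>2 ^ 22 * T ^ 12\<close> is the square of \<open>2048 * T ^ 6\<close>. The target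
  \<open>1 / (256 * T ^ 6)\<close> is split into two halves: one for the terms linear in the window
  length, which leads to \<open>2 ^ 31 * T ^ 18\<close>, and one for the term with
  \<open>1 / U\<close>.\<close>

lemma sum_test_all_bases:
  assumes r: "2 \<le> r" "r \<le> T" and l: "l \<in> {1..<128 * T ^ 5}" and N: "N \<ge> 2"
    and U: "S = U\<^sup>2" "2 ^ 60 * real T ^ 20 \<le> real U"
    and M: "(2 + 2 * (real (s * b * 4 + 128 * T ^ 5))\<^sup>2) * (2 ^ 31 * real T ^ 18) \<le> real (card (Wn r))"
  shows "(\<Sum>d\<in>words S N. test T r l d) \<le> real (card (words S N)) * (1 / (256 * real T * real T ^ 5))"
proof (rule sum_test_le)
  let ?M = "real (card (Wn r))"
  define X where "X = real (s * b * 4 + 128 * T ^ 5)"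
  have T: "real T \<ge> 2" using r by simp
  have T1: "1 \<le> real T ^ n" for n using T by (intro one_le_power) simp
  have M1: "1 \<le> ?M"
  proof -
    have "1 * 1 \<le> (2 + 2 * X\<^sup>2) * (2 ^ 31 * real T ^ 18)"
      using T1[of 18] by (intro mult_mono) auto
    then show ?thesis using M by (simp add: X_def)
  qed
  then show M0: "card (Wn r) > 0" by simp
  show "T \<ge> 1" using r by simp
  have "(2::real) \<le> 2 ^ 60 * real T ^ 20" using mult_mono[of "2::real" "2 ^ 60" 1 "real T ^ 20"] T1[of 20] by simp
  then have U2: "U \<ge> 2" using U by simp
  have lX: "(real (s * b * 4 + l))\<^sup>2 \<le> X\<^sup>2"
    unfolding X_def using l by (intro power_mono) (simp_all only: of_nat_le_iff atLeastLessThan_iff add_le_cancel_left less_imp_le of_nat_0_le_iff)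
  show "moment r l \<le>
      real (S - 1) ^ N * (2 * (?M + 5 * ?M\<^sup>2 / real U) + 2 * (real (s * b * 4 + l))\<^sup>2)"
    by (rule moment_all_bases) (use r l U U2 N in auto)
  have "2 * (?M + 5 * ?M\<^sup>2 / real U) + 2 * (real (s * b * 4 + l))\<^sup>2 \<le> (2 + 2 * X\<^sup>2) * ?M + 10 * ?M\<^sup>2 / real U"
    using lX mult_left_mono[OF M1, of "2 * X\<^sup>2"] by (simp add: algebra_simps)
  then have "(2 * (?M + 5 * ?M\<^sup>2 / real U) + 2 * (real (s * b * 4 + l))\<^sup>2) * (2 ^ 22 * real T ^ 12)
      \<le> ((2 + 2 * X\<^sup>2) * ?M + 10 * ?M\<^sup>2 / real U) * (2 ^ 22 * real T ^ 12)"
    by (rule mult_right_mono) simp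
  also have "\<dots> = (2 + 2 * X\<^sup>2) * ?M * (2 ^ 22 * real T ^ 12) + 10 * ?M\<^sup>2 / real U * (2 ^ 22 * real T ^ 12)"
    by (rule distrib_right)
  also have "(2 + 2 * X\<^sup>2) * ?M * (2 ^ 22 * real T ^ 12) \<le> ?M\<^sup>2 * (1 / (512 * real T ^ 6))"
  proof -
    have "(2 + 2 * X\<^sup>2) * ?M * (2 ^ 22 * real T ^ 12) = ((2 + 2 * X\<^sup>2) * (2 ^ 31 * real T ^ 18)) * (?M * (1 / (512 * real T ^ 6)))"
      using T by (simp add: field_simps flip: power_add)
    also have "\<dots> \<le> ?M * (?M * (1 / (512 * real T ^ 6)))"
      using M by (intro mult_right_mono) (auto simp: X_def)
    finally show ?thesis by (simp add: power2_eq_square)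
  qed
  also have "10 * ?M\<^sup>2 / real U * (2 ^ 22 * real T ^ 12) \<le> ?M\<^sup>2 * (1 / (512 * real T ^ 6))"
  proof -
    have "10 * ?M\<^sup>2 / real U * (2 ^ 22 * real T ^ 12) \<le> 10 * ?M\<^sup>2 / (2 ^ 60 * real T ^ 20) * (2 ^ 22 * real T ^ 12)"
      using U T U2 by (intro mult_right_mono divide_left_mono mult_pos_pos) auto
    also have "\<dots> = ?M\<^sup>2 * (10 / (2 ^ 38 * real T ^ 8))"
      using T by (simp add: field_simps flip: power_add)
    also have "\<dots> \<le> ?M\<^sup>2 * (1 / (512 * real T ^ 6))"
    proof (rule mult_left_mono)
      have "10 / (2 ^ 38 * real T ^ 8) = (10 / 2 ^ 38) / real T ^ 8" by simp
      also have "\<dots> \<le> (1 / 512) / real T ^ 6"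
        by (rule frac_le) (use T in \<open>auto intro: power_increasing\<close>)
      finally show "10 / (2 ^ 38 * real T ^ 8) \<le> 1 / (512 * real T ^ 6)" by simp
    qed simp
    finally show ?thesis .
  qed
  finally have "(2 * (?M + 5 * ?M\<^sup>2 / real U) + 2 * (real (s * b * 4 + l))\<^sup>2) * (2 ^ 22 * real T ^ 12)
      \<le> ?M\<^sup>2 * (1 / (512 * real T ^ 6)) + ?M\<^sup>2 * (1 / (512 * real T ^ 6))"
    by simp
  also have "\<dots> = ?M\<^sup>2 * (1 / (256 * real T ^ 6))" by simp
  also have "real T ^ 6 = real T * real T ^ 5" by (simp flip: power_Suc)
  finally show "(2 * (?M + 5 * ?M\<^sup>2 / real U) + 2 * (real (s * b * 4 + l))\<^sup>2) * (2 ^ 22 * real T ^ 12)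
      \<le> ?M\<^sup>2 * (1 / (256 * real T * real T ^ 5))"
    by (simp only: mult.assoc)
qed

text \<open>The same balance at precision \<open>q\<close>. The term quadratic in the window length
  shrinks with \<open>a\<close> by the hypothesis \<open>small\<close>; the other terms, with the
  huge \<open>r ^ (S ^ (4 * a))\<close> among them, are beaten by the length of the window.\<close>

lemma sum_test_independent:
  assumes r: "2 \<le> r" "r \<le> T" and l: "l \<in> {1..<128 * q ^ 5}" and a: "a \<ge> 1" and N: "2 * a \<le> N" and q: "q = (a + 2)\<^sup>2"
    and ind: "\<And>n p. n \<ge> 1 \<Longrightarrow> p \<ge> 1 \<Longrightarrow> r ^ n \<noteq> S ^ p"
    and small: "164 * real S * 2 ^ 31 * real T * real q ^ 17 \<le> real (S - 1) ^ a"
    and M: "(160 * real S * ln S * real T ^ (S ^ (4 * a)) * real (S ^ (4 * a)) + 2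
      + 2 * (real (s * b * (2 * a + 2) + 128 * q ^ 5))\<^sup>2) * (2 ^ 31 * real T * real q ^ 17) \<le> real (card (Wn r))"
  shows "(\<Sum>d\<in>words S N. test q r l d) \<le> real (card (words S N)) * (1 / (256 * real T * real q ^ 5))"
proof (rule sum_test_le)
  let ?M = "real (card (Wn r))"
  define X where "X = real (s * b * (2 * a + 2) + 128 * q ^ 5)"
  define L where "L = S ^ (4 * a)"
  define E where "E = 160 * real S * ln S * real T ^ L * real L"
  define \<tau> where "\<tau> = 1 / real (S - 1) ^ a"
  have T: "real T \<ge> 2" using r by simp
  have q4: "q \<ge> 4" unfolding q using power_mono[of 2 "a + 2" 2] by simp
  then have q1: "real q \<ge> 1" by simp
  have lnS: "0 \<le> ln (real S)" using S4 by simp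
  have E0: "0 \<le> E" using lnS by (simp add: E_def)
  have S1: "1 \<le> real (S - 1) ^ a" using S4 by (intro one_le_power) simp
  have \<tau>: "0 < \<tau>" "\<tau> \<le> 1" using S4 S1 by (auto simp: \<tau>_def)
  have qn: "1 \<le> real q ^ n" for n using q1 by (rule one_le_power)
  have M': "(E + 2 + 2 * X\<^sup>2) * (2 ^ 31 * real T * real q ^ 17) \<le> ?M" using M by (simp add: E_def X_def L_def)
  have M1: "1 \<le> ?M"
  proof -
    have "1 * (1 * 1 * 1) \<le> (E + 2 + 2 * X\<^sup>2) * (2 ^ 31 * real T * real q ^ 17)"
      using qn[of 17] E0 T by (intro mult_mono) auto
    then show ?thesis using M' by simp
  qed
  then show M0: "card (Wn r) > 0" by simp
  show "q \<ge> 1" using q4 by simp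
  let ?Y = "2 * (?M + 2 * ?M * ((41 * real S * ?M + 40 * real S * ln S * real r ^ L * real L) / real (S - 1) ^ a)) + 2 * (real (s * b * (2 * a + 2) + l))\<^sup>2"
  show "moment r l \<le> real (S - 1) ^ N * ?Y"
    unfolding L_def by (rule moment_independent) (use r l a N ind in auto)
  have lX: "(real (s * b * (2 * a + 2) + l))\<^sup>2 \<le> X\<^sup>2"
    unfolding X_def using l by (intro power_mono) (simp_all only: of_nat_le_iff atLeastLessThan_iff add_le_cancel_left less_imp_le of_nat_0_le_iff)
  have Yle: "?Y \<le> 164 * real S * \<tau> * ?M\<^sup>2 + (E + 2 + 2 * X\<^sup>2) * ?M"
  proof -
    have "real r ^ L \<le> real T ^ L" using r by (intro power_mono) auto
    then have "160 * real S * ln S * real r ^ L * real L \<le> E"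
      unfolding E_def using lnS by (intro mult_right_mono mult_left_mono) auto
    then have "(160 * real S * ln S * real r ^ L * real L) * (?M * \<tau>) \<le> E * (?M * 1)"
      using \<tau> E0 by (intro mult_mono) auto
    moreover have "X\<^sup>2 \<le> X\<^sup>2 * ?M" using M1 mult_left_mono[OF M1, of "X\<^sup>2"] by simp
    moreover have "?Y = 2 * ?M + 164 * real S * \<tau> * ?M\<^sup>2 + (160 * real S * ln S * real r ^ L * real L) * (?M * \<tau>) + 2 * (real (s * b * (2 * a + 2) + l))\<^sup>2"
      by (simp add: \<tau>_def power2_eq_square add_divide_distrib algebra_simps)
    ultimately show ?thesis using lX by (simp add: algebra_simps)
  qed
  have "?Y * (2 ^ 22 * real q ^ 12) \<le> (164 * real S * \<tau> * ?M\<^sup>2 + (E + 2 + 2 * X\<^sup>2) * ?M) * (2 ^ 22 * real q ^ 12)"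
    using Yle by (rule mult_right_mono) simp
  also have "\<dots> = 164 * real S * \<tau> * ?M\<^sup>2 * (2 ^ 22 * real q ^ 12) + (E + 2 + 2 * X\<^sup>2) * ?M * (2 ^ 22 * real q ^ 12)"
    by (rule distrib_right)
  also have "164 * real S * \<tau> * ?M\<^sup>2 * (2 ^ 22 * real q ^ 12) \<le> ?M\<^sup>2 * (1 / (512 * real T * real q ^ 5))"
  proof -
    have "164 * real S * \<tau> * ?M\<^sup>2 * (2 ^ 22 * real q ^ 12)
        = (164 * real S * 2 ^ 31 * real T * real q ^ 17 * \<tau>) * (?M\<^sup>2 * (1 / (512 * real T * real q ^ 5)))"
      using T q1 by (simp add: field_simps flip: power_add)
    also have "\<dots> \<le> 1 * (?M\<^sup>2 * (1 / (512 * real T * real q ^ 5)))"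
    proof (rule mult_right_mono)
      have "164 * real S * 2 ^ 31 * real T * real q ^ 17 * \<tau> \<le> real (S - 1) ^ a * \<tau>"
        using \<tau>(1) by (intro mult_right_mono small) simp
      moreover have "real (S - 1) ^ a * \<tau> = 1"
        unfolding \<tau>_def times_divide_eq_right mult_1_right using S1 by (intro divide_self) linarith
      ultimately show "164 * real S * 2 ^ 31 * real T * real q ^ 17 * \<tau> \<le> 1"
        by linarith
    qed simp
    finally show ?thesis by simp
  qed
  also have "(E + 2 + 2 * X\<^sup>2) * ?M * (2 ^ 22 * real q ^ 12) \<le> ?M\<^sup>2 * (1 / (512 * real T * real q ^ 5))"
  proof -
    have "(E + 2 + 2 * X\<^sup>2) * ?M * (2 ^ 22 * real q ^ 12)
        = ((E + 2 + 2 * X\<^sup>2) * (2 ^ 31 * real T * real q ^ 17)) * (?M * (1 / (512 * real T * real q ^ 5)))"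
      using T q1 by (simp add: field_simps flip: power_add)
    also have "\<dots> \<le> ?M * (?M * (1 / (512 * real T * real q ^ 5)))"
      using M' by (intro mult_right_mono) auto
    finally show ?thesis by (simp add: power2_eq_square)
  qed
  finally show "?Y * (2 ^ 22 * real q ^ 12) \<le> ?M\<^sup>2 * (1 / (256 * real T * real q ^ 5))"
    by simp
qed

end

text \<open>A relation \<open>r ^ Suc a = s ^ Suc b\<close> is found as soon as \<open>k\<close>
  exceeds \<open>a\<close> and \<open>b\<close>, and only finitely many \<open>r\<close> are
  concerned.\<close>

lemma eventually_seems_independent:
  "\<forall>\<^sub>F k in sequentially. \<forall>r\<le>T. seems_independent s k r \<longrightarrow> (\<forall>a b. r ^ Suc a \<noteq> s ^ Suc b)"
proof -
  have "\<forall>\<^sub>F k in sequentially. seems_independent s k r \<longrightarrow> (\<forall>a b. r ^ Suc a \<noteq> s ^ Suc b)" for r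
  proof (cases "\<forall>a b. r ^ Suc a \<noteq> s ^ Suc b")
    case False
    then obtain a b where ab: "r ^ Suc a = s ^ Suc b" by blast
    show ?thesis
      using eventually_gt_at_top[of "max a b"]
    proof eventually_elim
      case (elim k)
      then have "\<not> seems_independent s k r"
        using ab unfolding seems_independent_def by (metis max_less_iff_conj)
      then show ?case by simp
    qed
  qed simp
  then have "\<forall>\<^sub>F k in sequentially. \<forall>r\<in>{..T}. seems_independent s k r \<longrightarrow> (\<forall>a b. r ^ Suc a \<noteq> s ^ Suc b)"
    by (intro eventually_ball_finite) auto
  then show ?thesis by (rule eventually_mono) auto
qed

text \<open>The quantifier over \<open>w\<close> stands inside: the moment bounds do not see the
  earlier digits, so the threshold for \<open>k\<close> depends on \<open>s\<close> and
  \<open>T\<close> alone. This matters because the prefix at stage \<open>k\<close> depends on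
  \<open>g\<close>.\<close>

theorem eventually_good:
  assumes s: "s \<ge> 2" and T: "T \<ge> 1"
  shows "\<forall>\<^sub>F k in sequentially. \<forall>w. \<exists>v<s ^ (2 * k). good s k w T v"
proof -
  define b where "b = 2 * uexp T"
  define S where "S = s ^ b"
  define U where "U = s ^ uexp T"
  have b2: "b \<ge> 2" by (simp add: b_def uexp_def)
  have S4: "S \<ge> 4"
  proof -
    have "(2::nat) ^ 2 \<le> s ^ 2" using s by (rule power_mono) simp
    also have "\<dots> \<le> s ^ b" using s b2 by (intro power_increasing) auto
    finally show ?thesis by (simp add: S_def)
  qed
  have SU: "S = U\<^sup>2" by (simp add: S_def U_def b_def power_mult mult.commute flip: power_mult)
  have UT: "2 ^ 60 * real T ^ 20 \<le> real U"
  proof -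
    have "2 ^ 60 * T ^ 20 \<le> 2 ^ 60 * (2 ^ T) ^ 20"
      using less_exp[of T] by (intro mult_left_mono power_mono) auto
    also have "\<dots> = 2 ^ uexp T" by (simp add: uexp_def power_add power_mult mult.commute flip: power_mult)
    also have "\<dots> \<le> U" unfolding U_def using s by (intro power_mono) auto
    finally have "real (2 ^ 60 * T ^ 20) \<le> real U" by (simp only: of_nat_le_iff)
    then show ?thesis by simp
  qed
  define ZA where "ZA = (2 + 2 * (real (s * b * 4 + 128 * T ^ 5))\<^sup>2) * (2 ^ 31 * real T ^ 18)"
  have kA: "\<forall>\<^sub>F k in sequentially. ZA * real T \<le> real k"
    by real_asymp
  have eB: "\<forall>\<^sub>F a in sequentially. a \<ge> 1 \<and> (164 * real S * 2 ^ 31 * real T) * ((real a + 2)\<^sup>2) ^ 17 \<le> (real S - 1) ^ a \<and>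
     (160 * real S * ln S * real T ^ (S ^ (4 * a)) * real (S ^ (4 * a)) + 2
      + 2 * (real (s * b * (2 * a + 2) + 128 * ((a + 2)\<^sup>2) ^ 5))\<^sup>2) * (2 ^ 31 * real T ^ 2 * (real ((a + 2)\<^sup>2)) ^ 17)
     \<le> real (tower a)"
    by (intro eventually_conj eventually_ge_at_top eventually_small_term eventually_below_tower)
      (use S4 T s b2 in auto)
  have kB: "\<forall>\<^sub>F k in sequentially. itlog k \<ge> 1 \<and> (164 * real S * 2 ^ 31 * real T) * ((real (itlog k) + 2)\<^sup>2) ^ 17 \<le> (real S - 1) ^ itlog k \<and>
     (160 * real S * ln S * real T ^ (S ^ (4 * itlog k)) * real (S ^ (4 * itlog k)) + 2
      + 2 * (real (s * b * (2 * itlog k + 2) + 128 * ((itlog k + 2)\<^sup>2) ^ 5))\<^sup>2) * (2 ^ 31 * real T ^ 2 * (real ((itlog k + 2)\<^sup>2)) ^ 17)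
     \<le> real (tower (itlog k))"
    by (rule eventually_compose_filterlim[OF eB filterlim_itlog])
  have kN: "\<forall>\<^sub>F k in sequentially. 2 * b \<le> k"
    by (rule eventually_ge_at_top)
  have kT: "\<forall>\<^sub>F k in sequentially. max T 4 \<le> k"
    by (rule eventually_ge_at_top)
  have kL: "\<forall>\<^sub>F k in sequentially. b * itlog k \<le> k"
  proof -
    have "\<forall>\<^sub>F a in sequentially. b * a \<le> tower a"
    proof -
      have "\<forall>\<^sub>F a in sequentially. real b * real a \<le> 2 ^ a" by real_asymp
      then show ?thesis
      proof eventually_elim
        case (elim a)
        then have "real (b * a) \<le> real (2 ^ a)" by simp
        then have "b * a \<le> 2 ^ a" by (simp only: of_nat_le_iff)
        also have "\<dots> \<le> 2 ^ (2 ^ a)" by (intro power_increasing less_imp_le[OF less_exp]) auto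
        also have "\<dots> \<le> tower a" unfolding tower_def by (intro power_increasing less_imp_le[OF less_exp]) auto
        finally show ?case .
      qed
    qed
    from eventually_compose_filterlim[OF this filterlim_itlog] kT
    show ?thesis
    proof eventually_elim
      case (elim k)
      then show ?case using tower_itlog[of k] by simp
    qed
  qed
  from kA kB kN kT kL eventually_seems_independent[of T s] show ?thesis
  proof eventually_elim
    case (elim k)
    define a where "a = itlog k"
    define q where "q = (a + 2)\<^sup>2"
    \<comment> \<open>Digits are taken from \<open>2 * k\<close> places only; the leading place of
      the block keeps the digit \<open>0\<close>.\<close>
    define N where "N = (2 * k) div b"
    have aN: "2 * a \<le> N" "2 \<le> N"
    proof -
      have "2 * a \<le> 2 * k div b" using elim(5) b2 by (simp add: a_def less_eq_div_iff_mult_less_eq mult.commute mult.left_commute)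
      then show "2 * a \<le> N" by (simp add: N_def)
      have "2 \<le> 2 * k div b" using elim(3) b2 by (simp add: less_eq_div_iff_mult_less_eq mult.commute)
      then show "2 \<le> N" by (simp add: N_def)
    qed
    have bN: "b * N \<le> 2 * k" by (simp add: N_def)
    show ?case
    proof
      fix w
      interpret wb: word_block s b N "k ^ 2" "2 * k + 1" w
      proof
        have "2 * k < b * (N + 1)" unfolding N_def using b2
          by (metis dividend_less_times_div mult.commute Suc_eq_plus1 mult_Suc_right add.commute less_le_trans zero_less_numeral)
        then show "2 * k + 1 \<le> b * (N + 1)" by simp
      qed (use s b2 in auto)
      have wS: "wb.S = S" by (simp add: wb.S_def S_def)
      have kk: "k ^ 2 + (2 * k + 1) = Suc k ^ 2" by (simp add: power2_eq_square)
      have Mk: "real k \<le> real T * real (card (wb.Wn r))" if "2 \<le> r" "r \<le> T" for r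
      proof -
        have "(2 * k + 1) div T \<le> card (wb.Wn r)" by (rule wb.card_Wn_ge) (use that T in auto)
        then have "T * ((2 * k + 1) div T) \<le> T * card (wb.Wn r)" by (rule mult_le_mono2)
        moreover have "2 * k + 1 \<le> T * ((2 * k + 1) div T) + T"
          using mult_div_mod_eq[of T "2 * k + 1"] mod_less_divisor[of T "2 * k + 1"] T by linarith
        moreover have "T \<le> k" using elim(4) by simp
        ultimately have "k \<le> T * card (wb.Wn r)" by linarith
        then have "real k \<le> real (T * card (wb.Wn r))" by (simp only: of_nat_le_iff)
        then show ?thesis by simp
      qed
      have rT: "0 < real T" using T by simp
      have MA: "ZA \<le> real (card (wb.Wn r))" if "2 \<le> r" "r \<le> T" for r
      proof -
        have "real T * ZA \<le> real T * real (card (wb.Wn r))"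
          using elim(1) Mk[OF that] by (simp add: mult.commute)
        then show ?thesis using rT by simp
      qed
      define Y where "Y = 160 * real S * ln S * real T ^ (S ^ (4 * a)) * real (S ^ (4 * a)) + 2
          + 2 * (real (s * b * (2 * a + 2) + 128 * q ^ 5))\<^sup>2"
      have MB: "Y * (2 ^ 31 * real T * real q ^ 17) \<le> real (card (wb.Wn r))" if "2 \<le> r" "r \<le> T" for r
      proof -
        have "real T * (Y * (2 ^ 31 * real T * real q ^ 17)) = Y * (2 ^ 31 * real T ^ 2 * real q ^ 17)"
          by (simp add: power2_eq_square)
        also have "\<dots> \<le> real (tower a)" using elim(2) by (simp only: Y_def q_def a_def)
        also have "\<dots> \<le> real k" using elim(4) tower_itlog[of k] by (simp add: a_def)
        also have "\<dots> \<le> real T * real (card (wb.Wn r))" by (rule Mk[OF that])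
        finally show ?thesis using rT by simp
      qed
      have Mpos: "card (wb.Wn r) > 0" if "2 \<le> r" "r \<le> T" for r
        using Mk[OF that] elim(4) by (intro Nat.gr0I) auto
      define J where "J = {r. 2 \<le> r \<and> r \<le> T \<and> seems_independent s k r}"
      define IA where "IA = {2..T} \<times> {1..<128 * T ^ 5}"
      define IB where "IB = J \<times> {1..<128 * q ^ 5}"
      \<comment> \<open>The tag separates the two precisions, so that both families of tests enter a
        single union bound.\<close>
      define X where "X i d = (case i of (tag, r, l) \<Rightarrow> wb.test (if tag then T else q) r l d)" for i :: "bool \<times> nat \<times> nat" and d
      define \<delta> where "\<delta> i = (if fst i then 1 / (256 * real T * real T ^ 5) else 1 / (256 * real T * real q ^ 5))" for i :: "bool \<times> nat \<times> nat"
      define I where "I = Pair True ` IA \<union> Pair False ` IB"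
      have fin: "finite IA" "finite IB" by (simp_all add: IA_def IB_def J_def)
      have q1: "q \<ge> 1" by (simp add: q_def)
      have "\<exists>d\<in>words wb.S N. \<forall>i\<in>I. X i d \<le> 1"
      proof (rule averaging)
        show "finite (words wb.S N)" by simp
        have "card (words wb.S N) > 0" using S4 by (simp add: wS)
        then show "words wb.S N \<noteq> {}" by (metis card.empty less_irrefl)
        show "finite I" using fin by (simp add: I_def)
        show "0 \<le> X i d" for i d by (cases i) (simp only: X_def prod.case wb.test_nonneg)
        show "(\<Sum>i\<in>I. \<delta> i) \<le> 1"
        proof -
          have "(\<Sum>i\<in>I. \<delta> i) = (\<Sum>i\<in>Pair True ` IA. \<delta> i) + (\<Sum>i\<in>Pair False ` IB. \<delta> i)"
            unfolding I_def using fin by (intro sum.union_disjoint) auto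
          also have "(\<Sum>i\<in>Pair True ` IA. \<delta> i) = real (card IA) * (1 / (256 * real T * real T ^ 5))"
            by (subst sum.reindex) (auto simp: inj_on_def \<delta>_def)
          also have "(\<Sum>i\<in>Pair False ` IB. \<delta> i) = real (card IB) * (1 / (256 * real T * real q ^ 5))"
            by (subst sum.reindex) (auto simp: inj_on_def \<delta>_def)
          also have "real (card IA) * (1 / (256 * real T * real T ^ 5)) \<le> 1 / 2"
            by (rule test_count_bound) (use T in \<open>auto simp: IA_def\<close>)
          also have "real (card IB) * (1 / (256 * real T * real q ^ 5)) \<le> 1 / 2"
            by (rule test_count_bound) (use T q1 in \<open>auto simp: IB_def J_def\<close>)
          finally show ?thesis by simp
        qed
        fix i assume "i \<in> I"
        then consider (A) r l where "i = (True, r, l)" "r \<in> {2..T}" "l \<in> {1..<128 * T ^ 5}"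
          | (B) r l where "i = (False, r, l)" "r \<in> J" "l \<in> {1..<128 * q ^ 5}"
          by (auto simp: I_def IA_def IB_def)
        then show "(\<Sum>d\<in>words wb.S N. X i d) \<le> real (card (words wb.S N)) * \<delta> i"
        proof cases
          case A
          have "(\<Sum>d\<in>words wb.S N. wb.test T r l d) \<le> real (card (words wb.S N)) * (1 / (256 * real T * real T ^ 5))"
            by (rule wb.sum_test_all_bases[where U = U]) (use A aN SU UT MA[of r] wS in \<open>auto simp: ZA_def\<close>)
          then show ?thesis by (simp add: X_def \<delta>_def A)
        next
          case B
          have r: "2 \<le> r" "r \<le> T" "seems_independent s k r" using B by (auto simp: J_def)
          have "(\<Sum>d\<in>words wb.S N. wb.test q r l d) \<le> real (card (words wb.S N)) * (1 / (256 * real T * real q ^ 5))"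
          proof (rule wb.sum_test_independent[where a = a])
            show "1 \<le> a" using elim(2) by (simp add: a_def)
            show "r ^ n \<noteq> wb.S ^ p" if np: "1 \<le> n" "1 \<le> p" for n p
            proof -
              have "b * p \<noteq> 0" using b2 np by simp
              then obtain p' where p': "b * p = Suc p'" by (cases "b * p") auto
              obtain n' where n': "n = Suc n'" using np(1) by (cases n) auto
              have "r ^ Suc n' \<noteq> s ^ Suc p'" using elim(6) r by blast
              then show ?thesis unfolding wb.S_def power_mult[symmetric] p' n' .
            qed
            have "real q = (real a + 2)\<^sup>2" by (simp add: q_def add.commute)
            moreover have "real (wb.S - 1) = real S - 1" using S4 by (simp add: wS of_nat_diff)
            ultimately show "164 * real wb.S * 2 ^ 31 * real T * real q ^ 17 \<le> real (wb.S - 1) ^ a"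
              using elim(2) by (simp only: wS a_def)
            show "(160 * real wb.S * ln wb.S * real T ^ (wb.S ^ (4 * a)) * real (wb.S ^ (4 * a)) + 2
                + 2 * (real (s * b * (2 * a + 2) + 128 * q ^ 5))\<^sup>2) * (2 ^ 31 * real T * real q ^ 17) \<le> real (card (wb.Wn r))"
              using MB[OF r(1,2)] by (simp only: wS Y_def)
          qed (use r B aN q_def in auto)
          then show ?thesis by (simp add: X_def \<delta>_def B)
        qed
      qed
      then obtain d where d: "d \<in> words wb.S N" "\<And>i. i \<in> I \<Longrightarrow> X i d \<le> 1" by blast
      let ?v = "word_val wb.S N d"
      have "?v < s ^ (2 * k)"
      proof -
        have "?v < wb.S ^ N" by (rule word_val_less[OF d(1)])
        also have "\<dots> = s ^ (b * N)" by (simp add: wb.S_def power_mult)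
        also have "\<dots> \<le> s ^ (2 * k)" using bN s by (intro power_increasing) auto
        finally show ?thesis .
      qed
      moreover have "good s k w T ?v"
        unfolding good_def
      proof (intro conjI allI impI)
        have "runlen T = 2 * b" by (simp add: runlen_def b_def)
        then show "no_run s (runlen T) ?v" using wb.no_run_word_val[OF d(1)] by simp
        fix r assume r: "r < Suc T" "2 \<le> r"
        then have r': "2 \<le> r" "r \<le> T" by auto
        show "cell_ok s k r T (w * s ^ (2 * k + 1) + ?v)"
        proof (rule wb.cell_ok_of_exp_sums[OF refl kk T r(2)])
          fix l assume l: "l \<in> {1..<128 * T ^ 5}"
          then have "(True, r, l) \<in> I" using r by (auto simp: I_def IA_def)
          then have "wb.test T r l d \<le> 1" using d(2) by (fastforce simp: X_def)
          then show "norm (wb.wsum r l d) \<le> real (card (wb.Wn r)) / real (2048 * T ^ 6)"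
            by (rule wb.test_le_1_imp) (use Mpos r' T in auto)
        qed
        assume ind: "seems_independent s k r"
        have "cell_ok s k r q (w * s ^ (2 * k + 1) + ?v)"
        proof (rule wb.cell_ok_of_exp_sums[OF refl kk q1 r(2)])
          fix l assume l: "l \<in> {1..<128 * q ^ 5}"
          then have "(False, r, l) \<in> I" using r ind by (auto simp: I_def IB_def J_def)
          then have "wb.test q r l d \<le> 1" using d(2) by (fastforce simp: X_def)
          then show "norm (wb.wsum r l d) \<le> real (card (wb.Wn r)) / real (2048 * q ^ 6)"
            by (rule wb.test_le_1_imp) (use Mpos r' q1 in auto)
        qed
        then show "cell_ok s k r ((itlog k + 2) ^ 2) (w * s ^ (2 * k + 1) + ?v)"
          by (simp add: q_def a_def)
      qed
      ultimately show "\<exists>v<s ^ (2 * k). good s k w T v" by blast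
    qed
  qed
qed

section \<open>Discrepancy estimates\<close>

lemma discrepancy_values_le_1:
  assumes "0 \<le> u" "u < v" "v \<le> (1::real)"
  shows "\<bar>real (card {n. n < N \<and> u \<le> x n \<and> x n < v}) / real N - (v - u)\<bar> \<le> 1"
proof -
  have "card {n. n < N \<and> u \<le> x n \<and> x n < v} \<le> card {..<N}" by (rule card_mono) auto
  then have "real (card {n. n < N \<and> u \<le> x n \<and> x n < v}) / real N \<le> 1"
    by (cases "N = 0") (simp_all add: divide_le_eq_1)
  moreover have "0 \<le> real (card {n. n < N \<and> u \<le> x n \<and> x n < v}) / real N" by simp
  ultimately show ?thesis using assms by linarith
qed

lemma discrepancy_ge:
  assumes "0 \<le> u" "u < v" "v \<le> (1::real)"
  shows "\<bar>real (card {n. n < N \<and> u \<le> x n \<and> x n < v}) / real N - (v - u)\<bar> \<le> discrepancy x N"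
proof -
  let ?f = "\<lambda>(u, v). \<bar>real (card {n. n < N \<and> u \<le> x n \<and> x n < v}) / real N - (v - u)\<bar>"
  have "?f (u, v) \<le> (SUP p\<in>{(u, v). 0 \<le> u \<and> u < v \<and> v \<le> 1}. ?f p)"
  proof (rule cSUP_upper)
    show "bdd_above (?f ` {(u, v). 0 \<le> u \<and> u < v \<and> v \<le> 1})"
      by (rule bdd_aboveI[of _ 1]) (use discrepancy_values_le_1 in auto)
  qed (use assms in auto)
  then show ?thesis by (simp add: discrepancy_def)
qed

lemma discrepancy_le:
  assumes "\<And>u v. 0 \<le> u \<Longrightarrow> u < v \<Longrightarrow> v \<le> (1::real) \<Longrightarrow>
     \<bar>real (card {n. n < N \<and> u \<le> x n \<and> x n < v}) / real N - (v - u)\<bar> \<le> D"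
  shows "discrepancy x N \<le> D"
  unfolding discrepancy_def
proof (rule cSUP_least)
  have "(0::real, 1::real) \<in> {(u, v). 0 \<le> u \<and> u < v \<and> v \<le> 1}" by simp
  then show "{(u, v). 0 \<le> u \<and> u < v \<and> v \<le> (1::real)} \<noteq> {}" by blast
qed (use assms in auto)

lemma discrepancy_nonneg: "0 \<le> discrepancy x N"
  using discrepancy_ge[of 0 1 N x] by linarith

section \<open>The limit number and the gap in its orbit\<close>

lemma discrepancy_ge_gap:
  assumes "N \<ge> 1" "0 < \<delta>" "\<delta> \<le> 1" "\<And>n. n < N \<Longrightarrow> x n < 1 - \<delta>"
  shows "\<delta> \<le> discrepancy x N"
proof -
  have e: "{n. n < N \<and> 1 - \<delta> \<le> x n \<and> x n < 1} = {}" using assms(4) by (auto simp: not_le)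
  have "\<bar>real (card {n. n < N \<and> 1 - \<delta> \<le> x n \<and> x n < 1}) / real N - (1 - (1 - \<delta>))\<bar> \<le> discrepancy x N"
    by (rule discrepancy_ge) (use assms in auto)
  then show ?thesis using assms unfolding e by simp
qed

text \<open>Nested intervals. Each block starts with the digit \<open>0\<close>, so the right end
  points decrease strictly and \<open>\<xi>\<close> stays strictly below all of them.\<close>

lemma digits_limit:
  fixes W e :: "nat \<Rightarrow> nat"
  assumes s: "s \<ge> 2" and W: "\<And>k. W (Suc k) = W k * s ^ (2 * k + 1) + e k" and e: "\<And>k. e k < s ^ (2 * k)"
  shows "\<exists>\<xi>. \<forall>k. real (W k) / real s ^ (k ^ 2) \<le> \<xi> \<and> \<xi> < (real (W k) + 1) / real s ^ (k ^ 2)"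
proof -
  define x where "x k = real (W k) / real s ^ (k ^ 2)" for k
  define y where "y k = (real (W k) + 1) / real s ^ (k ^ 2)" for k
  have rs: "real s \<ge> 2" using s by simp
  have sq: "real s ^ (Suc k ^ 2) = real s ^ (k ^ 2) * real s ^ (2 * k + 1)" for k
  proof -
    have "Suc k ^ 2 = k ^ 2 + (2 * k + 1)" by (simp add: power2_eq_square)
    then show ?thesis by (simp only: power_add)
  qed
  have x_Suc: "x (Suc k) = x k + real (e k) / real s ^ (Suc k ^ 2)" for k
    unfolding x_def sq W using rs by (simp add: add_divide_distrib)
  have y_Suc: "y (Suc k) < y k" for k
  proof -
    have "real (e k) + 1 \<le> real s ^ (2 * k)"
      using e[of k] by (metis Suc_eq_plus1 Suc_leI of_nat_1 of_nat_add of_nat_le_iff of_nat_power)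
    also have "\<dots> < real s ^ (2 * k + 1)" using rs by (intro power_strict_increasing) auto
    finally have lt: "real (e k) + 1 < real s ^ (2 * k + 1)" .
    have "real (W (Suc k)) + 1 = real (W k) * real s ^ (2 * k + 1) + (real (e k) + 1)" by (simp add: W)
    also have "\<dots> < real (W k) * real s ^ (2 * k + 1) + real s ^ (2 * k + 1)" using lt by simp
    also have "\<dots> = (real (W k) + 1) * real s ^ (2 * k + 1)" by (simp add: distrib_right)
    finally have "y (Suc k) < ((real (W k) + 1) * real s ^ (2 * k + 1)) / real s ^ (Suc k ^ 2)"
      unfolding y_def using rs by (intro divide_strict_right_mono) auto
    also have "\<dots> = y k" unfolding sq y_def using rs by simp
    finally show ?thesis .
  qed
  have x_inc: "incseq x" by (rule incseq_SucI) (simp add: x_Suc)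
  have y_dec: "decseq y" by (rule decseq_SucI) (simp add: y_Suc less_imp_le)
  have xy: "x k \<le> y l" for k l
  proof -
    have "x k \<le> x (max k l)" using x_inc by (auto simp: incseq_def)
    also have "\<dots> \<le> y (max k l)" unfolding x_def y_def using rs by (intro divide_right_mono) auto
    also have "\<dots> \<le> y l" using y_dec by (auto simp: decseq_def)
    finally show ?thesis .
  qed
  have bdd: "bdd_above (range x)" by (rule bdd_aboveI[of _ "y 0"]) (use xy in auto)
  define \<xi> where "\<xi> = (SUP k. x k)"
  have "x k \<le> \<xi>" for k unfolding \<xi>_def by (rule cSUP_upper[OF _ bdd]) simp
  moreover have "\<xi> < y k" for k
  proof -
    have "\<xi> \<le> y (Suc k)" unfolding \<xi>_def by (rule cSUP_least) (use xy in auto)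
    then show ?thesis using y_Suc[of k] by linarith
  qed
  ultimately show ?thesis unfolding x_def y_def by blast
qed

text \<open>A fractional part of at least \<open>1 - 1 / s ^ l\<close> after \<open>n\<close> digits
  forces the next \<open>l\<close> digits to be \<open>s - 1\<close>, and these are digits of
  \<open>w\<close> because \<open>n + l \<le> m\<close>.\<close>

lemma frac_less_of_no_run:
  assumes s: "s \<ge> 2" and l: "l \<ge> 1" and w: "no_run s l w" and n: "n + l \<le> m"
    and \<xi>: "real w / real s ^ m \<le> \<xi>" "\<xi> < (real w + 1) / real s ^ m"
  shows "frac (real s ^ n * \<xi>) < 1 - 1 / real s ^ l"
proof (rule ccontr)
  assume "\<not> ?thesis"
  then have fr: "1 - 1 / real s ^ l \<le> frac (real s ^ n * \<xi>)" by simp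
  have rs: "real s \<ge> 2" using s by simp
  have \<xi>0: "0 \<le> \<xi>" using \<xi>(1) by (rule order.trans[rotated]) simp
  define F where "F = nat \<lfloor>real s ^ n * \<xi>\<rfloor>"
  have F: "real s ^ n * \<xi> = real F + frac (real s ^ n * \<xi>)"
    using \<xi>0 by (simp add: F_def frac_def)
  define i where "i = m - (n + l)"
  have m: "m = i + (l + n)" using n by (simp add: i_def)
  \<comment> \<open>Under the assumption to be refuted, this is the integer part of
    \<open>s ^ (l + n) * \<xi>\<close>, hence equal to \<open>w div s ^ i\<close>, and it ends in
    \<open>l\<close> digits \<open>s - 1\<close>.\<close>
  define z where "z = s ^ l * (F + 1) - 1"
  have z1: "z + 1 = s ^ l * (F + 1)" using s by (simp add: z_def)
  then have rz: "real z + 1 = real s ^ l * (real F + 1)"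
    by (metis of_nat_1 of_nat_add of_nat_mult of_nat_power)
  have sl: "real s ^ l > 0" using rs by simp
  have sn: "real s ^ (l + n) * \<xi> = real s ^ l * (real F + frac (real s ^ n * \<xi>))"
    using F by (simp add: power_add mult.assoc)
  have "real s ^ l * (1 - 1 / real s ^ l) \<le> real s ^ l * frac (real s ^ n * \<xi>)"
    using fr sl by (intro mult_left_mono) auto
  then have "real s ^ l - 1 \<le> real s ^ l * frac (real s ^ n * \<xi>)" using rs by (simp add: right_diff_distrib)
  then have za: "real z \<le> real s ^ (l + n) * \<xi>" using sn rz by (simp add: distrib_left)
  have "real s ^ l * frac (real s ^ n * \<xi>) < real s ^ l * 1"
    using sl frac_lt_1 by (intro mult_strict_left_mono) auto
  then have zb: "real s ^ (l + n) * \<xi> < real z + 1" using sn rz by (simp add: distrib_left)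
  have sm: "real s ^ m * \<xi> = real s ^ i * (real s ^ (l + n) * \<xi>)" by (simp add: m power_add)
  have w1: "real w \<le> real s ^ m * \<xi>" "real s ^ m * \<xi> < real w + 1"
    using \<xi> rs by (auto simp: field_simps)
  have "real s ^ i * real z \<le> real s ^ m * \<xi>" unfolding sm using za by (intro mult_left_mono) auto
  then have "real (s ^ i * z) < real (w + 1)" using w1 by simp
  then have a: "z * s ^ i \<le> w" by (simp only: of_nat_less_iff) (simp add: mult.commute)
  have "real s ^ m * \<xi> < real s ^ i * (real z + 1)" unfolding sm using zb rs by (intro mult_strict_left_mono) auto
  then have "real w < real s ^ i * (real z + 1)" using w1 by linarith
  also have "\<dots> = real (s ^ i * (z + 1))" by (simp add: distrib_left)
  finally have "real w < real (s ^ i * (z + 1))" .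
  then have b: "w < s ^ i * (z + 1)" by (simp only: of_nat_less_iff)
  have wz: "w div s ^ i = z"
    by (rule div_nat_eqI) (use a b in \<open>auto simp: mult.commute\<close>)
  obtain t where t: "t < l" "w div s ^ (i + t) mod s \<noteq> s - 1"
    using no_run_digit[OF s l w, of i] by blast
  define Y where "Y = s ^ (l - t - 1) * (F + 1)"
  have "s ^ l = s ^ t * (s * s ^ (l - t - 1))" using t by (simp flip: power_add power_Suc)
  then have zY: "z + 1 = s ^ t * (s * Y)" by (simp only: z1 Y_def mult.assoc)
  have Y: "Y \<ge> 1" using s by (simp add: Y_def Suc_le_eq)
  have zt: "z div s ^ t = s * Y - 1"
  proof (rule div_nat_eqI)
    have "1 \<le> s * Y" using Y s by simp
    then obtain y where y: "s * Y = Suc y" by (cases "s * Y") auto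
    have "z + 1 = s ^ t * y + s ^ t" using zY by (simp add: y)
    moreover have "1 \<le> s ^ t" using s by simp
    ultimately show "s ^ t * (s * Y - 1) \<le> z" using y by simp
    show "z < s ^ t * Suc (s * Y - 1)" using zY y by simp
  qed
  have "w div s ^ (i + t) mod s = (s * Y - 1) mod s"
    by (simp add: power_add div_mult2_eq wz zt)
  also have "\<dots> = (s * (Y - 1) + (s - 1)) mod s"
  proof -
    obtain y where y: "Y = Suc y" using Y by (cases Y) auto
    have "s * Y - 1 = s * (Y - 1) + (s - 1)" using s by (simp add: y)
    then show ?thesis by (simp only:)
  qed
  also have "\<dots> = (s - 1) mod s" by (rule mod_mult_self4)
  also have "\<dots> = s - 1" using s by simp
  finally show False using t by simp
qed

section \<open>Visits to intervals, counted by stages\<close>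

lemma card_nat_open_interval_le:
  fixes a b :: real
  assumes "a \<le> b"
  shows "finite {c::nat. a < real c \<and> real c < b}" "real (card {c::nat. a < real c \<and> real c < b}) \<le> b - a + 1"
proof -
  let ?A = "{c::nat. a < real c \<and> real c < b}"
  have sub: "int ` ?A \<subseteq> {\<lfloor>a\<rfloor> + 1..\<lceil>b\<rceil> - 1}" by (auto simp: floor_less_iff less_ceiling_iff) linarith+
  have fin: "finite (int ` ?A)" by (rule finite_subset[OF sub]) simp
  then show "finite ?A" by (simp add: finite_image_iff)
  have "card ?A = card (int ` ?A)" by (rule card_image[symmetric]) simp
  also have "\<dots> \<le> card {\<lfloor>a\<rfloor> + 1..\<lceil>b\<rceil> - 1}" by (rule card_mono[OF _ sub]) simp
  also have "\<dots> = nat (\<lceil>b\<rceil> - 1 - \<lfloor>a\<rfloor>)" by simp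
  finally have "int (card ?A) \<le> max 0 (\<lceil>b\<rceil> - 1 - \<lfloor>a\<rfloor>)" by simp
  then have "real (card ?A) \<le> max 0 (of_int (\<lceil>b\<rceil> - 1 - \<lfloor>a\<rfloor>))" by linarith
  also have "\<dots> \<le> b - a + 1" using assms by (auto simp: max_def) linarith
  finally show "real (card ?A) \<le> b - a + 1" .
qed

definition window :: "nat \<Rightarrow> nat \<Rightarrow> nat \<Rightarrow> nat set" where
  "window s r k = {nr s r (k ^ 2)..<nr s r (Suc k ^ 2)}"

definition hits :: "nat set \<Rightarrow> (nat \<Rightarrow> real) \<Rightarrow> real \<Rightarrow> real \<Rightarrow> nat" where
  "hits A x u v = card {n\<in>A. u \<le> x n \<and> x n < v}"

lemma hits_split:
  assumes "finite A" "u \<le> v" "v \<le> w"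
  shows "hits A x u w = hits A x u v + hits A x v w"
proof -
  have "{n\<in>A. u \<le> x n \<and> x n < w} = {n\<in>A. u \<le> x n \<and> x n < v} \<union> {n\<in>A. v \<le> x n \<and> x n < w}"
    using assms by auto
  then show ?thesis unfolding hits_def using assms(1)
    by (simp only:) (rule card_Un_disjoint, auto)
qed

lemma hits_Un:
  assumes "finite A" "finite B" "A \<inter> B = {}"
  shows "hits (A \<union> B) x u v = hits A x u v + hits B x u v"
proof -
  have "{n \<in> A \<union> B. u \<le> x n \<and> x n < v} = {n\<in>A. u \<le> x n \<and> x n < v} \<union> {n\<in>B. u \<le> x n \<and> x n < v}"
    by auto
  then show ?thesis unfolding hits_def using assms
    by (simp only:) (rule card_Un_disjoint, auto)
qed

text \<open>Upper bounds for all intervals yield lower bounds by taking complements.\<close>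

lemma hits_two_sided:
  assumes A: "finite A" and x: "\<And>n. 0 \<le> x n \<and> x n < (1::real)" and E: "0 \<le> E"
    and up: "\<And>u v. 0 \<le> u \<Longrightarrow> u < v \<Longrightarrow> v \<le> 1 \<Longrightarrow> real (hits A x u v) \<le> real (card A) * (v - u) + E"
    and uv: "0 \<le> u" "u < v" "v \<le> 1"
  shows "\<bar>real (hits A x u v) - real (card A) * (v - u)\<bar> \<le> 2 * E"
proof -
  have up': "real (hits A x a b) \<le> real (card A) * (b - a) + E" if "0 \<le> a" "a \<le> b" "b \<le> 1" for a b
  proof (cases "a = b")
    case True
    then have e: "{n\<in>A. a \<le> x n \<and> x n < b} = {}" by auto
    have "hits A x a b = 0" unfolding hits_def e by simp
    then show ?thesis using E True by simp
  next
    case False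
    then show ?thesis using up that by simp
  qed
  have "{n\<in>A. 0 \<le> x n \<and> x n < 1} = A" using x by auto
  then have "card A = hits A x 0 1" by (simp add: hits_def)
  also have "\<dots> = hits A x 0 u + (hits A x u v + hits A x v 1)"
    using A uv by (simp add: hits_split[of A 0 u 1] hits_split[of A u v 1])
  finally have "real (card A) = real (hits A x 0 u) + (real (hits A x u v) + real (hits A x v 1))"
    by (simp only: of_nat_add)
  moreover have "real (hits A x 0 u) \<le> real (card A) * u + E" using up'[of 0 u] uv by simp
  moreover have "real (hits A x v 1) \<le> real (card A) * (1 - v) + E" using up'[of v 1] uv by simp
  moreover have "real (hits A x u v) \<le> real (card A) * (v - u) + E" using up[OF uv] .
  ultimately show ?thesis using E by (simp add: algebra_simps abs_le_iff)
qed

text \<open>\<open>cell_ok\<close> concerns the truncation \<open>W / B\<close>, the claim concerns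
  \<open>\<xi>\<close>. Except for at most \<open>q\<close> exponents near the end of the window,
  the two orbits differ by less than the width of a cell, so visits to \<open>[u, v)\<close> come
  from the cells that meet a slightly enlarged interval.\<close>

lemma window_hits_le:
  assumes s: "s \<ge> 2" and r: "r \<ge> 2" and q: "q \<ge> 1" and ok: "cell_ok s k r q W"
    and \<xi>: "real W / real s ^ (Suc k ^ 2) \<le> \<xi>" "\<xi> < (real W + 1) / real s ^ (Suc k ^ 2)"
    and uv: "0 \<le> u" "u < v" "v \<le> (1::real)"
  defines "M \<equiv> real (card (window s r k))"
  shows "real (hits (window s r k) (\<lambda>n. frac (real r ^ n * \<xi>)) u v) \<le> M * (v - u) + (9 * M / real q + real q)"
proof -
  define B where "B = s ^ (Suc k ^ 2)"
  have B0: "B > 0" using s by (simp add: B_def)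
  have rq: "real q \<ge> 1" using q by simp
  let ?Win = "window s r k"
  have fin: "finite ?Win" by (simp add: window_def)
  have ltB: "r ^ n < B" if "n \<in> ?Win" for n
    using that less_nr_iff[OF r] by (auto simp: window_def B_def)
  define y where "y n = frac (real r ^ n * (real W / real B))" for n
  have y: "y n = real (r ^ n * W mod B) / real B" for n
  proof -
    have "real r ^ n * (real W / real B) = real (r ^ n * W) / real B" by simp
    then show ?thesis unfolding y_def by (simp only: frac_of_nat_divide)
  qed
  define cell where "cell c = {n\<in>?Win. real c \<le> real q * y n \<and> real q * y n < real c + 1}" for c
  have card_cell: "real q ^ 2 * real (card (cell c)) \<le> (real q + 1) * M" if c: "c < q" for c
  proof -
    have "cell c = {n. n < nr s r (Suc k ^ 2) \<and> (nr s r (k ^ 2) \<le> n \<and>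
         (c * B \<le> q * (r ^ n * W mod B) \<and> q * (r ^ n * W mod B) < Suc c * B))}"
      unfolding cell_def y window_def le_cell_iff[OF B0] cell_less_iff[OF B0] by auto
    moreover have "card ?Win = nr s r (Suc k ^ 2) - nr s r (k ^ 2)" by (simp add: window_def)
    ultimately have "q ^ 2 * card (cell c) \<le> Suc q * card ?Win"
      using ok c unfolding cell_ok_def B_def by (simp del: power_Suc)
    then have "real (q ^ 2 * card (cell c)) \<le> real (Suc q * card ?Win)" by (simp only: of_nat_le_iff)
    then show ?thesis by (simp add: M_def distrib_right add.commute)
  qed
  define E where "E = {n\<in>?Win. B < r ^ n * q}"
  have cardE: "card E \<le> q"
  proof (rule card_power_ratio_le[OF r])
    show "finite E" using fin by (simp add: E_def)
    fix n n' assume n: "n \<in> E" "n' \<in> E"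
    then have "r ^ n < B" using ltB by (simp add: E_def)
    also have "B < r ^ n' * q" using n by (simp add: E_def)
    also have "\<dots> \<le> r ^ n' * 2 ^ q" by (intro mult_left_mono less_imp_le[OF less_exp]) auto
    finally show "r ^ n < r ^ n' * 2 ^ q" .
  qed
  \<comment> \<open>One unit is lost to the truncation error and one to rounding down. The last cell
    is added separately below, since from there the error can carry a point across
    \<open>1\<close>.\<close>
  define C where "C = {c::nat. real q * u - 2 < real c \<and> real c < real q * v}"
  have quv: "real q * u - 2 \<le> real q * v"
    using mult_left_mono[of u v "real q"] uv by simp
  have finC: "finite C" and cardC: "real (card C) \<le> real q * (v - u) + 3"
    using card_nat_open_interval_le[OF quv] by (auto simp: C_def algebra_simps)
  have sub: "{n\<in>?Win. u \<le> frac (real r ^ n * \<xi>) \<and> frac (real r ^ n * \<xi>) < v} \<subseteq> E \<union> (\<Union>c\<in>(insert (q - 1) (C \<inter> {..<q})). cell c)"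
  proof
    fix n assume n: "n \<in> {n\<in>?Win. u \<le> frac (real r ^ n * \<xi>) \<and> frac (real r ^ n * \<xi>) < v}"
    show "n \<in> E \<union> (\<Union>c\<in>(insert (q - 1) (C \<inter> {..<q})). cell c)"
    proof (cases "n \<in> E")
      case False
      then have nE: "r ^ n * q \<le> B" using n by (auto simp: E_def)
      define e where "e = real r ^ n * (\<xi> - real W / real B)"
      have e0: "0 \<le> e" using \<xi>(1) by (simp add: e_def B_def)
      have e1: "real q * e < 1"
      proof -
        have "\<xi> - real W / real B < 1 / real B"
          using \<xi>(2) by (simp add: B_def add_divide_distrib)
        then have "real (r ^ n * q) * (\<xi> - real W / real B) < real (r ^ n * q) * (1 / real B)"
          using r q by (intro mult_strict_left_mono) auto
        also have "\<dots> \<le> real B * (1 / real B)"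
          using nE by (intro mult_right_mono) (simp_all only: of_nat_le_iff, simp)
        finally show ?thesis using B0 by (simp add: e_def mult_ac)
      qed
      have yb: "0 \<le> y n" "y n < 1" by (simp_all add: y_def frac_lt_1)
      define c where "c = nat \<lfloor>real q * y n\<rfloor>"
      have qy: "0 \<le> real q * y n" using yb by simp
      have cr: "real c \<le> real q * y n" "real q * y n < real c + 1"
        using qy unfolding c_def by linarith+
      have "real q * y n < real q * 1" using yb rq by (intro mult_strict_left_mono) auto
      then have cq: "c < q" using cr by simp
      have nc: "n \<in> cell c" using n cr by (simp add: cell_def)
      have eq: "real r ^ n * \<xi> = real r ^ n * (real W / real B) + e" by (simp add: e_def right_diff_distrib)
      have e_lt: "e < 1"
      proof -
        have "1 * e \<le> real q * e" using rq e0 by (intro mult_right_mono) auto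
        then show ?thesis using e1 by simp
      qed
      have "c \<in> insert (q - 1) (C \<inter> {..<q})"
      proof (cases "y n + e < 1")
        case True
        have "frac (real r ^ n * \<xi>) = y n + e"
        proof -
          have "real r ^ n * \<xi> - (y n + e) \<in> \<int>" by (simp add: eq y_def frac_def)
          then show ?thesis using True yb e0 by (simp add: frac_unique_iff)
        qed
        then have "u \<le> y n + e" "y n + e < v" using n by auto
        then have "real q * u \<le> real q * y n + real q * e" "real q * y n + real q * e < real q * v"
          using rq mult_left_mono[of u "y n + e" "real q"] mult_strict_left_mono[of "y n + e" v "real q"]
          by (simp_all add: distrib_left)
        moreover have "0 \<le> real q * e" using e0 by simp
        ultimately have "c \<in> C" unfolding C_def using cr e1 by simp
        then show ?thesis using cq by simp
      next
        case False
        then have "real q * 1 \<le> real q * (y n + e)" using rq by (intro mult_left_mono) auto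
        then have "real q < real c + 2" using cr e1 by (simp add: distrib_left)
        then have "c = q - 1" using cq by linarith
        then show ?thesis by simp
      qed
      then show ?thesis using nc by blast
    qed simp
  qed
  let ?I = "insert (q - 1) (C \<inter> {..<q})"
  have finI: "finite ?I" using finC by simp
  have "hits ?Win (\<lambda>n. frac (real r ^ n * \<xi>)) u v \<le> card (E \<union> (\<Union>c\<in>?I. cell c))"
    unfolding hits_def using fin finI by (intro card_mono[OF _ sub]) (auto simp: E_def cell_def)
  also have "\<dots> \<le> card E + card (\<Union>c\<in>?I. cell c)" by (rule card_Un_le)
  also have "\<dots> \<le> q + (\<Sum>c\<in>?I. card (cell c))"
    by (intro add_mono cardE card_UN_le finI)
  finally have "real (hits ?Win (\<lambda>n. frac (real r ^ n * \<xi>)) u v) \<le> real q + (\<Sum>c\<in>?I. real (card (cell c)))"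
    by (metis of_nat_add of_nat_le_iff of_nat_sum)
  also have "(\<Sum>c\<in>?I. real (card (cell c))) \<le> (\<Sum>c\<in>?I. (real q + 1) * M / real q ^ 2)"
  proof (rule sum_mono)
    fix c assume "c \<in> ?I"
    then have "c < q" using q by auto
    then show "real (card (cell c)) \<le> (real q + 1) * M / real q ^ 2"
      using card_cell[of c] rq by (simp add: pos_le_divide_eq mult.commute)
  qed
  also have "\<dots> = real (card ?I) * ((real q + 1) * M / real q ^ 2)" by simp
  also have "\<dots> \<le> (real q * (v - u) + 4) * ((real q + 1) * M / real q ^ 2)"
  proof (rule mult_right_mono)
    have "card ?I \<le> Suc (card C)"
      using card_insert_le_m1[of "Suc (card C)" "C \<inter> {..<q}" "q - 1"] card_mono[OF finC, of "C \<inter> {..<q}"] by simp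
    then show "real (card ?I) \<le> real q * (v - u) + 4" using cardC by linarith
  qed (simp add: M_def)
  also have "\<dots> = M * (v - u) + M * ((v - u) / real q + 4 / real q + 4 / real q ^ 2)"
    using rq by (simp add: field_simps power2_eq_square)
  also have "M * ((v - u) / real q + 4 / real q + 4 / real q ^ 2) \<le> M * (9 / real q)"
  proof (rule mult_left_mono)
    have "(v - u) / real q \<le> 1 / real q" using uv rq by (intro divide_right_mono) auto
    moreover have "4 / real q ^ 2 \<le> 4 / real q"
      using rq self_le_power[of "real q" 2] by (intro divide_left_mono) auto
    ultimately show "(v - u) / real q + 4 / real q + 4 / real q ^ 2 \<le> 9 / real q" by (simp add: field_simps)
  qed (simp add: M_def)
  finally show ?thesis by (simp add: mult.commute)
qed

lemma nr_0: "r \<ge> 2 \<Longrightarrow> nr s r 0 = 0"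
  by (simp add: nr_def)

text \<open>Stages before \<open>J\<close>, about which nothing is assumed, are charged with their
  full length.\<close>

lemma prefix_hits:
  assumes s: "s \<ge> 2" and r: "r \<ge> 2" and x: "\<And>n. 0 \<le> x n \<and> x n < (1::real)"
    and uv: "0 \<le> u" "u < v" "v \<le> 1" and JK: "J \<le> K"
    and E: "\<And>k. J \<le> k \<Longrightarrow> k < K \<Longrightarrow> \<bar>real (hits (window s r k) x u v) - real (card (window s r k)) * (v - u)\<bar> \<le> E k"
  shows "\<bar>real (hits {..<nr s r (K ^ 2)} x u v) - real (nr s r (K ^ 2)) * (v - u)\<bar> \<le> real (nr s r (J ^ 2)) + (\<Sum>k\<in>{J..<K}. E k)"
  using JK E
proof (induction K rule: dec_induct)
  case base
  have "hits {..<nr s r (J ^ 2)} x u v \<le> card {..<nr s r (J ^ 2)}"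
    unfolding hits_def by (rule card_mono) auto
  then have "real (hits {..<nr s r (J ^ 2)} x u v) \<le> real (nr s r (J ^ 2))" by simp
  moreover have "real (nr s r (J ^ 2)) * (v - u) \<le> real (nr s r (J ^ 2)) * 1"
    using uv by (intro mult_left_mono) auto
  moreover have "0 \<le> real (nr s r (J ^ 2)) * (v - u)" using uv by simp
  ultimately show ?case by simp
next
  case (step k)
  have mono: "nr s r (k ^ 2) \<le> nr s r (Suc k ^ 2)" by (rule nr_mono[OF s r]) (simp add: power_mono)
  have "hits {..<nr s r (Suc k ^ 2)} x u v = hits {..<nr s r (k ^ 2)} x u v + hits (window s r k) x u v"
  proof -
    have "{..<nr s r (Suc k ^ 2)} = {..<nr s r (k ^ 2)} \<union> window s r k"
      unfolding window_def using mono by (rule ivl_disj_un_one(2)[symmetric])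
    moreover have "{..<nr s r (k ^ 2)} \<inter> window s r k = {}" by (auto simp: window_def simp del: power_Suc)
    ultimately show ?thesis using hits_Un[of "{..<nr s r (k ^ 2)}" "window s r k"] by (simp only: window_def finite_lessThan finite_atLeastLessThan)
  qed
  moreover have "real (nr s r (Suc k ^ 2)) = real (nr s r (k ^ 2)) + real (card (window s r k))"
    using mono by (simp add: window_def of_nat_diff)
  ultimately have eq: "real (hits {..<nr s r (Suc k ^ 2)} x u v) - real (nr s r (Suc k ^ 2)) * (v - u)
      = (real (hits {..<nr s r (k ^ 2)} x u v) - real (nr s r (k ^ 2)) * (v - u))
        + (real (hits (window s r k) x u v) - real (card (window s r k)) * (v - u))"
    by (simp only: of_nat_add) (simp add: distrib_right)
  have IH: "\<bar>real (hits {..<nr s r (k ^ 2)} x u v) - real (nr s r (k ^ 2)) * (v - u)\<bar> \<le> real (nr s r (J ^ 2)) + (\<Sum>k\<in>{J..<k}. E k)"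
    by (rule step.IH) (use step.prems in auto)
  have Ek: "\<bar>real (hits (window s r k) x u v) - real (card (window s r k)) * (v - u)\<bar> \<le> E k"
    by (rule step.prems) (use step.hyps in auto)
  have "(\<Sum>k\<in>{J..<Suc k}. E k) = (\<Sum>k\<in>{J..<k}. E k) + E k" using step.hyps by simp
  then show ?case unfolding eq using IH Ek by linarith
qed

text \<open>\<open>nr s r A\<close> is the ceiling of the logarithm of \<open>s ^ A\<close> in base
  \<open>r\<close>.\<close>

lemma nr_bounds:
  assumes "s \<ge> 2" "r \<ge> 2"
  shows "real A * (ln s / ln r) \<le> real (nr s r A)" "real (nr s r A) \<le> real A * (ln s / ln r) + 1"
proof -
  have lr: "ln (real r) > 0" using assms by simp
  have ls: "ln (real s) > 0" using assms by simp
  have "s ^ A \<le> r ^ nr s r A" using less_nr_iff[OF assms(2), of "nr s r A" s A] by simp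
  then have "real (s ^ A) \<le> real (r ^ nr s r A)" by (simp only: of_nat_le_iff)
  then have "ln (real (s ^ A)) \<le> ln (real (r ^ nr s r A))" using assms by (subst ln_le_cancel_iff) auto
  then have "real A * ln s \<le> real (nr s r A) * ln r" using assms by (simp add: ln_realpow)
  then show "real A * (ln s / ln r) \<le> real (nr s r A)" using lr by (simp add: pos_divide_le_eq)
  show "real (nr s r A) \<le> real A * (ln s / ln r) + 1"
  proof (cases "nr s r A")
    case 0
    then show ?thesis using lr ls by simp
  next
    case (Suc n)
    then have "r ^ n < s ^ A" using less_nr_iff[OF assms(2), of n s A] by simp
    then have "real (r ^ n) < real (s ^ A)" by (simp only: of_nat_less_iff)
    then have "ln (real (r ^ n)) < ln (real (s ^ A))" using assms by (subst ln_less_cancel_iff) auto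
    then have "real n * ln r < real A * ln s" using assms by (simp add: ln_realpow)
    then have "real n \<le> real A * (ln s / ln r)" using lr by (simp add: pos_le_divide_eq)
    then show ?thesis using Suc by simp
  qed
qed

lemma sum_card_window_le:
  assumes s: "s \<ge> 2" and r: "r \<ge> 2" and "J \<le> K"
  shows "(\<Sum>k\<in>{J..<K}. card (window s r k)) \<le> nr s r (K ^ 2)"
  using assms(3)
proof (induction K rule: dec_induct)
  case (step k)
  have "nr s r (k ^ 2) \<le> nr s r (Suc k ^ 2)" by (rule nr_mono[OF s r]) (simp add: power_mono)
  then show ?case using step by (simp add: window_def)
qed simp

text \<open>Complete windows contribute their cell errors, where \<open>18 = 2 * 9\<close> comes
  from the passage to two-sided bounds. The stages before \<open>J\<close> and the unfinished last
  window are counted trivially; the latter has length of order \<open>K\<close> against a total of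
  order \<open>K ^ 2\<close>.\<close>

lemma discrepancy_fun_window_bound:
  fixes q W :: "nat \<Rightarrow> nat"
  assumes s: "s \<ge> 2" and r: "r \<ge> 2" and JK: "J \<le> K" and K: "K \<ge> 1" and Qf: "Qf \<ge> 1"
    and q: "\<And>k. J \<le> k \<Longrightarrow> k < K \<Longrightarrow> Qf \<le> q k \<and> q k \<le> V \<and> cell_ok s k r (q k) (W (Suc k))"
    and \<xi>: "\<And>k. real (W k) / real s ^ (k ^ 2) \<le> \<xi> \<and> \<xi> < (real (W k) + 1) / real s ^ (k ^ 2)"
    and N: "nr s r (K ^ 2) \<le> N" "N < nr s r (Suc K ^ 2)"
  defines "\<kappa> \<equiv> ln s / ln r"
  shows "discrepancy_fun r \<xi> N \<le> 18 / real Qf +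
    (real (nr s r (J ^ 2)) + 2 * real K * real V + (2 * real K + 1) * \<kappa> + 1) / (\<kappa> * real K ^ 2)"
proof -
  define x where "x n = frac (real r ^ n * \<xi>)" for n
  have x01: "0 \<le> x n \<and> x n < 1" for n by (simp add: x_def frac_lt_1)
  have \<kappa>: "\<kappa> > 0" using s r by (simp add: \<kappa>_def)
  let ?n = "nr s r (K ^ 2)"
  define R where "R = real (nr s r (J ^ 2)) + 2 * real K * real V + (2 * real K + 1) * \<kappa> + 1"
  have nK: "\<kappa> * real K ^ 2 \<le> real ?n" using nr_bounds(1)[OF s r, of "K ^ 2"] by (simp add: \<kappa>_def mult.commute)
  have pos: "0 < \<kappa> * real K ^ 2" using \<kappa> K by simp
  have N0: "0 < real N" using nK pos N by linarith
  have last: "real N - real ?n \<le> (2 * real K + 1) * \<kappa> + 1"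
  proof -
    have "real N \<le> real (nr s r (Suc K ^ 2))" using N by simp
    also have "\<dots> \<le> real (Suc K ^ 2) * \<kappa> + 1" using nr_bounds(2)[OF s r, of "Suc K ^ 2"] by (simp add: \<kappa>_def)
    also have "real (Suc K ^ 2) = real K ^ 2 + (2 * real K + 1)" by (simp add: power2_eq_square algebra_simps)
    finally show ?thesis using nK by (simp add: algebra_simps)
  qed
  have main: "\<bar>real (hits {..<N} x u v) - real N * (v - u)\<bar> \<le> 18 * real N / real Qf + R"
    if uv: "0 \<le> u" "u < v" "v \<le> 1" for u v
  proof -
    define E where "E k = 18 * real (card (window s r k)) / real Qf + 2 * real V" for k
    have Ek: "\<bar>real (hits (window s r k) x u v) - real (card (window s r k)) * (v - u)\<bar> \<le> E k"
      if k: "J \<le> k" "k < K" for k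
    proof -
      let ?M = "real (card (window s r k))"
      have qk: "Qf \<le> q k" "q k \<le> V" "cell_ok s k r (q k) (W (Suc k))" using q[OF k] by auto
      have "real (hits (window s r k) x u v) \<le> ?M * (v - u) + (9 * ?M / real (q k) + real (q k))"
        if "0 \<le> u" "u < v" "v \<le> 1" for u v
        unfolding x_def by (rule window_hits_le[OF s r _ qk(3)]) (use qk Qf \<xi>[of "Suc k"] that in auto)
      then have "\<bar>real (hits (window s r k) x u v) - ?M * (v - u)\<bar> \<le> 2 * (9 * ?M / real (q k) + real (q k))"
        by (intro hits_two_sided x01 uv) (auto simp: window_def)
      also have "\<dots> \<le> 2 * (9 * ?M / real Qf + real V)"
        using qk Qf by (intro mult_left_mono add_mono divide_left_mono) auto
      finally show ?thesis by (simp add: E_def)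
    qed
    have "\<bar>real (hits {..<?n} x u v) - real ?n * (v - u)\<bar> \<le> real (nr s r (J ^ 2)) + (\<Sum>k\<in>{J..<K}. E k)"
      by (rule prefix_hits[OF s r x01 uv JK Ek])
    also have "(\<Sum>k\<in>{J..<K}. E k) = 18 * real (\<Sum>k\<in>{J..<K}. card (window s r k)) / real Qf + 2 * real (K - J) * real V"
      unfolding E_def by (simp add: sum.distrib sum_divide_distrib sum_distrib_left)
    also have "18 * real (\<Sum>k\<in>{J..<K}. card (window s r k)) / real Qf \<le> 18 * real N / real Qf"
      using sum_card_window_le[OF s r JK] N(1) by (intro divide_right_mono mult_left_mono) (auto simp del: of_nat_sum)
    also have "2 * real (K - J) * real V \<le> 2 * real K * real V"
      by (intro mult_right_mono mult_left_mono) auto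
    finally have 1: "\<bar>real (hits {..<?n} x u v) - real ?n * (v - u)\<bar> \<le> real (nr s r (J ^ 2)) + (18 * real N / real Qf + 2 * real K * real V)"
      by simp
    have "hits {..<N} x u v = hits {..<?n} x u v + hits {?n..<N} x u v"
    proof -
      have "{..<N} = {..<?n} \<union> {?n..<N}" using N(1) by (rule ivl_disj_un_one(2)[symmetric])
      moreover have "{..<?n} \<inter> {?n..<N} = {}" by auto
      ultimately show ?thesis using hits_Un[of "{..<?n}" "{?n..<N}"] by (simp only: finite_lessThan finite_atLeastLessThan)
    qed
    moreover have "real N = real ?n + (real N - real ?n)" by simp
    ultimately have eq: "real (hits {..<N} x u v) - real N * (v - u) = (real (hits {..<?n} x u v) - real ?n * (v - u))
        + (real (hits {?n..<N} x u v) - (real N - real ?n) * (v - u))"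
      by (simp add: algebra_simps)
    have "hits {?n..<N} x u v \<le> card {?n..<N}" unfolding hits_def by (rule card_mono) auto
    then have "real (hits {?n..<N} x u v) \<le> real N - real ?n" using N by (simp add: of_nat_diff)
    moreover have "(real N - real ?n) * (v - u) \<le> (real N - real ?n) * 1" using uv N by (intro mult_left_mono) auto
    moreover have "0 \<le> (real N - real ?n) * (v - u)" using uv N by simp
    ultimately have 2: "\<bar>real (hits {?n..<N} x u v) - (real N - real ?n) * (v - u)\<bar> \<le> real N - real ?n"
      by simp
    show ?thesis unfolding eq R_def using 1 2 last by linarith
  qed
  have "discrepancy x N \<le> 18 / real Qf + R / (\<kappa> * real K ^ 2)"
  proof (rule discrepancy_le)
    fix u v :: real assume uv: "0 \<le> u" "u < v" "v \<le> 1"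
    have "{n. n < N \<and> u \<le> x n \<and> x n < v} = {n\<in>{..<N}. u \<le> x n \<and> x n < v}" by auto
    then have "\<bar>real (card {n. n < N \<and> u \<le> x n \<and> x n < v}) / real N - (v - u)\<bar>
        = \<bar>(real (hits {..<N} x u v) - real N * (v - u)) / real N\<bar>"
      using N0 by (simp add: hits_def diff_divide_distrib)
    also have "\<dots> = \<bar>real (hits {..<N} x u v) - real N * (v - u)\<bar> / real N" by simp
    also have "\<dots> \<le> (18 * real N / real Qf + R) / real N"
      by (intro divide_right_mono main uv) simp
    also have "\<dots> = 18 / real Qf + R / real N" using N0 by (simp add: add_divide_distrib)
    also have "R / real N \<le> R / (\<kappa> * real K ^ 2)"
      using pos nK N \<kappa> K N0 by (intro divide_left_mono mult_pos_pos) (auto simp: R_def)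
    finally show "\<bar>real (card {n. n < N \<and> u \<le> x n \<and> x n < v}) / real N - (v - u)\<bar> \<le> 18 / real Qf + R / (\<kappa> * real K ^ 2)"
      by simp
  qed
  then show ?thesis by (simp add: discrepancy_fun_def x_def[abs_def] R_def)
qed

text \<open>The windows tile the natural numbers, as \<open>nr s r 0 = 0\<close>, and each is
  finite, so all large \<open>N\<close> lie in late windows.\<close>

lemma eventually_from_windows:
  assumes s: "s \<ge> 2" and r: "r \<ge> 2"
    and P: "\<forall>\<^sub>F K in sequentially. \<forall>N. nr s r (K ^ 2) \<le> N \<and> N < nr s r (Suc K ^ 2) \<longrightarrow> P N"
  shows "\<forall>\<^sub>F N in sequentially. P N"
proof -
  obtain K0 where K0: "\<And>K N. K \<ge> K0 \<Longrightarrow> nr s r (K ^ 2) \<le> N \<Longrightarrow> N < nr s r (Suc K ^ 2) \<Longrightarrow> P N"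
    using P unfolding eventually_sequentially by blast
  show ?thesis
    using eventually_ge_at_top[of "nr s r (K0 ^ 2)"]
  proof eventually_elim
    case (elim N)
    have "\<exists>K. N < nr s r (Suc K ^ 2)"
    proof -
      have "N < r ^ N" using r by (simp add: power_gt_expt)
      have "r ^ N < s ^ (Suc (r ^ N) ^ 2)"
      proof -
        have "r ^ N < s ^ (r ^ N)" using s by (simp add: power_gt_expt)
        also have "\<dots> \<le> s ^ (Suc (r ^ N) ^ 2)" using s by (intro power_increasing) (auto simp: power2_eq_square)
        finally show ?thesis .
      qed
      then have "N < nr s r (Suc (r ^ N) ^ 2)" using less_nr_iff[OF r] by simp
      then show ?thesis by blast
    qed
    define K where "K = (LEAST K. N < nr s r (Suc K ^ 2))"
    have K: "N < nr s r (Suc K ^ 2)" unfolding K_def by (rule LeastI_ex) fact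
    have "nr s r (K ^ 2) \<le> N"
    proof (cases K)
      case 0
      then show ?thesis using nr_0[OF r] by simp
    next
      case (Suc K')
      then have "\<not> N < nr s r (Suc K' ^ 2)" using not_less_Least[of K' "\<lambda>K. N < nr s r (Suc K ^ 2)"] by (simp add: K_def)
      then show ?thesis using Suc by simp
    qed
    moreover have "K0 \<le> K"
    proof (rule ccontr)
      assume "\<not> K0 \<le> K"
      then have "nr s r (Suc K ^ 2) \<le> nr s r (K0 ^ 2)" by (intro nr_mono[OF s r] power_mono) auto
      with K elim show False by simp
    qed
    ultimately show ?case using K0 K by blast
  qed
qed

section \<open>Stages compared with the iterated logarithm\<close>

lemma eventually_poly_le_tower: "\<forall>\<^sub>F a in sequentially. c * (real a + 2) ^ 3 \<le> real (tower a)"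
proof -
  have "\<forall>\<^sub>F a in sequentially. c * (real a + 2) ^ 3 \<le> 2 ^ a" by real_asymp
  then show ?thesis
  proof eventually_elim
    case (elim a)
    have "(2::nat) ^ a \<le> 2 ^ (2 ^ a)" by (intro power_increasing less_imp_le[OF less_exp]) auto
    also have "\<dots> \<le> tower a" unfolding tower_def by (intro power_increasing less_imp_le[OF less_exp]) auto
    finally have le: "(2::nat) ^ a \<le> tower a" .
    have "(2::real) ^ a = real (2 ^ a)" by simp
    also have "\<dots> \<le> real (tower a)" using le by (simp only: of_nat_le_iff)
    finally show ?case using elim by linarith
  qed
qed

lemma eventually_itlog_poly_le: "\<forall>\<^sub>F k in sequentially. c * (real (itlog k) + 2) ^ 3 \<le> real k"
  using eventually_compose_filterlim[OF eventually_poly_le_tower[of c] filterlim_itlog] eventually_ge_at_top[of 4]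
proof eventually_elim
  case (elim k)
  have "real (tower (itlog k)) \<le> real k" using tower_itlog[OF elim(2)] by (simp only: of_nat_le_iff)
  with elim(1) show ?case by linarith
qed

text \<open>One step of \<open>tower\<close> squares the exponent \<open>E\<close>, while the fifth
  power only multiplies it by \<open>5 \<le> E\<close>.\<close>

lemma tower_power5_le:
  assumes "a \<ge> 2"
  shows "tower a ^ 5 \<le> tower (Suc a)"
proof -
  define E :: nat where "E = 2 ^ (2 ^ a)"
  have "(2::nat) ^ (2 ^ 2) \<le> E" unfolding E_def using assms by (intro power_increasing) auto
  then have "E * 5 \<le> E * E" by (intro mult_left_mono) auto
  then have le: "(2::nat) ^ (E * 5) \<le> 2 ^ (E * E)" by (rule power_increasing) simp
  have "tower a ^ 5 = 2 ^ (E * 5)" unfolding tower_def E_def power_mult ..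
  moreover have "tower (Suc a) = 2 ^ (E * E)" by (simp add: tower_def E_def mult_2 power_add)
  ultimately show ?thesis using le by (simp only:)
qed

text \<open>Positions \<open>N\<close> in the window of stage \<open>K\<close> are of order
  \<open>K ^ 2\<close>, hence eventually below \<open>K ^ 5\<close>. The iterated logarithm moves by
  at most \<open>1\<close> over this range, so a rate in terms of \<open>N\<close> can be compared
  with \<open>itlog K\<close>.\<close>

lemma itlog_power5_le:
  assumes "2 \<le> itlog k" "4 \<le> n" "n \<le> k ^ 5"
  shows "itlog n \<le> itlog k + 1"
proof (rule ccontr)
  assume "\<not> ?thesis"
  then have "tower (itlog k + 2) \<le> tower (itlog n)"
    using tower_strict_mono by (simp add: strict_mono_less_eq)
  also have "\<dots> \<le> n" by (rule tower_itlog[OF assms(2)])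
  also have "\<dots> \<le> k ^ 5" by (rule assms(3))
  also have "\<dots> < tower (itlog k + 1) ^ 5"
  proof (rule power_strict_mono)
    show "k < tower (itlog k + 1)"
    proof (rule ccontr)
      assume "\<not> k < tower (itlog k + 1)"
      then show False using itlog_ge[of "itlog k + 1" k] by simp
    qed
  qed auto
  also have "\<dots> \<le> tower (itlog k + 2)" using tower_power5_le[of "itlog k + 1"] assms(1) by simp
  finally show False by simp
qed

lemma small_enough_iff:
  assumes "0 \<le> q"
  shows "small_enough s (rat_encode q) T \<longleftrightarrow> real s ^ runlen T * real_of_rat q \<le> 1"
proof -
  obtain a b where ab: "quotient_of q = (a, b)" by fastforce
  have b: "b > 0" using ab quotient_of_denom_pos by blast
  have qab: "q = of_int a / of_int b" using quotient_of_div[OF ab] .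
  have a: "a \<ge> 0" using assms b unfolding qab by (simp add: zero_le_divide_iff)
  have enc: "rat_encode q = prod_encode (2 * nat a, nat b)"
    using a by (simp add: rat_encode_def ab int_encode_def sum_encode_def)
  have "real_of_rat q = real (nat a) / real (nat b)" using a b by (simp add: qab of_rat_divide)
  then have iff: "real s ^ runlen T * real_of_rat q \<le> 1 \<longleftrightarrow> s ^ runlen T * nat a \<le> nat b"
  proof -
    assume q: "real_of_rat q = real (nat a) / real (nat b)"
    have "real s ^ runlen T * real_of_rat q \<le> 1 \<longleftrightarrow> real (s ^ runlen T * nat a) \<le> real (nat b)"
      unfolding q using b by (simp add: pos_divide_le_eq)
    then show ?thesis by (simp only: of_nat_le_iff)
  qed
  show ?thesis
  proof
    assume "small_enough s (rat_encode q) T"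
    then obtain a' b' where "prod_encode (2 * nat a, nat b) = prod_encode (2 * a', b')" "s ^ runlen T * a' \<le> b'"
      unfolding small_enough_def enc by blast
    then show "real s ^ runlen T * real_of_rat q \<le> 1" unfolding iff by (simp add: prod_encode_eq)
  next
    assume "real s ^ runlen T * real_of_rat q \<le> 1"
    then have "s ^ runlen T * nat a \<le> nat b" unfolding iff .
    moreover have "nat a < Suc (rat_encode q)" "nat b < Suc (rat_encode q)"
      unfolding enc using le_prod_encode_1[of "2 * nat a" "nat b"] le_prod_encode_2[of "nat b" "2 * nat a"] by auto
    ultimately show "small_enough s (rat_encode q) T" unfolding small_enough_def enc by blast
  qed
qed

lemma mult_independent_powers:
  assumes "r \<ge> 2" "s \<ge> 2" "mult_independent r s"
  shows "r ^ Suc a \<noteq> s ^ Suc b"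
proof
  assume eq: "r ^ Suc a = s ^ Suc b"
  have "real r ^ Suc a = real s ^ Suc b" using eq by (metis of_nat_power)
  then have "real r powr real (Suc a) = real s powr real (Suc b)"
    using assms by (simp only: powr_realpow of_nat_0_less_iff)
  then have "(real r powr real (Suc a)) powr (1 / real (Suc a)) = (real s powr real (Suc b)) powr (1 / real (Suc a))"
    by (rule arg_cong)
  then have "real r = real s powr (real (Suc b) / real (Suc a))"
    using assms by (simp add: powr_powr)
  moreover have "real_of_rat (of_nat (Suc b) / of_nat (Suc a)) = real (Suc b) / real (Suc a)"
    by (simp only: of_rat_divide of_rat_of_nat_eq)
  ultimately have "mult_dependent r s" unfolding mult_dependent_def by metis
  with assms(3) show False by (simp add: mult_independent_def)
qed

section \<open>Main theorem\<close>

lemma decseq_inverse_itlog: "decreasing_to_0 (\<lambda>n. 1 / of_nat (1 + itlog n))"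
  unfolding decreasing_to_0_def
proof
  show "decseq (\<lambda>n. 1 / of_nat (1 + itlog n) :: rat)"
    unfolding decseq_def
  proof (intro allI impI)
    fix m n :: nat assume "m \<le> n"
    then have "itlog m \<le> itlog n" using itlog_mono by (simp add: mono_def)
    then show "1 / of_nat (1 + itlog n) \<le> (1 / of_nat (1 + itlog m) :: rat)"
      by (intro divide_left_mono) (auto intro: add_pos_nonneg mult_pos_pos)
  qed
  have "(\<lambda>a::nat. 1 / (1 + real a)) \<longlonglongrightarrow> 0" by real_asymp
  from filterlim_compose[OF this filterlim_itlog]
  show "(\<lambda>n. real_of_rat (1 / of_nat (1 + itlog n))) \<longlonglongrightarrow> 0"
    by (simp add: of_rat_divide of_rat_add)
qed

locale construction =
  fixes s :: nat and g :: "nat \<Rightarrow> rat"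
  assumes s: "s \<ge> 2" and g: "decreasing_to_0 g"
begin

definition G :: "nat \<Rightarrow> nat" where "G n = rat_encode (g n)"
definition W :: "nat \<Rightarrow> nat" where "W = wseq s G"
definition T :: "nat \<Rightarrow> nat" where "T k = level s (G k) k (W k)"
definition e :: "nat \<Rightarrow> nat" where "e k = extension s (G k) k (W k)"

lemma g_dec: "m \<le> n \<Longrightarrow> real_of_rat (g n) \<le> real_of_rat (g m)"
  using g unfolding decreasing_to_0_def decseq_def by (simp add: of_rat_less_eq)

lemma g_lim: "(\<lambda>n. real_of_rat (g n)) \<longlonglongrightarrow> 0"
  using g by (simp add: decreasing_to_0_def)

lemma g_nonneg: "0 \<le> g n"
proof -
  have "0 \<le> real_of_rat (g n)" by (rule decseq_ge[OF _ g_lim]) (simp add: decseq_def g_dec)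
  then show ?thesis by simp
qed

lemma W_Suc: "W (Suc k) = W k * s ^ (2 * k + 1) + e k"
  by (simp add: W_def wseq_def e_def)

lemma W_0: "W 0 = 0"
  by (simp add: W_def wseq_def)

lemma T_le: "T k \<le> itlog k"
  unfolding T_def level_def by (rule bmax_le)

lemma T_admissible: "T k \<noteq> 0 \<Longrightarrow> admissible s (G k) k (W k) (T k)"
  unfolding T_def level_def by (rule bmax_sat)

lemma good_e: "T k \<noteq> 0 \<Longrightarrow> good s k (W k) (T k) (e k) \<and> e k < s ^ (2 * k)"
proof -
  assume T: "T k \<noteq> 0"
  then have "\<exists>v<s ^ (2 * k). good s k (W k) (T k) v"
    using T_admissible unfolding admissible_def by blast
  from bleast_sat[OF this] T show ?thesis
    by (simp add: e_def extension_def T_def)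
qed

lemma e_0: "T k = 0 \<Longrightarrow> e k = 0"
  by (simp add: e_def extension_def T_def)

lemma e_less: "e k < s ^ (2 * k)"
  using good_e[of k] e_0[of k] s by (cases "T k = 0") auto

text \<open>Each fixed level becomes admissible: \<open>g\<close> tends to \<open>0\<close>, good
  blocks exist from some stage on whatever the prefix, and \<open>itlog\<close> passes every
  bound.\<close>

lemma T_eventually_ge: "\<forall>\<^sub>F k in sequentially. t \<le> T k"
proof -
  define t' where "t' = max 1 t"
  have "(\<lambda>k. real s ^ runlen t' * real_of_rat (g k)) \<longlonglongrightarrow> real s ^ runlen t' * 0"
    by (intro tendsto_mult tendsto_const g_lim)
  then have "\<forall>\<^sub>F k in sequentially. real s ^ runlen t' * real_of_rat (g k) < 1"
    by (rule order_tendstoD) simp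
  moreover have "\<forall>\<^sub>F k in sequentially. \<forall>w. \<exists>v<s ^ (2 * k). good s k w t' v"
    by (rule eventually_good[OF s]) (simp add: t'_def)
  moreover have "\<forall>\<^sub>F k in sequentially. t' \<le> itlog k"
    using filterlim_itlog by (simp add: filterlim_at_top)
  ultimately show ?thesis
  proof eventually_elim
    case (elim k)
    have "admissible s (G k) k (W k) t'"
      unfolding admissible_def G_def using elim by (auto simp: small_enough_iff[OF g_nonneg] t'_def)
    then have "t' \<le> T k" unfolding T_def level_def by (rule bmax_ge) (rule elim)
    then show ?case by (simp add: t'_def)
  qed
qed

definition \<xi> :: real where
  "\<xi> = (SOME \<xi>. \<forall>k. real (W k) / real s ^ (k ^ 2) \<le> \<xi> \<and> \<xi> < (real (W k) + 1) / real s ^ (k ^ 2))"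

lemma \<xi>: "real (W k) / real s ^ (k ^ 2) \<le> \<xi> \<and> \<xi> < (real (W k) + 1) / real s ^ (k ^ 2)"
  unfolding \<xi>_def using someI_ex[OF digits_limit[OF s W_Suc e_less]] by blast

lemma real_computable_\<xi>: "real_computable_from g \<xi>"
proof (rule real_computable_from_wseq[OF s])
  fix k
  have "W = wseq s (\<lambda>n. rat_encode (g n))" by (simp add: W_def G_def[abs_def])
  then show "\<bar>\<xi> - real (wseq s (\<lambda>n. rat_encode (g n)) k) / real s ^ (k ^ 2)\<bar> \<le> 1 / real s ^ (k ^ 2)"
    using \<xi>[of k] by (simp add: add_divide_distrib)
qed

text \<open>The levels need not be monotone, so the invariant carries the longest run length
  \<open>l\<close> used so far. A constraint \<open>s ^ l * g k \<le> 1\<close> survives later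
  stages because \<open>g\<close> decreases; the alternative \<open>l = runlen 0\<close> is the
  starting value. The bound by \<open>runlen (itlog k)\<close> keeps \<open>l\<close> small against
  \<open>k\<close>.\<close>

lemma no_run_W:
  "\<exists>l\<ge>1. no_run s l (W k) \<and> l \<le> runlen (itlog k) \<and> (l = runlen 0 \<or> real s ^ l * real_of_rat (g k) \<le> 1)"
proof (induction k)
  case 0
  have "runlen 0 \<ge> 1" "runlen 0 \<le> runlen (itlog 0)" by (simp_all add: runlen_def uexp_def)
  then show ?case using no_run_0[OF s] W_0 by metis
next
  case (Suc k)
  then obtain l where l: "l \<ge> 1" "no_run s l (W k)" "l \<le> runlen (itlog k)"
    "l = runlen 0 \<or> real s ^ l * real_of_rat (g k) \<le> 1" by blast
  have rl_mono: "runlen a \<le> runlen b" if "a \<le> b" for a b using that by (simp add: runlen_def uexp_def)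
  have it: "itlog k \<le> itlog (Suc k)" using itlog_mono by (simp add: mono_def)
  define l' where "l' = (if T k = 0 then l else max l (runlen (T k)))"
  have ll': "l \<le> l'" by (simp add: l'_def)
  have e: "no_run s l' (e k)"
  proof (cases "T k = 0")
    case True
    then show ?thesis using no_run_0[OF s l(1)] e_0 by (simp add: l'_def)
  next
    case False
    then have "no_run s (runlen (T k)) (e k)" using good_e by (simp add: good_def)
    then show ?thesis by (rule no_run_mono) (simp add: l'_def False)
  qed
  have "no_run s l' (W (Suc k))"
    using no_run_append[OF s _ e_less no_run_mono[OF l(2) ll'] e] l(1) ll' by (simp add: W_Suc)
  moreover have "l' \<le> runlen (itlog (Suc k))"
  proof -
    have "runlen (T k) \<le> runlen (itlog k)" by (rule rl_mono[OF T_le])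
    then have "l' \<le> runlen (itlog k)" using l(3) by (simp add: l'_def)
    also have "\<dots> \<le> runlen (itlog (Suc k))" by (rule rl_mono[OF it])
    finally show ?thesis .
  qed
  moreover have "l' = runlen 0 \<or> real s ^ l' * real_of_rat (g (Suc k)) \<le> 1"
  proof -
    have "real s ^ l * real_of_rat (g (Suc k)) \<le> 1" if "real s ^ l * real_of_rat (g k) \<le> 1" for l
    proof -
      have "real s ^ l * real_of_rat (g (Suc k)) \<le> real s ^ l * real_of_rat (g k)"
        by (intro mult_left_mono g_dec) auto
      with that show ?thesis by simp
    qed
    moreover have "real s ^ runlen (T k) * real_of_rat (g k) \<le> 1" if "T k \<noteq> 0"
      using T_admissible[OF that] small_enough_iff[OF g_nonneg] by (simp add: admissible_def G_def)
    ultimately show ?thesis using l(4) unfolding l'_def max_def by auto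
  qed
  moreover have "1 \<le> l'" using l(1) ll' by simp
  ultimately show ?case by blast
qed

text \<open>\<open>W N\<close> supplies \<open>N ^ 2 \<ge> N + l\<close> digits without a run of
  length \<open>l\<close>, so the first \<open>N\<close> points of the orbit in base
  \<open>s\<close> miss an interval of length \<open>1 / s ^ l \<ge> g N\<close> next to
  \<open>1\<close>.\<close>

lemma dominates_g: "eventually_dominates (discrepancy_fun s \<xi>) (\<lambda>N. real_of_rat (g N))"
  unfolding eventually_dominates_def
proof -
  have "\<forall>\<^sub>F N in sequentially. real s ^ runlen 0 * real_of_rat (g N) < 1"
  proof (rule order_tendstoD)
    show "(\<lambda>N. real s ^ runlen 0 * real_of_rat (g N)) \<longlonglongrightarrow> real s ^ runlen 0 * 0"
      by (intro tendsto_mult tendsto_const g_lim)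
  qed simp
  moreover have "\<forall>\<^sub>F N in sequentially. 240 * (real (itlog N) + 2) ^ 3 \<le> real N"
    by (rule eventually_itlog_poly_le)
  moreover have "\<forall>\<^sub>F N in sequentially. 2 \<le> (N::nat)" by (rule eventually_ge_at_top)
  ultimately show "\<forall>\<^sub>F N in sequentially. real_of_rat (g N) \<le> discrepancy_fun s \<xi> N"
  proof eventually_elim
    case (elim N)
    obtain l where l: "l \<ge> 1" "no_run s l (W N)" "l \<le> runlen (itlog N)"
      "l = runlen 0 \<or> real s ^ l * real_of_rat (g N) \<le> 1" using no_run_W by blast
    have lg: "real s ^ l * real_of_rat (g N) \<le> 1" using l(4) elim(1) by auto
    have sl: "real s ^ l \<ge> 1" using s by (intro one_le_power) simp
    have "real (runlen (itlog N)) \<le> 240 * (real (itlog N) + 2) ^ 1" by (simp add: runlen_def uexp_def)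
    also have "\<dots> \<le> 240 * (real (itlog N) + 2) ^ 3" by (intro mult_left_mono power_increasing) auto
    finally have "l \<le> N" using l(3) elim(2) by linarith
    then have lN: "N + l \<le> N ^ 2" using elim(3) by (simp add: power2_eq_square) (metis add_mono le_refl le_trans mult_2 mult_le_mono1)
    have "real_of_rat (g N) \<le> 1 / real s ^ l" using lg s by (simp add: pos_le_divide_eq mult.commute)
    also have "\<dots> \<le> discrepancy_fun s \<xi> N"
      unfolding discrepancy_fun_def
    proof (rule discrepancy_ge_gap)
      fix n assume "n < N"
      then have "n + l \<le> N ^ 2" using lN by simp
      then show "frac (real s ^ n * \<xi>) < 1 - 1 / real s ^ l"
        using frac_less_of_no_run[OF s l(1,2)] \<xi>[of N] by blast
    next
      show "1 \<le> N" using elim(3) by linarith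
      show "0 < 1 / real s ^ l" using s by simp
      show "1 / real s ^ l \<le> 1" using frac_le[of 1 1 1 "real s ^ l"] sl by simp
    qed
    finally show ?case .
  qed
qed

lemma cell_ok_T: "2 \<le> r \<Longrightarrow> r \<le> T k \<Longrightarrow> cell_ok s k r (T k) (W (Suc k))"
  using good_e[of k] by (simp add: good_def W_Suc)

lemma cell_ok_independent:
  "2 \<le> r \<Longrightarrow> r \<le> T k \<Longrightarrow> mult_independent r s \<Longrightarrow> cell_ok s k r ((itlog k + 2) ^ 2) (W (Suc k))"
  using good_e[of k] mult_independent_powers[of r s] s
  by (simp add: good_def W_Suc seems_independent_def del: power_Suc)

text \<open>From some stage on the precision \<open>T k\<close> exceeds any given \<open>Qf\<close>.
  Its upper bound by \<open>itlog\<close> keeps the additive errors \<open>q\<close> of all windows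
  together negligible against \<open>K ^ 2\<close>.\<close>

lemma absolutely_normal_\<xi>: "absolutely_normal \<xi>"
  unfolding absolutely_normal_def normal_to_base_def is_base_def
proof (intro allI impI)
  fix r :: nat assume r: "2 \<le> r"
  define \<kappa> where "\<kappa> = ln (real s) / ln (real r)"
  have \<kappa>: "\<kappa> > 0" using s r by (simp add: \<kappa>_def)
  show "discrepancy_fun r \<xi> \<longlonglongrightarrow> 0"
  proof (rule tendstoI)
    fix \<epsilon> :: real assume \<epsilon>: "\<epsilon> > 0"
    obtain Qf :: nat where Qf: "36 / \<epsilon> < real Qf" using reals_Archimedean2 by blast
    have "0 < 36 / \<epsilon>" using \<epsilon> by simp
    then have Qf1: "Qf \<ge> 1" using Qf by (cases Qf) auto
    have QfE: "18 / real Qf < \<epsilon> / 2" using Qf \<epsilon> Qf1 by (simp add: field_simps)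
    obtain J where J: "\<And>k. k \<ge> J \<Longrightarrow> max Qf r \<le> T k"
      using T_eventually_ge[of "max Qf r"] unfolding eventually_sequentially by blast
    define c where "c = 8 / (\<kappa> * \<epsilon>)"
    have c: "c > 0" using \<kappa> \<epsilon> by (simp add: c_def)
    define A where "A = real (nr s r (J ^ 2))"
    have small: "\<forall>\<^sub>F K in sequentially. (A + (2 * real K + 1) * \<kappa> + 1) / (\<kappa> * real K ^ 2) < \<epsilon> / 4"
      using \<kappa> \<epsilon> by real_asymp
    have "\<forall>\<^sub>F N in sequentially. discrepancy_fun r \<xi> N < \<epsilon>"
    proof (rule eventually_from_windows[OF s r])
      show "\<forall>\<^sub>F K in sequentially. \<forall>N. nr s r (K ^ 2) \<le> N \<and> N < nr s r (Suc K ^ 2) \<longrightarrow> discrepancy_fun r \<xi> N < \<epsilon>"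
        using small eventually_itlog_poly_le[of c] eventually_ge_at_top[of "max J 1"]
      proof eventually_elim
        case (elim K)
        show ?case
        proof (intro allI impI)
          fix N assume N: "nr s r (K ^ 2) \<le> N \<and> N < nr s r (Suc K ^ 2)"
          define V where "V = (itlog K + 2) ^ 2"
          have K: "J \<le> K" "1 \<le> K" using elim(3) by auto
          have "discrepancy_fun r \<xi> N \<le> 18 / real Qf + (A + 2 * real K * real V + (2 * real K + 1) * \<kappa> + 1) / (\<kappa> * real K ^ 2)"
            unfolding A_def \<kappa>_def
          proof (rule discrepancy_fun_window_bound[OF s r K Qf1, where q = T and W = W])
            fix k assume k: "J \<le> k" "k < K"
            have "T k \<le> itlog K" using T_le[of k] itlog_mono k by (meson le_trans less_imp_le monoD)
            also have "\<dots> \<le> V" by (simp add: V_def power2_eq_square)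
            finally show "Qf \<le> T k \<and> T k \<le> V \<and> cell_ok s k r (T k) (W (Suc k))"
              using J[OF k(1)] cell_ok_T[OF r, of k] by simp
          qed (use \<xi> N in auto)
          also have "\<dots> = 18 / real Qf + ((A + (2 * real K + 1) * \<kappa> + 1) / (\<kappa> * real K ^ 2) + 2 * real V / (\<kappa> * real K))"
            using K \<kappa> by (simp add: field_simps power2_eq_square)
          also have "2 * real V / (\<kappa> * real K) \<le> \<epsilon> / 4"
          proof -
            have "real V = (real (itlog K) + 2) ^ 2" by (simp add: V_def add.commute)
            also have "\<dots> \<le> (real (itlog K) + 2) ^ 3" by (intro power_increasing) auto
            finally have "c * real V \<le> c * (real (itlog K) + 2) ^ 3" using c by (intro mult_left_mono) auto
            then have "c * real V \<le> real K" using elim(2) by linarith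
            then have "8 * real V \<le> \<kappa> * \<epsilon> * real K" using \<kappa> \<epsilon> by (simp add: c_def field_simps)
            then show ?thesis using K \<kappa> by (simp add: field_simps)
          qed
          finally show "discrepancy_fun r \<xi> N < \<epsilon>" using QfE elim(1) by linarith
        qed
      qed
    qed
    then show "\<forall>\<^sub>F N in sequentially. dist (discrepancy_fun r \<xi> N) 0 < \<epsilon>"
      by (rule eventually_mono) (simp add: discrepancy_fun_def discrepancy_nonneg)
  qed
qed

text \<open>With \<open>P = itlog K\<close>, the rate is at least \<open>1 / (P + 2)\<close> on the
  window of stage \<open>K\<close>. Half of it covers the cell errors, of order
  \<open>1 / P ^ 2\<close>, the other half the remaining terms, of order
  \<open>P ^ 2 / K\<close>.\<close>

lemma dominated_by_inverse_itlog:
  assumes r: "r \<ge> 2" and ind: "mult_independent r s"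
  shows "eventually_dominates (\<lambda>N. real_of_rat (1 / of_nat (1 + itlog N))) (discrepancy_fun r \<xi>)"
  unfolding eventually_dominates_def
proof (rule eventually_from_windows[OF s r])
  define \<kappa> where "\<kappa> = ln (real s) / ln (real r)"
  have \<kappa>: "\<kappa> > 0" using s r by (simp add: \<kappa>_def)
  obtain k0 where k0: "\<And>k. k \<ge> k0 \<Longrightarrow> r \<le> T k"
    using T_eventually_ge[of r] unfolding eventually_sequentially by blast
  define c where "c = 2 * (4 + 4 / \<kappa>)"
  \<comment> \<open>The bound \<open>40\<close> yields
    \<open>36 * (P + 2) \<le> (P + 1) ^ 2\<close>; the bound \<open>k0 + 1\<close> ensures that base
    \<open>r\<close> is tested at all stages from \<open>J\<close> on.\<close>
  have a1: "\<forall>\<^sub>F K in sequentially. max 40 (k0 + 1) \<le> itlog K"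
    using filterlim_itlog by (simp add: filterlim_at_top)
  have a2: "\<forall>\<^sub>F K in sequentially. 4 \<le> \<kappa> * real K ^ 2" using \<kappa> by real_asymp
  have a3: "\<forall>\<^sub>F K in sequentially. (real K + 1) ^ 2 * \<kappa> + 1 \<le> real K ^ 5" using \<kappa> by real_asymp
  show "\<forall>\<^sub>F K in sequentially. \<forall>N. nr s r (K ^ 2) \<le> N \<and> N < nr s r (Suc K ^ 2) \<longrightarrow>
      discrepancy_fun r \<xi> N \<le> real_of_rat (1 / of_nat (1 + itlog N))"
    using a1 a2 a3 eventually_itlog_poly_le[of c] eventually_ge_at_top[of 4]
  proof eventually_elim
    case (elim K)
    show ?case
    proof (intro allI impI)
      fix N assume N: "nr s r (K ^ 2) \<le> N \<and> N < nr s r (Suc K ^ 2)"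
      define P where "P = itlog K"
      \<comment> \<open>From this stage on \<open>itlog\<close> is at least \<open>P - 1\<close>, so
        the precision is at most one step behind, while \<open>J ^ 2 \<le> K\<close> limits the
        earlier stages to order \<open>K\<close> of about \<open>K ^ 2\<close> positions.\<close>
      define J where "J = tower (P - 1)"
      define V where "V = (P + 2) ^ 2"
      have P: "40 \<le> P" "k0 + 1 \<le> P" using elim(1) by (auto simp: P_def)
      have J5: "J ^ 5 \<le> K"
      proof -
        have "J ^ 5 \<le> tower (Suc (P - 1))" unfolding J_def by (rule tower_power5_le) (use P in simp)
        also have "\<dots> \<le> K" using tower_itlog[of K] elim(5) P by (simp add: P_def)
        finally show ?thesis .
      qed
      have J1: "1 \<le> J" by (simp add: J_def tower_def)
      have J2: "J ^ 2 \<le> K" using power_increasing[of 2 5 J] J1 J5 by simp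
      have JK: "J \<le> K" using power_increasing[of 1 5 J] J1 J5 by simp
      have Jk0: "k0 \<le> J"
      proof -
        have "k0 \<le> P - 1" using P by simp
        also have "\<dots> \<le> J" unfolding J_def by (rule strict_mono_imp_increasing[OF tower_strict_mono])
        finally show ?thesis .
      qed
      have K1: "1 \<le> K" using elim(5) by simp
      have "discrepancy_fun r \<xi> N \<le> 18 / real ((P + 1) ^ 2) +
          (real (nr s r (J ^ 2)) + 2 * real K * real V + (2 * real K + 1) * \<kappa> + 1) / (\<kappa> * real K ^ 2)"
        unfolding \<kappa>_def
      proof (rule discrepancy_fun_window_bound[OF s r JK K1, where q = "\<lambda>k. (itlog k + 2) ^ 2" and W = W])
        fix k assume k: "J \<le> k" "k < K"
        have "P - 1 \<le> itlog k" by (rule itlog_ge) (use k in \<open>simp add: J_def\<close>)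
        then have "(P + 1) ^ 2 \<le> (itlog k + 2) ^ 2" using P by (intro power_mono) auto
        moreover have "itlog k \<le> P" unfolding P_def using itlog_mono k by (simp add: monoD)
        then have "(itlog k + 2) ^ 2 \<le> V" unfolding V_def by (intro power_mono) auto
        moreover have "r \<le> T k" using k0 Jk0 k by simp
        then have "cell_ok s k r ((itlog k + 2) ^ 2) (W (Suc k))" by (rule cell_ok_independent[OF r _ ind])
        ultimately show "(P + 1) ^ 2 \<le> (itlog k + 2) ^ 2 \<and> (itlog k + 2) ^ 2 \<le> V \<and> cell_ok s k r ((itlog k + 2) ^ 2) (W (Suc k))"
          by blast
      qed (use \<xi> N in auto)
      also have "18 / real ((P + 1) ^ 2) \<le> 1 / (2 * (real P + 2))"
      proof -
        have "36 * (real P + 2) \<le> (real P + 1) ^ 2"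
        proof -
          have P40: "40 \<le> real P" using P by simp
          define y where "y = (real P + 1) ^ 2"
          have "(40 - 1 + 2) * (real P + 1) \<le> (real P + 1) * (real P + 1)" using P40 by (intro mult_right_mono) auto
          then have "41 * (real P + 1) \<le> y" by (simp add: y_def power2_eq_square)
          moreover have "36 * (real P + 2) \<le> 41 * (real P + 1)" using P40 by (simp add: algebra_simps)
          ultimately have "36 * (real P + 2) \<le> y" by (rule order.trans[rotated])
          then show ?thesis by (simp only: y_def)
        qed
        moreover have "real ((P + 1) ^ 2) = (real P + 1) ^ 2" by (simp add: add.commute)
        moreover have "0 < (real P + 1) ^ 2" by simp
        ultimately show ?thesis by (simp only:) (simp add: frac_le_eq divide_simps)
      qed
      also have "(real (nr s r (J ^ 2)) + 2 * real K * real V + (2 * real K + 1) * \<kappa> + 1) / (\<kappa> * real K ^ 2)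
          \<le> (real K * real V * (4 * \<kappa> + 4)) / (\<kappa> * real K ^ 2)"
      proof (rule divide_right_mono)
        have "real (nr s r (J ^ 2)) \<le> real (J ^ 2) * \<kappa> + 1"
          using nr_bounds(2)[OF s r, of "J ^ 2"] by (simp add: \<kappa>_def)
        also have "\<dots> \<le> real K * \<kappa> + 1" using J2 \<kappa> by (intro add_right_mono mult_right_mono) (auto simp del: of_nat_power)
        finally have n: "real (nr s r (J ^ 2)) \<le> real K * \<kappa> + 1" .
        define X where "X = real K * real V"
        have V1: "1 \<le> V" by (simp add: V_def)
        have KX: "real K \<le> X" unfolding X_def using V1 mult_left_mono[of 1 "real V" "real K"] by simp
        have X1: "1 \<le> X" using KX K1 by linarith
        have kX: "real K * \<kappa> \<le> X * \<kappa>" using KX \<kappa> by (intro mult_right_mono) auto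
        have "1 * \<kappa> \<le> X * \<kappa>" using X1 \<kappa> by (intro mult_right_mono) auto
        then show "real (nr s r (J ^ 2)) + 2 * real K * real V + (2 * real K + 1) * \<kappa> + 1 \<le> real K * real V * (4 * \<kappa> + 4)"
          using n kX X1 unfolding X_def by (simp add: algebra_simps)
      qed (use \<kappa> in simp)
      also have "\<dots> = (4 + 4 / \<kappa>) * real V / real K"
        using \<kappa> K1 by (simp add: field_simps power2_eq_square)
      also have "\<dots> \<le> 1 / (2 * (real P + 2))"
      proof -
        have "real V = (real P + 2) ^ 2" by (simp add: V_def add.commute)
        then have "c * (real P + 2) ^ 3 = (4 + 4 / \<kappa>) * real V * (2 * (real P + 2))"
          by (simp only: c_def power2_eq_square power3_eq_cube mult_ac)
        then have "(4 + 4 / \<kappa>) * real V * (2 * (real P + 2)) \<le> real K" using elim(4) by (simp add: P_def)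
        then show ?thesis using K1 by (simp add: pos_divide_le_eq pos_le_divide_eq)
      qed
      finally have "discrepancy_fun r \<xi> N \<le> 1 / (2 * (real P + 2)) + 1 / (2 * (real P + 2))" by simp
      also have "\<dots> = 1 / (real P + 2)" by (simp add: field_simps)
      also have "\<dots> \<le> 1 / (1 + real (itlog N))"
      proof -
        have "real N \<le> real (nr s r (Suc K ^ 2))" using N by simp
        also have "\<dots> \<le> real (Suc K ^ 2) * \<kappa> + 1" using nr_bounds(2)[OF s r, of "Suc K ^ 2"] by (simp add: \<kappa>_def)
        also have "\<dots> = (real K + 1) ^ 2 * \<kappa> + 1" by (simp add: add.commute)
        also have "\<dots> \<le> real (K ^ 5)" using elim(3) by simp
        finally have N5: "N \<le> K ^ 5" by (simp only: of_nat_le_iff)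
        have "4 \<le> \<kappa> * real K ^ 2" by (rule elim(2))
        also have "\<dots> \<le> real (nr s r (K ^ 2))" using nr_bounds(1)[OF s r, of "K ^ 2"] by (simp add: \<kappa>_def mult.commute)
        also have "\<dots> \<le> real N" using N by simp
        finally have "4 \<le> N" by simp
        then have "itlog N \<le> P + 1" using itlog_power5_le[of K N] N5 P by (simp add: P_def)
        then show ?thesis by (intro divide_left_mono) auto
      qed
      also have "\<dots> = real_of_rat (1 / of_nat (1 + itlog N))" by (simp add: of_rat_divide of_rat_add)
      finally show "discrepancy_fun r \<xi> N \<le> real_of_rat (1 / of_nat (1 + itlog N))" .
    qed
  qed
qed

end

theorem theorem4:
  fixes s :: nat
  assumes "is_base s"
  shows "\<exists>f :: nat \<Rightarrow> rat. computable_rat_fun f \<and> decreasing_to_0 f \<and>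
    (\<forall>g :: nat \<Rightarrow> rat. decreasing_to_0 g \<longrightarrow>
      (\<exists>\<xi> :: real. absolutely_normal \<xi> \<and>
         eventually_dominates (discrepancy_fun s \<xi>) (\<lambda>N. real_of_rat (g N)) \<and>
         (\<forall>r. is_base r \<and> mult_independent r s \<longrightarrow>
            eventually_dominates (\<lambda>N. real_of_rat (f N)) (discrepancy_fun r \<xi>)) \<and>
         real_computable_from g \<xi>))"
\<comment> \<open>The witness for \<open>f\<close> depends neither on \<open>g\<close> nor on
  \<open>s\<close>: the dependence on the bases and on the levels is absorbed by eventual
  domination.\<close>
proof (intro exI[of _ "\<lambda>n. 1 / of_nat (1 + itlog n)"] conjI allI impI)
  show "computable_rat_fun (\<lambda>n. 1 / of_nat (1 + itlog n))" by (rule computable_inverse_itlog)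
  show "decreasing_to_0 (\<lambda>n. 1 / of_nat (1 + itlog n))" by (rule decseq_inverse_itlog)
  fix g :: "nat \<Rightarrow> rat" assume g: "decreasing_to_0 g"
  interpret construction s g
    using assms g by unfold_locales (simp_all add: is_base_def)
  show "\<exists>\<xi>. absolutely_normal \<xi> \<and> eventually_dominates (discrepancy_fun s \<xi>) (\<lambda>N. real_of_rat (g N)) \<and>
         (\<forall>r. is_base r \<and> mult_independent r s \<longrightarrow>
            eventually_dominates (\<lambda>N. real_of_rat (1 / of_nat (1 + itlog N))) (discrepancy_fun r \<xi>)) \<and>
         real_computable_from g \<xi>"
    using absolutely_normal_\<xi> dominates_g dominated_by_inverse_itlog real_computable_\<xi>
    unfolding is_base_def by blast
qed

end
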